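(* Let $0<a<\frac12$, let $u_0$ be a datum as in the context, and let $U,\Omega$ and $u,\omega$ be the profiles and self-similar fields, respectively, supplied for $u_0$ by the vanishing-dissipation construction described in the context. Then $$U\,\Omega\in L^1_{\rm loc}(\mathbb R^2),$$ and the profile vorticity satisfies $$\Bigl(U-\frac{y}{1+a}\Bigr)\cdot\nabla\Omega=\Omega$$ in distributions on $\mathbb R^2$, i.e. for every $\psi\in C_c^\infty(\mathbb R^2)$, $$\int_{\mathbb R^2}\Omega\Bigl(U-\frac y{1+a}\Bigr)\cdot\nabla\psi\,dy=\Bigl(\frac2{1+a}-1\Bigr)\int_{\mathbb R^2}\Omega\,\psi\,dy.$$ Equivalently, the physical vorticity $\omega(t,x)=t^{-1}\Omega\bigl(t^{-\frac1{1+a}}x\bigr)$ satisfies $\partial_t\omega+u\cdot\nabla\omega=0$ in distributions on $\mathbb R^2\times(0,\infty)$ (where $u\cdot\nabla\omega=\operatorname{div}(u\,\omega)$).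
   Context: Notation: $\operatorname{curl}u=\partial_1u_2-\partial_2u_1$; $\Lambda=(-\Delta)^{1/2}$; $K(x)=\frac1{2\pi}\frac{x^\perp}{|x|^2}$ with $x^\perp=(-x_2,x_1)$; $L^{r,\infty}$ is weak-$L^r$ on $\mathbb R^2$; $p_c=\frac2{1+a}$, $q_c=\frac2a$. Weak-star convergence in $L^{r,\infty}$ ($1<r<\infty$) is with respect to the predual, the Lorentz space $L^{r',1}$, $\frac1r+\frac1{r'}=1$. Datum: $u_0(x)=|x|^{-a}\overline u_0(x/|x|)$ with $\overline u_0\in C^1(\mathbb S^1;\mathbb R^2)$ and $\operatorname{div}u_0=0$; $\omega_0=\operatorname{curl}u_0$. Construction of the profiles (carried out in the paper for every such datum and every $0<a<1$). For each $\epsilon\in(0,1]$ there is a smooth solution $(U_\epsilon,P_\epsilon)$ of $$\epsilon\Lambda^{1+a}U_\epsilon-\tfrac1{1+a}(aU_\epsilon+y\cdot\nabla U_\epsilon)+U_\epsilon\cdot\nabla U_\epsilon+\nabla P_\epsilon=0,\qquad \operatorname{div}U_\epsilon=0,$$ with $\Omega_\epsilon=\operatorname{curl}U_\epsilon$, $U_\epsilon=K*\Omega_\epsilon$, such that $t^{-\frac a{1+a}}U_\epsilon(t^{-\frac1{1+a}}\cdot)\to u_0$ weak-star in $L^{q_c,\infty}$ and $t^{-1}\Omega_\epsilon(t^{-\frac1{1+a}}\cdot)\to\omega_0$ weak-star in $L^{p_c,\infty}$ as $t\downarrow0$, and such that, uniformly in $\epsilon$, $\|\Omega_\epsilon\|_{L^{p_c,\infty}}\le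 C(a)\|\omega_0\|_{L^{p_c,\infty}}$ and $\|U_\epsilon\|_{L^{q_c,\infty}}+\|\nabla U_\epsilon\|_{L^{p_c,\infty}}+\|P_\epsilon\|_{L^{1/a,\infty}}\le C(a,u_0)$. The profiles $U,\Omega,P$ are the limits along a sequence $\epsilon_n\downarrow0$: $U_{\epsilon_n}\to U$ strongly in $L^2_{\rm loc}(\mathbb R^2)$, $\Omega_{\epsilon_n}\to\Omega$ weak-star in $L^{p_c,\infty}$, $P_{\epsilon_n}\to P$ weak-star in $L^{1/a,\infty}$, with $\Omega=\operatorname{curl}U$ and $U=K*\Omega$. Properties of these profiles established in the paper: $\operatorname{div}U=0$, $U\in L^{q_c,\infty}$, $\nabla U\in L^{p_c,\infty}$, $P\in L^{1/a,\infty}$, and $-\frac1{1+a}(aU+y\cdot\nabla U)+U\cdot\nabla U+\nabla P=0$ in distributions on $\mathbb R^2$. Self-similar fields: $u(t,x)=t^{-\frac a{1+a}}U(t^{-\frac1{1+a}}x)$ and $\omega(t,x)=t^{-1}\Omega(t^{-\frac1{1+a}}x)$ for $t>0$. The field $u\in C([0,\infty);L^2_{\rm loc}(\mathbb R^2))$ is a weak solution of the 2D incompressible Euler equations with $u(0)=u_0$ (that is, $\int_0^\infty\int(u\cdot\partial_t\varphi+(u\otimes u):\nabla\varphi)\,dx\,dt+\int u_0\cdot\varphi(\cdot,0)\,dx=0$ for all divergence-free $\varphi\in C_c^\infty(\mathbb R^2\times[0,\infty);\mathbb R^2)$), $\omega\in L^\infty((0,\infty);L^{p_c,\infty})$, and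 $\omega(t)\to\omega_0$ weak-star in $L^{p_c,\infty}$ as $t\downarrow0$. *)

theory Defs
  imports "HOL-Analysis.Analysis"
begin

text \<open>
  Elements of \<open>L\<^sup>1\<^sub>l\<^sub>o\<^sub>c\<close> and of the weak-\<open>L\<^sup>r\<close> and Lorentz spaces are represented by Borel functions
  on \<open>real ^ 2\<close>, and all integrals are taken with respect to \<^const>\<open>lborel\<close>.
\<close>


section \<open>Smooth functions, test functions, local integrability\<close>

primrec Ck :: "nat \<Rightarrow> ('a::euclidean_space \<Rightarrow> 'b::real_normed_vector) \<Rightarrow> bool" where
  "Ck 0 f \<longleftrightarrow> continuous_on UNIV f"
| "Ck (Suc k) f \<longleftrightarrow> (\<forall>x. f differentiable (at x)) \<and>
     (\<forall>b\<in>Basis. Ck k (\<lambda>x. frechet_derivative f (at x) b))"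

definition smooth :: "('a::euclidean_space \<Rightarrow> 'b::real_normed_vector) \<Rightarrow> bool" where
  "smooth f \<longleftrightarrow> (\<forall>k. Ck k f)"

text \<open>\<open>C\<^sub>c\<^sup>\<infinity>(X)\<close> for an open set \<open>X\<close>; its elements are functions on the whole space.\<close>
definition test_fun :: "'a::euclidean_space set \<Rightarrow> ('a \<Rightarrow> 'b::real_normed_vector) set" where
  "test_fun X = {\<phi>. smooth \<phi> \<and> compact (closure {x. \<phi> x \<noteq> 0}) \<and> closure {x. \<phi> x \<noteq> 0} \<subseteq> X}"

definition loc_integrable_on ::
  "'a::euclidean_space set \<Rightarrow> ('a \<Rightarrow> 'b::{banach, second_countable_topology}) \<Rightarrow> bool" where
  "loc_integrable_on X f \<longleftrightarrow> (\<forall>K. compact K \<and> K \<subseteq> X \<longrightarrow> set_integrable lborel K f)"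


section \<open>Differential operators, classical and in distributions\<close>

definition grad :: "(real ^ 2 \<Rightarrow> real) \<Rightarrow> real ^ 2 \<Rightarrow> real ^ 2" where
  "grad f x = (\<chi> i. frechet_derivative f (at x) (axis i 1))"

definition divergence :: "(real ^ 2 \<Rightarrow> real ^ 2) \<Rightarrow> real ^ 2 \<Rightarrow> real" where
  "divergence V x = trace (jacobian V (at x))"

definition curl :: "(real ^ 2 \<Rightarrow> real ^ 2) \<Rightarrow> real ^ 2 \<Rightarrow> real" where
  "curl V x = jacobian V (at x) $ 2 $ 1 - jacobian V (at x) $ 1 $ 2"

definition weak_div_free :: "(real ^ 2 \<Rightarrow> real ^ 2) \<Rightarrow> bool" where
  "weak_div_free V \<longleftrightarrow> loc_integrable_on UNIV V \<and>
     (\<forall>\<psi>\<in>test_fun UNIV. (\<integral>x. V x \<bullet> grad \<psi> x \<partial>lborel) = 0)"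

definition weak_curl :: "(real ^ 2 \<Rightarrow> real ^ 2) \<Rightarrow> (real ^ 2 \<Rightarrow> real) \<Rightarrow> bool" where
  "weak_curl V w \<longleftrightarrow> loc_integrable_on UNIV V \<and> loc_integrable_on UNIV w \<and>
     (\<forall>\<psi>\<in>test_fun UNIV. (\<integral>x. w x * \<psi> x \<partial>lborel) =
        - (\<integral>x. V x $ 2 * grad \<psi> x $ 1 - V x $ 1 * grad \<psi> x $ 2 \<partial>lborel))"

definition weak_jacobian :: "(real ^ 2 \<Rightarrow> real ^ 2) \<Rightarrow> (real ^ 2 \<Rightarrow> real ^ 2 ^ 2) \<Rightarrow> bool" where
  "weak_jacobian V G \<longleftrightarrow> loc_integrable_on UNIV V \<and> loc_integrable_on UNIV G \<and>
     (\<forall>\<psi>\<in>test_fun UNIV. \<forall>i j. (\<integral>x. G x $ i $ j * \<psi> x \<partial>lborel) =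
        - (\<integral>x. V x $ i * grad \<psi> x $ j \<partial>lborel))"


section \<open>Weak \<open>L\<^sup>r\<close>, the Lorentz space \<open>L\<^sup>s\<^sup>,\<^sup>1\<close>, and weak-star convergence\<close>

definition ennreal_powr :: "ennreal \<Rightarrow> real \<Rightarrow> ennreal" where
  "ennreal_powr m s = (if m = \<infinity> then \<infinity> else ennreal (enn2real m powr s))"

definition weakL_norm :: "real \<Rightarrow> (real ^ 2 \<Rightarrow> 'b::real_normed_vector) \<Rightarrow> ennreal" where
  "weakL_norm r f =
     (SUP l\<in>{0<..}. ennreal l * ennreal_powr (emeasure lborel {x. norm (f x) > l}) (1 / r))"

definition weakL :: "real \<Rightarrow> (real ^ 2 \<Rightarrow> 'b::real_normed_vector) set" where
  "weakL r = {f. f \<in> borel_measurable lborel \<and> weakL_norm r f < \<infinity>}"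

definition lorentz1 :: "real \<Rightarrow> (real ^ 2 \<Rightarrow> real) set" where
  "lorentz1 s = {g. g \<in> borel_measurable lborel \<and>
     (\<integral>\<^sup>+ l\<in>{0<..}. ennreal_powr (emeasure lborel {x. \<bar>g x\<bar> > l}) (1 / s) \<partial>lborel) < \<infinity>}"

text \<open>
  Weak-star convergence in \<open>L\<^sup>r\<^sup>,\<^sup>\<infinity>\<close>, for \<open>1 < r < \<infinity>\<close>; the exponent \<open>r / (r - 1)\<close> is conjugate to
  \<open>r\<close>. Pairing vector fields with all scalar \<open>g\<close> amounts to componentwise convergence.
\<close>
definition weak_star_tendsto ::
  "real \<Rightarrow> ('i \<Rightarrow> real ^ 2 \<Rightarrow> 'b::{banach, second_countable_topology}) \<Rightarrow>
   (real ^ 2 \<Rightarrow> 'b) \<Rightarrow> 'i filter \<Rightarrow> bool" where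
  "weak_star_tendsto r f l F \<longleftrightarrow>
     (\<forall>\<^sub>F i in F. f i \<in> weakL r) \<and> l \<in> weakL r \<and>
     (\<forall>g\<in>lorentz1 (r / (r - 1)).
        ((\<lambda>i. \<integral>x. g x *\<^sub>R f i x \<partial>lborel) \<longlongrightarrow> (\<integral>x. g x *\<^sub>R l x \<partial>lborel)) F)"

definition L2_loc_tendsto ::
  "('i \<Rightarrow> real ^ 2 \<Rightarrow> 'b::real_normed_vector) \<Rightarrow> (real ^ 2 \<Rightarrow> 'b) \<Rightarrow> 'i filter \<Rightarrow> bool" where
  "L2_loc_tendsto f l F \<longleftrightarrow>
     (\<forall>i. f i \<in> borel_measurable lborel) \<and> l \<in> borel_measurable lborel \<and>
     (\<forall>K. compact K \<longrightarrow> ((\<lambda>i. \<integral>\<^sup>+ x\<in>K. ennreal ((norm (f i x - l x))\<^sup>2) \<partial>lborel) \<longlongrightarrow> 0) F)"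


section \<open>Fractional Laplacian and Biot-Savart law\<close>

definition fourier :: "(real ^ 2 \<Rightarrow> real) \<Rightarrow> real ^ 2 \<Rightarrow> complex" where
  "fourier \<phi> \<xi> = (\<integral>x. cis (- (x \<bullet> \<xi>)) * of_real (\<phi> x) \<partial>lborel)"

text \<open>
  \<open>\<Lambda>\<^sup>s = (- \<Delta>)\<^sup>s\<^sup>/\<^sup>2\<close> on test functions, as the Fourier multiplier \<open>|\<xi>|\<^sup>s\<close>. The inverse Fourier
  integral is real, the multiplier being even and \<open>\<phi>\<close> real.
\<close>
definition Lambda_test :: "real \<Rightarrow> (real ^ 2 \<Rightarrow> real) \<Rightarrow> real ^ 2 \<Rightarrow> real" where
  "Lambda_test s \<phi> x =
     Re (\<integral>\<xi>. cis (x \<bullet> \<xi>) * of_real (norm \<xi> powr s) * fourier \<phi> \<xi> \<partial>lborel) / (2 * pi)\<^sup>2"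

text \<open>
  \<open>\<Lambda>\<^sup>s f = g\<close>, by duality with test functions. This covers fields with slow decay at infinity such
  as the profiles below, which are not square integrable:
  \<open>\<Lambda>\<^sup>s \<phi>\<close> is \<open>O(|x|\<^bsup>-2-s\<^esup>)\<close> at infinity.
\<close>
definition has_Lambda ::
  "real \<Rightarrow> (real ^ 2 \<Rightarrow> real ^ 2) \<Rightarrow> (real ^ 2 \<Rightarrow> real ^ 2) \<Rightarrow> bool" where
  "has_Lambda s f g \<longleftrightarrow> loc_integrable_on UNIV g \<and>
     (\<forall>\<phi>\<in>test_fun UNIV. integrable lborel (\<lambda>x. Lambda_test s \<phi> x *\<^sub>R f x) \<and>
        (\<integral>x. Lambda_test s \<phi> x *\<^sub>R f x \<partial>lborel) = (\<integral>x. \<phi> x *\<^sub>R g x \<partial>lborel))"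

definition perp :: "real ^ 2 \<Rightarrow> real ^ 2" where
  "perp x = vector [- x $ 2, x $ 1]"

definition biot_savart_kernel :: "real ^ 2 \<Rightarrow> real ^ 2" where
  "biot_savart_kernel x = (1 / (2 * pi * (norm x)\<^sup>2)) *\<^sub>R perp x"

definition biot_savart :: "(real ^ 2 \<Rightarrow> real ^ 2) \<Rightarrow> (real ^ 2 \<Rightarrow> real) \<Rightarrow> bool" where
  "biot_savart V w \<longleftrightarrow> (AE x in lborel.
     integrable lborel (\<lambda>y. w y *\<^sub>R biot_savart_kernel (x - y)) \<and>
     V x = (\<integral>y. w y *\<^sub>R biot_savart_kernel (x - y) \<partial>lborel))"


section \<open>Data, self-similar scaling, exponents\<close>

text \<open>
  A function on the unit circle is \<open>C\<^sup>1\<close> iff it is \<open>C\<^sup>1\<close> in the angle. The value at the origin, where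
  \<open>|x|\<^bsup>-a\<^esup>\<close> is not defined, is left open.
\<close>
definition homogeneous_datum :: "real \<Rightarrow> (real ^ 2 \<Rightarrow> real ^ 2) \<Rightarrow> bool" where
  "homogeneous_datum a u0 \<longleftrightarrow>
     (\<exists>ub :: real ^ 2 \<Rightarrow> real ^ 2.
        (\<lambda>\<theta>. ub (vector [cos \<theta>, sin \<theta>])) C1_differentiable_on UNIV \<and>
        (\<forall>x. x \<noteq> 0 \<longrightarrow> u0 x = norm x powr (- a) *\<^sub>R ub (x /\<^sub>R norm x))) \<and>
     weak_div_free u0"

definition p_c :: "real \<Rightarrow> real" where "p_c a = 2 / (1 + a)"

definition q_c :: "real \<Rightarrow> real" where "q_c a = 2 / a"

definition velocity_field ::
  "real \<Rightarrow> (real ^ 2 \<Rightarrow> real ^ 2) \<Rightarrow> real \<Rightarrow> real ^ 2 \<Rightarrow> real ^ 2" where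
  "velocity_field a U t x = t powr (- (a / (1 + a))) *\<^sub>R U (t powr (- (1 / (1 + a))) *\<^sub>R x)"

definition vorticity_field ::
  "real \<Rightarrow> (real ^ 2 \<Rightarrow> real) \<Rightarrow> real \<Rightarrow> real ^ 2 \<Rightarrow> real" where
  "vorticity_field a \<Omega> t x = t powr (- 1) * \<Omega> (t powr (- (1 / (1 + a))) *\<^sub>R x)"


section \<open>The vanishing-dissipation construction\<close>

definition dissipative_profile_eq ::
  "real \<Rightarrow> real \<Rightarrow> (real ^ 2 \<Rightarrow> real ^ 2) \<Rightarrow> (real ^ 2 \<Rightarrow> real) \<Rightarrow> bool" where
  "dissipative_profile_eq a \<epsilon> U P \<longleftrightarrow>
     (\<exists>L. has_Lambda (1 + a) U L \<and>
        (\<forall>y. \<epsilon> *\<^sub>R L y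
              - (1 / (1 + a)) *\<^sub>R (a *\<^sub>R U y + jacobian U (at y) *v y)
              + jacobian U (at y) *v U y + grad P y = 0)) \<and>
     (\<forall>y. divergence U y = 0)"

text \<open>
  \<open>C\<close> is the constant depending on \<open>a\<close> only, and \<open>C'\<close> the one depending on \<open>a\<close> and the datum.
\<close>
definition dissipative_profiles ::
  "(real \<Rightarrow> real) \<Rightarrow> (real \<Rightarrow> (real ^ 2 \<Rightarrow> real ^ 2) \<Rightarrow> real) \<Rightarrow> real \<Rightarrow>
   (real ^ 2 \<Rightarrow> real ^ 2) \<Rightarrow> (real ^ 2 \<Rightarrow> real) \<Rightarrow>
   (real \<Rightarrow> real ^ 2 \<Rightarrow> real ^ 2) \<Rightarrow> (real \<Rightarrow> real ^ 2 \<Rightarrow> real) \<Rightarrow> bool" where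
  "dissipative_profiles C C' a u0 \<omega>0 U\<epsilon> P\<epsilon> \<longleftrightarrow>
     (\<forall>\<epsilon>\<in>{0<..1}.
        smooth (U\<epsilon> \<epsilon>) \<and> smooth (P\<epsilon> \<epsilon>) \<and>
        dissipative_profile_eq a \<epsilon> (U\<epsilon> \<epsilon>) (P\<epsilon> \<epsilon>) \<and>
        biot_savart (U\<epsilon> \<epsilon>) (curl (U\<epsilon> \<epsilon>)) \<and>
        weak_star_tendsto (q_c a) (velocity_field a (U\<epsilon> \<epsilon>)) u0 (at_right 0) \<and>
        weak_star_tendsto (p_c a) (vorticity_field a (curl (U\<epsilon> \<epsilon>))) \<omega>0 (at_right 0) \<and>
        weakL_norm (p_c a) (curl (U\<epsilon> \<epsilon>)) \<le> ennreal (C a) * weakL_norm (p_c a) \<omega>0 \<and>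
        weakL_norm (q_c a) (U\<epsilon> \<epsilon>)
          + weakL_norm (p_c a) (\<lambda>y. jacobian (U\<epsilon> \<epsilon>) (at y))
          + weakL_norm (1 / a) (P\<epsilon> \<epsilon>) \<le> ennreal (C' a u0))"

definition vanishing_dissipation_limit ::
  "real \<Rightarrow> (real \<Rightarrow> real ^ 2 \<Rightarrow> real ^ 2) \<Rightarrow> (real \<Rightarrow> real ^ 2 \<Rightarrow> real) \<Rightarrow>
   (real ^ 2 \<Rightarrow> real ^ 2) \<Rightarrow> (real ^ 2 \<Rightarrow> real) \<Rightarrow> (real ^ 2 \<Rightarrow> real) \<Rightarrow> bool" where
  "vanishing_dissipation_limit a U\<epsilon> P\<epsilon> U \<Omega> P \<longleftrightarrow>
     (\<exists>e :: nat \<Rightarrow> real. (\<forall>n. e n \<in> {0<..1}) \<and> e \<longlonglongrightarrow> 0 \<and>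
        L2_loc_tendsto (\<lambda>n. U\<epsilon> (e n)) U sequentially \<and>
        weak_star_tendsto (p_c a) (\<lambda>n. curl (U\<epsilon> (e n))) \<Omega> sequentially \<and>
        weak_star_tendsto (1 / a) (\<lambda>n. P\<epsilon> (e n)) P sequentially) \<and>
     weak_curl U \<Omega> \<and> biot_savart U \<Omega>"

text \<open>
  The equation \<open>- (a U + y \<cdot> \<nabla>U) / (1 + a) + U \<cdot> \<nabla>U + \<nabla>P = 0\<close> in distributions, tested with a vector
  field \<open>\<phi>\<close>. All derivatives are moved to \<open>\<phi>\<close>:
  \<open>y \<cdot> \<nabla>U = div (U \<otimes> y) - 2 U\<close> (the dimension is 2) and, as \<open>U\<close> is divergence free,
  \<open>U \<cdot> \<nabla>U = div (U \<otimes> U)\<close>.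
\<close>
definition euler_profile_eq :: "real \<Rightarrow> (real ^ 2 \<Rightarrow> real ^ 2) \<Rightarrow> (real ^ 2 \<Rightarrow> real) \<Rightarrow> bool" where
  "euler_profile_eq a U P \<longleftrightarrow>
     (\<forall>\<phi> \<in> test_fun UNIV.
        (\<integral>y. - (1 / (1 + a)) * (a * (U y \<bullet> \<phi> y) - 2 * (U y \<bullet> \<phi> y) - U y \<bullet> (jacobian \<phi> (at y) *v y))
             - U y \<bullet> (jacobian \<phi> (at y) *v U y) - P y * divergence \<phi> y \<partial>lborel) = 0)"

definition euler_profile_properties ::
  "real \<Rightarrow> (real ^ 2 \<Rightarrow> real ^ 2) \<Rightarrow> (real ^ 2 \<Rightarrow> real) \<Rightarrow> bool" where
  "euler_profile_properties a U P \<longleftrightarrow>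
     weak_div_free U \<and> U \<in> weakL (q_c a) \<and>
     (\<exists>G. weak_jacobian U G \<and> G \<in> weakL (p_c a)) \<and>
     P \<in> weakL (1 / a) \<and> euler_profile_eq a U P"


section \<open>The transport equation in space-time\<close>

text \<open>
  \<open>\<partial>\<^sub>t w + div (v w) = 0\<close> in distributions on \<open>{(t, x). t > 0}\<close>, for \<open>w\<close> and \<open>v w\<close> locally integrable
  there. Nothing is required of the fields at times \<open>t \<le> 0\<close>, where \<open>\<phi>\<close> vanishes.
\<close>
definition weak_transport ::
  "(real \<Rightarrow> real ^ 2 \<Rightarrow> real ^ 2) \<Rightarrow> (real \<Rightarrow> real ^ 2 \<Rightarrow> real) \<Rightarrow> bool" where
  "weak_transport v w \<longleftrightarrow>
     loc_integrable_on ({0<..} \<times> UNIV) (\<lambda>(t, x). w t x) \<and>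
     loc_integrable_on ({0<..} \<times> UNIV) (\<lambda>(t, x). w t x *\<^sub>R v t x) \<and>
     (\<forall>\<phi>\<in>test_fun ({0<..} \<times> UNIV).
        (\<integral>(t, x). w t x * frechet_derivative \<phi> (at (t, x)) (1, 0)
                + w t x * frechet_derivative \<phi> (at (t, x)) (0, v t x) \<partial>lborel) = 0)"

end

theory Submission
  imports Defs
begin

text \<open>
  Testing the velocity equation with \<open>\<nabla>\<^sup>\<bottom>\<psi>\<close> removes the pressure and leaves the quadratic term
  \<open>\<integral> U \<cdot> D(\<nabla>\<^sup>\<bottom>\<psi>) U\<close>, and everything reduces to identifying it with \<open>- \<integral> \<Omega> U \<cdot> \<nabla>\<psi>\<close>. For the smooth
  divergence-free \<open>U\<^sub>\<epsilon>\<close> this is integration by parts. The left side passes to the limit by strong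
  \<open>L\<^sup>2\<^sub>l\<^sub>o\<^sub>c\<close> convergence. On the right, \<open>a < 1 / 2\<close> means \<open>p\<^sub>c > 4 / 3\<close> and \<open>q\<^sub>c > 4\<close>, and \<open>4 / 3\<close> and \<open>4\<close> are
  conjugate: so \<open>U \<cdot> \<nabla>\<psi>\<close> lies in the predual of weak \<open>L\<^bsup>p\<^sub>c\<^esup>\<close>, and interpolating \<open>U\<^sub>\<epsilon> - U\<close> between
  \<open>L\<^sup>2\<close> and weak \<open>L\<^bsup>q\<^sub>c\<^esup>\<close> makes \<open>\<Omega>\<^sub>\<epsilon> (U\<^sub>\<epsilon> - U)\<close> vanish in \<open>L\<^sup>1\<^sub>l\<^sub>o\<^sub>c\<close>.
\<close>

section \<open>Calculus of smooth functions\<close>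

text \<open>The obstacle is that \<Omega> lies only in weak L^p_c with p_c < 2, so strong L^2_loc
  convergence of the velocities alone cannot be paired with weak-star convergence of the
  vorticities. Since 1/p_c + 1/q_c = 1/2 + a, the condition a < 1/2 makes the product subcritical,
  and its strictness leaves room both for the interpolation and for replacing weak norms by local
  moments. The limit is taken in the identity between the two quadratic expressions rather than in
  the dissipative equation; the inviscid equation for \<open>U\<close> then supplies the dynamics.
  The dilation term is handled by a second scalar test function, y . \<nabla>\<psi>, whose rotated
  gradient is that of \<psi> plus the derivative of the latter in direction y. Every linear term
  thereby becomes the curl of \<open>U\<close> tested against a scalar. In space-time, x = t^b y
  with b = 1/(1+a) makes \<Omega> independent of time. On each time slice the profile equation gives
  the transport integrand the same integral as \<Omega>(y) times an exact time derivative, and this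
  vanishes after integration in time.\<close>

lemma frechet_derivative_eq:
  "(f has_derivative f') (at x) \<Longrightarrow> frechet_derivative f (at x) = f'"
  by (rule frechet_derivative_at[symmetric])

lemma has_frechet_derivative:
  "f differentiable (at x) \<Longrightarrow> (f has_derivative frechet_derivative f (at x)) (at x)"
  by (simp add: frechet_derivative_works[symmetric])

lemma Ck_SucI:
  assumes "\<And>x. (f has_derivative f' x) (at x)" "\<And>b. b \<in> Basis \<Longrightarrow> Ck k (\<lambda>x. f' x b)"
  shows "Ck (Suc k) f"
proof -
  have "(\<lambda>x. frechet_derivative f (at x) b) = (\<lambda>x. f' x b)" for b
    using frechet_derivative_eq[OF assms(1)] by simp
  then show ?thesis
    using assms by (auto simp: differentiable_def)
qed

lemma Ck_SucD:
  assumes "Ck (Suc k) f"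
  shows "(f has_derivative frechet_derivative f (at x)) (at x)"
    and "b \<in> Basis \<Longrightarrow> Ck k (\<lambda>x. frechet_derivative f (at x) b)"
  using assms has_frechet_derivative by auto

lemma Ck_Suc_imp_Ck: "Ck (Suc k) f \<Longrightarrow> Ck k f"
proof (induction k arbitrary: f)
  case 0
  then show ?case
    by (auto intro!: continuous_at_imp_continuous_on differentiable_imp_continuous_within)
next
  case (Suc k)
  show ?case
    by (rule Ck_SucI[OF Ck_SucD(1)[OF Suc.prems]]) (rule Suc.IH[OF Ck_SucD(2)[OF Suc.prems]])
qed

lemma Ck_const: "Ck k (\<lambda>_. c)"
proof (induction k arbitrary: c)
  case (Suc k)
  show ?case by (rule Ck_SucI[where f' = "\<lambda>_ _. 0"]) (auto simp: Suc)
qed simp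

lemma Ck_bounded_linear:
  assumes "bounded_linear L" shows "Ck k L"
proof (cases k)
  case 0
  then show ?thesis
    using assms linear_continuous_on by auto
next
  case (Suc k)
  show ?thesis unfolding Suc
    by (rule Ck_SucI[where f' = "\<lambda>_. L"]) (auto intro: bounded_linear_imp_has_derivative[OF assms] Ck_const)
qed

lemma Ck_bounded_linear_comp:
  assumes "bounded_linear L" shows "Ck k f \<Longrightarrow> Ck k (\<lambda>x. L (f x))"
proof (induction k arbitrary: f)
  case 0
  then show ?case
    using bounded_linear.continuous_on[OF assms] by auto
next
  case (Suc k)
  show ?case
    by (rule Ck_SucI[where f' = "\<lambda>x h. L (frechet_derivative f (at x) h)"])
      (auto intro: bounded_linear.has_derivative[OF assms Ck_SucD(1)[OF Suc.prems]]
        Suc.IH Ck_SucD(2)[OF Suc.prems])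
qed

lemma Ck_add: "Ck k f \<Longrightarrow> Ck k g \<Longrightarrow> Ck k (\<lambda>x. f x + g x)"
proof (induction k arbitrary: f g)
  case 0
  then show ?case by (auto intro: continuous_intros)
next
  case (Suc k)
  show ?case
    by (rule Ck_SucI[OF has_derivative_add[OF Ck_SucD(1)[OF Suc.prems(1)] Ck_SucD(1)[OF Suc.prems(2)]]])
      (intro Suc.IH Ck_SucD(2)[OF Suc.prems(1)] Ck_SucD(2)[OF Suc.prems(2)])
qed

lemma Ck_sum: "(\<And>i. i \<in> I \<Longrightarrow> Ck k (f i)) \<Longrightarrow> Ck k (\<lambda>x. \<Sum>i\<in>I. f i x)"
  by (induction I rule: infinite_finite_induct) (auto intro: Ck_const Ck_add)

lemma Ck_bilinear:
  assumes "bounded_bilinear p"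
  shows "Ck k f \<Longrightarrow> Ck k g \<Longrightarrow> Ck k (\<lambda>x. p (f x) (g x))"
proof (induction k arbitrary: f g)
  case 0
  then show ?case by (auto intro: bounded_bilinear.continuous_on[OF assms])
next
  case (Suc k)
  show ?case
    by (rule Ck_SucI[OF bounded_bilinear.FDERIV[OF assms Ck_SucD(1)[OF Suc.prems(1)] Ck_SucD(1)[OF Suc.prems(2)]]])
      (intro Ck_add Suc.IH Ck_SucD(2)[OF Suc.prems(1)] Ck_SucD(2)[OF Suc.prems(2)]
         Ck_Suc_imp_Ck[OF Suc.prems(1)] Ck_Suc_imp_Ck[OF Suc.prems(2)])
qed

lemma linear_Basis_expansion:
  fixes h :: "'a::euclidean_space"
  assumes "linear L" shows "L h = (\<Sum>d\<in>Basis. (h \<bullet> d) *\<^sub>R L d)"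
proof -
  have "L h = L (\<Sum>d\<in>Basis. (h \<bullet> d) *\<^sub>R d)" by (simp add: euclidean_representation)
  also have "\<dots> = (\<Sum>d\<in>Basis. (h \<bullet> d) *\<^sub>R L d)"
    using assms by (simp add: linear_sum linear_cmul)
  finally show ?thesis .
qed

lemma Ck_affine_comp:
  fixes A :: "'a::euclidean_space \<Rightarrow> 'b::euclidean_space"
  assumes A: "bounded_linear A"
  shows "Ck k f \<Longrightarrow> Ck k (\<lambda>x. f (c + A x))"
proof (induction k arbitrary: f)
  case 0
  then show ?case
    using bounded_linear.continuous_on[OF A continuous_on_id]
    by (auto intro!: continuous_on_compose2[of UNIV f] continuous_on_add)
next
  case (Suc k)
  \<comment> \<open>The chain rule produces the derivative of \<open>f\<close> in direction
    \<open>A h\<close>, whereas the induction hypothesis speaks of partials along basis vectors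
    only; hence the expansion of \<open>A h\<close> in the basis.\<close>
  have D: "((\<lambda>x. f (c + A x)) has_derivative
     (\<lambda>h. \<Sum>d\<in>Basis. (A h \<bullet> d) *\<^sub>R frechet_derivative f (at (c + A x)) d)) (at x)" for x
  proof -
    have "((\<lambda>x. c + A x) has_derivative A) (at x)"
      using bounded_linear_imp_has_derivative[OF A] by (auto intro!: derivative_eq_intros)
    from has_derivative_compose[OF this Ck_SucD(1)[OF Suc.prems]]
    show ?thesis
      by (rule has_derivative_eq_rhs)
        (rule ext, rule linear_Basis_expansion, rule has_derivative_linear[OF Ck_SucD(1)[OF Suc.prems]])
  qed
  show ?case
    by (rule Ck_SucI[OF D])
      (intro Ck_sum Ck_bounded_linear_comp[OF bounded_linear_scaleR_right] Suc.IH Ck_SucD(2)[OF Suc.prems])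
qed

lemma smooth_Ck: "smooth f \<Longrightarrow> Ck k f"
  by (simp add: smooth_def)

lemma smooth_has_derivative:
  "smooth f \<Longrightarrow> (f has_derivative frechet_derivative f (at x)) (at x)"
  using Ck_SucD(1)[OF smooth_Ck[where k = "Suc 0"]] .

lemma smooth_continuous_on: "smooth f \<Longrightarrow> continuous_on S f"
  using smooth_Ck[where k = 0 and f = f] by (auto intro: continuous_on_subset)

lemma smooth_partial: "smooth f \<Longrightarrow> b \<in> Basis \<Longrightarrow> smooth (\<lambda>x. frechet_derivative f (at x) b)"
  unfolding smooth_def using Ck_SucD(2) by blast

lemma smooth_bounded_linear_comp: "bounded_linear L \<Longrightarrow> smooth f \<Longrightarrow> smooth (\<lambda>x. L (f x))"
  by (simp add: smooth_def Ck_bounded_linear_comp)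

lemma smooth_bounded_linear: "bounded_linear L \<Longrightarrow> smooth L"
  by (simp add: smooth_def Ck_bounded_linear)

lemma smooth_add: "smooth f \<Longrightarrow> smooth g \<Longrightarrow> smooth (\<lambda>x. f x + g x)"
  by (simp add: smooth_def Ck_add)

lemma smooth_sum: "(\<And>i. i \<in> I \<Longrightarrow> smooth (f i)) \<Longrightarrow> smooth (\<lambda>x. \<Sum>i\<in>I. f i x)"
  by (simp add: smooth_def Ck_sum)

lemma smooth_bilinear:
  "bounded_bilinear p \<Longrightarrow> smooth f \<Longrightarrow> smooth g \<Longrightarrow> smooth (\<lambda>x. p (f x) (g x))"
  by (simp add: smooth_def Ck_bilinear)

lemma smooth_affine_comp:
  "bounded_linear A \<Longrightarrow> smooth f \<Longrightarrow> smooth (\<lambda>x. f (c + A x))"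
  by (simp add: smooth_def Ck_affine_comp)

lemma smooth_frechet_derivative:
  fixes f :: "'a::euclidean_space \<Rightarrow> 'b::real_normed_vector"
  assumes "smooth f"
  shows "smooth (\<lambda>x. frechet_derivative f (at x) h)"
proof -
  have "(\<lambda>x. frechet_derivative f (at x) h)
      = (\<lambda>x. \<Sum>d\<in>Basis. (h \<bullet> d) *\<^sub>R frechet_derivative f (at x) d)"
    by (rule ext, rule linear_Basis_expansion,
        rule has_derivative_linear[OF smooth_has_derivative[OF assms]])
  then show ?thesis
    using assms by (auto intro!: smooth_sum smooth_bounded_linear_comp[OF bounded_linear_scaleR_right] smooth_partial)
qed

section \<open>Directional derivatives and the symmetry of second derivatives\<close>

lemma partial_along_line:
  assumes "smooth f"
  shows "((\<lambda>r. f (x + r *\<^sub>R b)) has_vector_derivative frechet_derivative f (at (x + r *\<^sub>R b)) b) (at r)"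
proof -
  have "((\<lambda>r. x + r *\<^sub>R b) has_vector_derivative b) (at r)"
    by (auto intro!: derivative_eq_intros)
  from vector_derivative_diff_chain_within[OF this, of f "frechet_derivative f (at (x + r *\<^sub>R b))"]
  show ?thesis
    using has_derivative_at_withinI[OF smooth_has_derivative[OF assms]] by (simp add: o_def)
qed

text \<open>Mean value theorem first along \<open>b\<close>, then along \<open>c\<close>; the left side is symmetric in \<open>b\<close> and \<open>c\<close>.\<close>
lemma second_difference:
  fixes f :: "'a::euclidean_space \<Rightarrow> real"
  assumes f: "smooth f" and s: "0 < s"
  shows "\<exists>r1 r2. 0 < r1 \<and> r1 < s \<and> 0 < r2 \<and> r2 < s \<and>
     f (x + s *\<^sub>R b + s *\<^sub>R c) - f (x + s *\<^sub>R b) - f (x + s *\<^sub>R c) + f x =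
     s\<^sup>2 * frechet_derivative (\<lambda>y. frechet_derivative f (at y) b) (at (x + r1 *\<^sub>R b + r2 *\<^sub>R c)) c"
proof -
  let ?g = "\<lambda>r. f ((x + s *\<^sub>R c) + r *\<^sub>R b) - f (x + r *\<^sub>R b)"
  let ?fb = "\<lambda>y. frechet_derivative f (at y) b"
  have "\<exists>z. 0 < z \<and> z < s \<and> ?g s - ?g 0 = (s - 0) * (?fb ((x + s *\<^sub>R c) + z *\<^sub>R b) - ?fb (x + z *\<^sub>R b))"
    by (rule MVT2[OF s])
      (use partial_along_line[OF f] in \<open>auto simp: has_real_derivative_iff_has_vector_derivative
         intro!: has_vector_derivative_diff\<close>)
  then obtain r1 where r1: "0 < r1" "r1 < s"
    "?g s - ?g 0 = s * (?fb ((x + s *\<^sub>R c) + r1 *\<^sub>R b) - ?fb (x + r1 *\<^sub>R b))" by auto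
  let ?h = "\<lambda>r. ?fb ((x + r1 *\<^sub>R b) + r *\<^sub>R c)"
  have "\<exists>z. 0 < z \<and> z < s \<and> ?h s - ?h 0 = (s - 0) * frechet_derivative ?fb (at ((x + r1 *\<^sub>R b) + z *\<^sub>R c)) c"
    by (rule MVT2[OF s])
      (use partial_along_line[OF smooth_frechet_derivative[OF f]]
       in \<open>auto simp: has_real_derivative_iff_has_vector_derivative\<close>)
  then obtain r2 where r2: "0 < r2" "r2 < s"
    "?h s - ?h 0 = s * frechet_derivative ?fb (at ((x + r1 *\<^sub>R b) + r2 *\<^sub>R c)) c" by auto
  have "?g s - ?g 0 = s * (?h s - ?h 0)"
    using r1(3) by (simp add: algebra_simps)
  then show ?thesis
    using r1 r2 by (intro exI[of _ r1] exI[of _ r2]) (simp add: power2_eq_square algebra_simps)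
qed

text \<open>The second difference divided by s^2 equals an iterated partial at a point near
  \<open>x\<close>, so by continuity it tends to that partial at \<open>x\<close>. Exchanging
  \<open>b\<close> and \<open>c\<close> leaves the quotient unchanged but yields the other order of
  differentiation.\<close>

lemma mixed_partials_commute:
  fixes f :: "'a::euclidean_space \<Rightarrow> real"
  assumes f: "smooth f"
  shows "frechet_derivative (\<lambda>y. frechet_derivative f (at y) b) (at x) c
       = frechet_derivative (\<lambda>y. frechet_derivative f (at y) c) (at x) b"
proof -
  define s where "s n = 1 / real (Suc n)" for n
  have s: "s n > 0" for n by (simp add: s_def)
  have s0: "s \<longlonglongrightarrow> 0" unfolding s_def using LIMSEQ_inverse_real_of_nat by (simp add: inverse_eq_divide)
  let ?D = "\<lambda>b c y. frechet_derivative (\<lambda>y. frechet_derivative f (at y) b) (at y) c"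
  let ?Q = "\<lambda>n. (f (x + s n *\<^sub>R b + s n *\<^sub>R c) - f (x + s n *\<^sub>R b) - f (x + s n *\<^sub>R c) + f x) / (s n)\<^sup>2"
  let ?Q' = "\<lambda>n. (f (x + s n *\<^sub>R c + s n *\<^sub>R b) - f (x + s n *\<^sub>R c) - f (x + s n *\<^sub>R b) + f x) / (s n)\<^sup>2"
  have lim: "(\<lambda>n. (f (x + s n *\<^sub>R b + s n *\<^sub>R c) - f (x + s n *\<^sub>R b) - f (x + s n *\<^sub>R c) + f x) / (s n)\<^sup>2) \<longlonglongrightarrow> ?D b c x" for b c
  proof -
    obtain r1 r2 where r: "\<And>n. 0 < r1 n" "\<And>n. r1 n < s n" "\<And>n. 0 < r2 n" "\<And>n. r2 n < s n" and
      eq: "\<And>n. f (x + s n *\<^sub>R b + s n *\<^sub>R c) - f (x + s n *\<^sub>R b) - f (x + s n *\<^sub>R c) + f x =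
        (s n)\<^sup>2 * ?D b c (x + r1 n *\<^sub>R b + r2 n *\<^sub>R c)"
      using second_difference[OF f s, where x = x and b = b and c = c] by metis
    have "r1 \<longlonglongrightarrow> 0" "r2 \<longlonglongrightarrow> 0"
      using tendsto_sandwich[OF _ _ tendsto_const s0] r(1-4) less_imp_le
      by (metis (no_types, lifting) eventually_sequentiallyI)+
    then have "(\<lambda>n. x + r1 n *\<^sub>R b + r2 n *\<^sub>R c) \<longlonglongrightarrow> x + 0 *\<^sub>R b + 0 *\<^sub>R c"
      by (intro tendsto_intros)
    moreover have "isCont (?D b c) x"
      using smooth_continuous_on[OF smooth_frechet_derivative[OF smooth_frechet_derivative[OF f]], of UNIV b c]
      by (simp add: continuous_on_eq_continuous_at)
    ultimately have "(\<lambda>n. ?D b c (x + r1 n *\<^sub>R b + r2 n *\<^sub>R c)) \<longlonglongrightarrow> ?D b c x"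
      using isCont_tendsto_compose by fastforce
    moreover have "(\<lambda>n. (f (x + s n *\<^sub>R b + s n *\<^sub>R c) - f (x + s n *\<^sub>R b) - f (x + s n *\<^sub>R c) + f x) / (s n)\<^sup>2)
      = (\<lambda>n. ?D b c (x + r1 n *\<^sub>R b + r2 n *\<^sub>R c))"
      using s by (auto simp: eq less_imp_neq[THEN not_sym])
    ultimately show ?thesis by simp
  qed
  have "?Q = ?Q'" by (simp add: algebra_simps)
  then show ?thesis
    using LIMSEQ_unique[OF lim[of b c]] lim[of c b] by simp
qed

section \<open>Test functions and vector calculus in the plane\<close>

lemma smooth_mult: "smooth f \<Longrightarrow> smooth g \<Longrightarrow> smooth (\<lambda>x. f x * (g x :: real))"
  by (rule smooth_bilinear[OF bounded_bilinear_mult])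

lemma smooth_minus: "smooth f \<Longrightarrow> smooth (\<lambda>x. - f x)"
  by (rule smooth_bounded_linear_comp[OF bounded_linear_minus[OF bounded_linear_ident]])

lemma smooth_component: "smooth f \<Longrightarrow> smooth (\<lambda>x. f x $ i)"
  by (rule smooth_bounded_linear_comp[OF bounded_linear_vec_nth])

lemma test_fun_smooth: "f \<in> test_fun X \<Longrightarrow> smooth f"
  by (simp add: test_fun_def)

lemma test_fun_UNIV_iff: "f \<in> test_fun UNIV \<longleftrightarrow> smooth f \<and> bounded {x. f x \<noteq> 0}"
  by (auto simp: test_fun_def)

text \<open>The inclusion asks for the closed support of \<open>f\<close> only, so that it applies
  to derivatives of \<open>f\<close> and to their products with arbitrary smooth functions, which
  may be nonzero where \<open>f\<close> itself vanishes.\<close>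

lemma test_fun_subset:
  assumes f: "f \<in> test_fun X" and g: "smooth g" and sub: "{x. g x \<noteq> 0} \<subseteq> closure {x. f x \<noteq> 0}"
  shows "g \<in> test_fun X"
proof -
  have "closure {x. g x \<noteq> 0} \<subseteq> closure {x. f x \<noteq> 0}"
    using sub by (simp add: closure_minimal)
  moreover have "bounded {x. g x \<noteq> 0}"
    using f bounded_subset[OF bounded_closure sub] by (simp add: test_fun_def)
  ultimately show ?thesis
    using f g by (auto simp: test_fun_def)
qed

lemma frechet_derivative_outside_support:
  assumes "x \<notin> closure {x. f x \<noteq> 0}"
  shows "frechet_derivative f (at x) = (\<lambda>_. 0)"
proof -
  have "(f has_derivative (\<lambda>_. 0)) (at x)"
    by (rule has_derivative_transform_within_open[of "\<lambda>_. 0" _ _ _ "- closure {x. f x \<noteq> 0}"])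
      (use assms closure_subset[of "{x. f x \<noteq> 0}"] in auto)
  then show ?thesis by (rule frechet_derivative_eq)
qed

lemma test_fun_frechet_derivative:
  assumes "f \<in> test_fun X"
  shows "(\<lambda>x. frechet_derivative f (at x) h) \<in> test_fun X"
proof (rule test_fun_subset[OF assms])
  show "{x. frechet_derivative f (at x) h \<noteq> 0} \<subseteq> closure {x. f x \<noteq> 0}"
    using frechet_derivative_outside_support[where f = f] by force
qed (use assms in \<open>auto intro: smooth_frechet_derivative test_fun_smooth\<close>)

lemma test_fun_bounded_range:
  assumes "f \<in> test_fun X" shows "\<exists>M>0. \<forall>x. norm (f x) \<le> M"
proof -
  let ?S = "closure {x. f x \<noteq> 0}"
  have "compact ?S" using assms by (auto simp: test_fun_def)
  then have "bounded (f ` ?S)"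
    using assms by (intro compact_imp_bounded compact_continuous_image smooth_continuous_on test_fun_smooth)
  then obtain M where "M > 0" "\<And>x. x \<in> ?S \<Longrightarrow> norm (f x) \<le> M"
    by (auto simp: bounded_pos)
  moreover have "norm (f x) \<le> M" if "x \<notin> ?S" for x
    using that closure_subset[of "{x. f x \<noteq> 0}"] \<open>M > 0\<close> by (cases "f x = 0") auto
  ultimately show ?thesis by metis
qed

lemma test_fun_borel: "f \<in> test_fun X \<Longrightarrow> f \<in> borel_measurable borel"
  by (intro borel_measurable_continuous_onI smooth_continuous_on test_fun_smooth)

lemma test_fun_integrable:
  fixes f :: "'a::euclidean_space \<Rightarrow> real"
  assumes "f \<in> test_fun X" shows "integrable lborel f"
proof -
  let ?S = "closure {x. f x \<noteq> 0}"
  have "integrable lborel (\<lambda>x. indicator ?S x *\<^sub>R f x)"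
    by (intro borel_integrable_compact smooth_continuous_on)
      (use assms in \<open>auto simp: test_fun_def\<close>)
  moreover have "(\<lambda>x. indicator ?S x *\<^sub>R f x) = f"
    using closure_subset[of "{x. f x \<noteq> 0}"] by (auto simp: indicator_def fun_eq_iff)
  ultimately show ?thesis by simp
qed

text \<open>By translation invariance the difference quotients of \<open>f\<close> have integral zero.\<close>
lemma test_fun_integral_derivative:
  fixes f :: "'a::euclidean_space \<Rightarrow> real"
  assumes f: "f \<in> test_fun UNIV"
  shows "(\<integral>x. frechet_derivative f (at x) b \<partial>lborel) = 0"
proof -
  define s where "s n = 1 / real (Suc n)" for n
  have s: "0 < s n" "s n \<le> 1" for n by (auto simp: s_def)
  have s0: "s \<longlonglongrightarrow> 0" unfolding s_def using LIMSEQ_inverse_real_of_nat by (simp add: inverse_eq_divide)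
  let ?d = "\<lambda>x. frechet_derivative f (at x) b"
  let ?q = "\<lambda>n x. (f (x + s n *\<^sub>R b) - f x) / s n"
  have d: "((\<lambda>r. f (x + r *\<^sub>R b)) has_real_derivative ?d (x + r *\<^sub>R b)) (at r)" for x r
    using partial_along_line[OF test_fun_smooth[OF f], of x b r]
    by (simp add: has_real_derivative_iff_has_vector_derivative)
  obtain M where M: "\<And>x. \<bar>?d x\<bar> \<le> M"
    using test_fun_bounded_range[OF test_fun_frechet_derivative[OF f, of b]] by auto
  obtain R where R: "\<And>x. f x \<noteq> 0 \<Longrightarrow> norm x \<le> R"
    using f by (auto simp: test_fun_UNIV_iff bounded_iff)
  have fb [measurable]: "f \<in> borel_measurable borel" using test_fun_borel[OF f] .
  have int: "integrable lborel f" using test_fun_integrable[OF f] .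
  have shift: "integrable lborel (\<lambda>x. f (x + c)) \<and> (\<integral>x. f (x + c) \<partial>lborel) = (\<integral>x. f x \<partial>lborel)" for c
  proof -
    have "lborel = distr lborel borel ((+) c)" by (simp add: lborel_distr_plus)
    then have "integrable (distr lborel borel ((+) c)) f"
      "integral\<^sup>L lborel f = integral\<^sup>L (distr lborel borel ((+) c)) f"
      using int by simp_all
    then show ?thesis
      by (simp add: integral_distr integrable_distr_eq add.commute)
  qed
  have "(\<lambda>n. \<integral>x. ?q n x \<partial>lborel) \<longlonglongrightarrow> (\<integral>x. ?d x \<partial>lborel)"
  \<comment> \<open>The mean value theorem bounds the quotients by the bound \<open>M\<close> of the
    derivative. The steps \<open>s n\<close> are at most 1, so the quotients vanish outside the
    radius \<open>R\<close> of the support enlarged by \<open>norm b\<close>.\<close>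
  proof (rule integral_dominated_convergence[where w = "\<lambda>x. indicator (cball 0 (R + norm b)) x *\<^sub>R M"])
    show "?d \<in> borel_measurable lborel" 
      using test_fun_borel[OF test_fun_frechet_derivative[OF f, of b]] by simp
    show "integrable lborel (\<lambda>x. indicator (cball 0 (R + norm b)) x *\<^sub>R M)"
      by (rule borel_integrable_compact) auto
    show "AE x in lborel. (\<lambda>n. ?q n x) \<longlonglongrightarrow> ?d x"
    proof (rule AE_I2)
      fix x
      have "filterlim s (at 0) sequentially"
        using s0 s(1) by (auto simp: filterlim_at less_imp_neq[THEN not_sym])
      from filterlim_compose[OF d[of x 0, unfolded DERIV_def] this]
      show "(\<lambda>n. ?q n x) \<longlonglongrightarrow> ?d x" by simp
    qed
    show "AE x in lborel. norm (?q n x) \<le> indicator (cball 0 (R + norm b)) x *\<^sub>R M" for n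
    proof (rule AE_I2)
      fix x
      show "norm (?q n x) \<le> indicator (cball 0 (R + norm b)) x *\<^sub>R M"
      proof (cases "norm x \<le> R + norm b")
        case True
        have "\<exists>z. 0 < z \<and> z < s n \<and> f (x + s n *\<^sub>R b) - f (x + 0 *\<^sub>R b) = (s n - 0) * ?d (x + z *\<^sub>R b)"
          by (rule MVT2[OF s(1) d])
        then obtain z where "f (x + s n *\<^sub>R b) - f x = s n * ?d (x + z *\<^sub>R b)" by auto
        then show ?thesis using s(1)[of n] M True by (simp add: indicator_def)
      next
        case False
        have "norm x \<le> norm (x + s n *\<^sub>R b) + norm (s n *\<^sub>R b)"
          using norm_triangle_ineq4[of "x + s n *\<^sub>R b" "s n *\<^sub>R b"] by simp
        also have "norm (s n *\<^sub>R b) \<le> norm b"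
          using s[of n] by (simp add: mult_left_le_one_le)
        finally have "\<not> norm (x + s n *\<^sub>R b) \<le> R" "\<not> norm x \<le> R"
          using False norm_ge_zero[of b] by linarith+
        then have "f (x + s n *\<^sub>R b) = 0" "f x = 0" using R by blast+
        then show ?thesis using False by simp
      qed
    qed
  qed simp
  moreover have "(\<integral>x. ?q n x \<partial>lborel) = 0" for n
    using shift[of "s n *\<^sub>R b"] int by (simp add: Bochner_Integration.integral_diff)
  ultimately show ?thesis using s(1) by (simp add: LIMSEQ_const_iff less_imp_neq[THEN not_sym])
qed

section \<open>Gradient, rotated gradient, divergence and curl in coordinates\<close>

lemma grad_component: "grad \<psi> x $ i = frechet_derivative \<psi> (at x) (axis i 1)"
  by (simp add: grad_def)

lemma frechet_derivative_axis_sum: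
  fixes f :: "real ^ 2 \<Rightarrow> 'b::real_normed_vector"
  assumes "smooth f"
  shows "frechet_derivative f (at x) h =
    (h $ 1) *\<^sub>R frechet_derivative f (at x) (axis 1 1) + (h $ 2) *\<^sub>R frechet_derivative f (at x) (axis 2 1)"
proof -
  have lin: "linear (frechet_derivative f (at x))"
    by (rule has_derivative_linear[OF smooth_has_derivative[OF assms]])
  have "h = (h $ 1) *\<^sub>R axis 1 1 + (h $ 2) *\<^sub>R axis 2 1"
    by (simp add: vec_eq_iff forall_2 axis_def)
  then show ?thesis
    using linear_add[OF lin] linear_cmul[OF lin] by metis
qed

lemma frechet_derivative_grad:
  assumes "smooth \<psi>"
  shows "frechet_derivative \<psi> (at x) h = h \<bullet> grad \<psi> x"
  using frechet_derivative_axis_sum[OF assms, of x h] by (simp add: grad_def inner_vec_def sum_2)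

lemma perp_eq: "perp x = (- x $ 2) *\<^sub>R axis 1 1 + (x $ 1) *\<^sub>R axis 2 1"
  by (simp add: perp_def vec_eq_iff forall_2 axis_def)

lemma perp_component: "perp x $ 1 = - x $ 2" "perp x $ 2 = x $ 1"
  by (simp_all add: perp_def)

lemma bounded_linear_perp: "bounded_linear perp"
  unfolding linear_conv_bounded_linear[symmetric]
  by (rule linearI) (auto simp: perp_def vec_eq_iff forall_2)

lemma smooth_grad:
  assumes "smooth \<psi>" shows "smooth (grad \<psi>)"
proof -
  have "grad \<psi> = (\<lambda>x. frechet_derivative \<psi> (at x) (axis 1 1) *\<^sub>R axis 1 1
      + frechet_derivative \<psi> (at x) (axis 2 1) *\<^sub>R axis 2 1)"
    by (auto simp: grad_def vec_eq_iff forall_2 axis_def)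
  then show ?thesis
    using assms by (auto intro!: smooth_add smooth_bounded_linear_comp[OF bounded_linear_scaleR_left]
        smooth_frechet_derivative)
qed

lemma test_fun_grad: 
  assumes "\<psi> \<in> test_fun X" shows "grad \<psi> \<in> test_fun X"
proof (rule test_fun_subset[OF assms])
  show "{x. grad \<psi> x \<noteq> 0} \<subseteq> closure {x. \<psi> x \<noteq> 0}"
    using frechet_derivative_outside_support by (fastforce simp: grad_def vec_eq_iff)
qed (use assms test_fun_smooth in \<open>auto intro: smooth_grad\<close>)

lemma test_fun_perp_grad: 
  assumes "\<psi> \<in> test_fun X" shows "(\<lambda>x. perp (grad \<psi> x)) \<in> test_fun X"
proof (rule test_fun_subset[OF test_fun_grad[OF assms]])
  show "{x. perp (grad \<psi> x) \<noteq> 0} \<subseteq> closure {x. grad \<psi> x \<noteq> 0}"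
    using closure_subset by (fastforce simp: linear_0[OF bounded_linear.linear[OF bounded_linear_perp]])
qed (use assms test_fun_smooth in \<open>auto intro: smooth_grad smooth_bounded_linear_comp[OF bounded_linear_perp]\<close>)

lemma jacobian_mult:
  fixes V :: "real ^ 'n \<Rightarrow> real ^ 'm"
  assumes "smooth V"
  shows "jacobian V (at x) *v h = frechet_derivative V (at x) h"
proof -
  have "V differentiable (at x)"
    using smooth_has_derivative[OF assms] by (auto simp: differentiable_def)
  then show ?thesis
    using frechet_derivative_eq[of V "\<lambda>h. jacobian V (at x) *v h" x] by (simp add: jacobian_works)
qed

lemma jacobian_component:
  "jacobian V (at x) $ i $ j = frechet_derivative V (at x) (axis j 1) $ i"
  by (simp add: jacobian_def matrix_def)

lemma divergence_eq:
  "divergence V x = frechet_derivative V (at x) (axis 1 1) $ 1 + frechet_derivative V (at x) (axis 2 1) $ 2"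
  by (simp add: divergence_def trace_def jacobian_component sum_2)

lemma curl_eq:
  "curl V x = frechet_derivative V (at x) (axis 1 1) $ 2 - frechet_derivative V (at x) (axis 2 1) $ 1"
  by (simp add: curl_def jacobian_component)

lemma frechet_derivative_perp_grad:
  assumes "smooth \<psi>"
  shows "frechet_derivative (\<lambda>x. perp (grad \<psi> x)) (at x) h =
    perp (vector [frechet_derivative (\<lambda>x. frechet_derivative \<psi> (at x) (axis 1 1)) (at x) h,
                  frechet_derivative (\<lambda>x. frechet_derivative \<psi> (at x) (axis 2 1)) (at x) h])"
proof -
  have 1: "((\<lambda>x. frechet_derivative \<psi> (at x) b) has_derivative
     frechet_derivative (\<lambda>x. frechet_derivative \<psi> (at x) b) (at x)) (at x)" for b
    by (intro smooth_has_derivative smooth_frechet_derivative assms)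
  have "((\<lambda>x. perp (grad \<psi> x)) has_derivative (\<lambda>h.
      (- frechet_derivative (\<lambda>x. frechet_derivative \<psi> (at x) (axis 2 1)) (at x) h) *\<^sub>R axis 1 1
      + frechet_derivative (\<lambda>x. frechet_derivative \<psi> (at x) (axis 1 1)) (at x) h *\<^sub>R axis 2 1)) (at x)"
    unfolding perp_eq grad_component
    by (intro has_derivative_add has_derivative_scaleR_left has_derivative_minus 1)
  from frechet_derivative_eq[OF this] show ?thesis
    by (simp add: perp_eq)
qed

lemma divergence_perp_grad:
  assumes "smooth \<psi>" shows "divergence (\<lambda>x. perp (grad \<psi> x)) x = 0"
  by (simp add: divergence_eq frechet_derivative_perp_grad[OF assms] perp_component
      mixed_partials_commute[OF assms, of "axis 2 1" x "axis 1 1"])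

text \<open>The sum of the two integrands is the divergence of
  \<open>(V \<cdot> \<nabla>\<^sup>\<bottom>\<psi>) V - (|V|\<^sup>2 / 2) \<nabla>\<^sup>\<bottom>\<psi>\<close>, whose components are \<open>G1\<close> and \<open>G2\<close>.\<close>
lemma smooth_vorticity_flux:
  fixes V :: "real ^ 2 \<Rightarrow> real ^ 2"
  assumes V: "smooth V" and div: "\<And>x. divergence V x = 0" and \<psi>: "\<psi> \<in> test_fun UNIV"
  shows "(\<integral>x. V x \<bullet> frechet_derivative (\<lambda>x. perp (grad \<psi> x)) (at x) (V x) \<partial>lborel)
    = - (\<integral>x. curl V x * (V x \<bullet> grad \<psi> x) \<partial>lborel)"
proof -
  note s\<psi> = test_fun_smooth[OF \<psi>]
  let ?p = "\<lambda>i x. frechet_derivative \<psi> (at x) (axis i 1)"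
  let ?q = "\<lambda>i j x. frechet_derivative (?p i) (at x) (axis j 1)"
  let ?v = "\<lambda>i j x. frechet_derivative V (at x) (axis j 1) $ i"
  define G1 where "G1 x = V x $ 1 * V x $ 2 * ?p 1 x + (1/2) * (V x $ 2 * V x $ 2 - V x $ 1 * V x $ 1) * ?p 2 x" for x
  define G2 where "G2 x = - (V x $ 1 * V x $ 2 * ?p 2 x) + (1/2) * (V x $ 2 * V x $ 2 - V x $ 1 * V x $ 1) * ?p 1 x" for x
  let ?A = "\<lambda>x. V x \<bullet> frechet_derivative (\<lambda>x. perp (grad \<psi> x)) (at x) (V x)"
  let ?B = "\<lambda>x. curl V x * (V x \<bullet> grad \<psi> x)"
  have dp: "(?p i has_derivative frechet_derivative (?p i) (at x)) (at x)" for i x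
    by (intro smooth_has_derivative smooth_frechet_derivative s\<psi>)
  have dv: "((\<lambda>x. V x $ i) has_derivative (\<lambda>h. frechet_derivative V (at x) h $ i)) (at x)" for i x
    by (rule bounded_linear.has_derivative[OF bounded_linear_vec_nth smooth_has_derivative[OF V]])
  have sm: "smooth (\<lambda>x. (1/2) * (V x $ 2 * V x $ 2 - V x $ 1 * V x $ 1))"
    unfolding diff_conv_add_uminus
    by (intro smooth_mult smooth_add smooth_minus smooth_component V) (simp add: smooth_def Ck_const)
  have supp: "frechet_derivative \<psi> (at x) h = 0" if "x \<notin> closure {x. \<psi> x \<noteq> 0}" for x h
    using frechet_derivative_outside_support[OF that] by simp
  have G1: "G1 \<in> test_fun UNIV" 
  proof (rule test_fun_subset[OF \<psi>])
    show "smooth G1" unfolding G1_def[abs_def]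
      by (intro sm smooth_mult smooth_add smooth_component V smooth_frechet_derivative s\<psi>)
    show "{x. G1 x \<noteq> 0} \<subseteq> closure {x. \<psi> x \<noteq> 0}" using supp by (fastforce simp: G1_def)
  qed
  have G2: "G2 \<in> test_fun UNIV" 
  proof (rule test_fun_subset[OF \<psi>])
    show "smooth G2" unfolding G2_def[abs_def]
      by (intro sm smooth_mult smooth_add smooth_minus smooth_component V smooth_frechet_derivative s\<psi>)
    show "{x. G2 x \<noteq> 0} \<subseteq> closure {x. \<psi> x \<noteq> 0}" using supp by (fastforce simp: G2_def)
  qed
  have d1: "frechet_derivative G1 (at x) (axis 1 1) =
     (?v 1 1 x * V x $ 2 + V x $ 1 * ?v 2 1 x) * ?p 1 x + V x $ 1 * V x $ 2 * ?q 1 1 x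
     + (V x $ 2 * ?v 2 1 x - V x $ 1 * ?v 1 1 x) * ?p 2 x + (1/2) * (V x $ 2 * V x $ 2 - V x $ 1 * V x $ 1) * ?q 2 1 x" for x
    unfolding G1_def[abs_def]
    using frechet_derivative_eq[OF has_derivative_add[OF
       has_derivative_mult[OF has_derivative_mult[OF dv[of 1 x] dv[of 2 x]] dp[of 1 x]]
       has_derivative_mult[OF has_derivative_mult_right[of "\<lambda>x. V x $ 2 * V x $ 2 - V x $ 1 * V x $ 1" _ _ "1/2", OF has_derivative_diff[OF
          has_derivative_mult[OF dv[of 2 x] dv[of 2 x]] has_derivative_mult[OF dv[of 1 x] dv[of 1 x]]]] dp[of 2 x]]]]
    by (simp add: algebra_simps)
  have d2: "frechet_derivative G2 (at x) (axis 2 1) =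
     - (?v 1 2 x * V x $ 2 + V x $ 1 * ?v 2 2 x) * ?p 2 x - V x $ 1 * V x $ 2 * ?q 2 2 x
     + (V x $ 2 * ?v 2 2 x - V x $ 1 * ?v 1 2 x) * ?p 1 x + (1/2) * (V x $ 2 * V x $ 2 - V x $ 1 * V x $ 1) * ?q 1 2 x" for x
    unfolding G2_def[abs_def]
    using frechet_derivative_eq[OF has_derivative_add[OF
       has_derivative_minus[OF has_derivative_mult[OF has_derivative_mult[OF dv[of 1 x] dv[of 2 x]] dp[of 2 x]]]
       has_derivative_mult[OF has_derivative_mult_right[of "\<lambda>x. V x $ 2 * V x $ 2 - V x $ 1 * V x $ 1" _ _ "1/2", OF has_derivative_diff[OF
          has_derivative_mult[OF dv[of 2 x] dv[of 2 x]] has_derivative_mult[OF dv[of 1 x] dv[of 1 x]]]] dp[of 1 x]]]]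
    by (simp add: algebra_simps)
  \<comment> \<open>Incompressibility enters as \<partial>_2 V_2 = - \<partial>_1 V_1 and the
    symmetry of the Hessian as \<open>q\<close>; after these substitutions both sides agree as
    polynomials in the values and first derivatives of \<open>V\<close> and the derivatives of
    \<psi>.\<close>
  have sum: "frechet_derivative G1 (at x) (axis 1 1) + frechet_derivative G2 (at x) (axis 2 1) = ?A x + ?B x" for x
  proof -
    have A: "?A x = - V x $ 1 * (V x $ 1 * ?q 2 1 x + V x $ 2 * ?q 2 2 x) + V x $ 2 * (V x $ 1 * ?q 1 1 x + V x $ 2 * ?q 1 2 x)"
      unfolding frechet_derivative_perp_grad[OF s\<psi>]
        frechet_derivative_axis_sum[OF smooth_frechet_derivative[OF s\<psi>], of _ x "V x"]
      by (simp add: inner_vec_def sum_2 perp_component algebra_simps)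
    have B: "?B x = (?v 2 1 x - ?v 1 2 x) * (V x $ 1 * ?p 1 x + V x $ 2 * ?p 2 x)"
      by (simp add: curl_eq inner_vec_def sum_2 grad_component)
    have q: "?q 1 2 x = ?q 2 1 x"
      by (rule mixed_partials_commute[OF s\<psi>])
    have dv0: "?v 2 2 x = - ?v 1 1 x" using div[of x] by (simp add: divergence_eq)
    show ?thesis unfolding d1 d2 A B q dv0 by algebra
  qed
  have Bt: "?B \<in> test_fun UNIV"
  proof (rule test_fun_subset[OF \<psi>])
    show "smooth ?B" unfolding curl_eq diff_conv_add_uminus
      by (intro smooth_mult smooth_bilinear[OF bounded_bilinear_inner] smooth_add smooth_minus
          smooth_component V smooth_frechet_derivative smooth_grad s\<psi>)
    show "{x. ?B x \<noteq> 0} \<subseteq> closure {x. \<psi> x \<noteq> 0}"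
      using supp by (fastforce simp: grad_component inner_vec_def sum_2)
  qed
  have iB: "integrable lborel ?B" 
    and i1: "integrable lborel (\<lambda>x. frechet_derivative G1 (at x) (axis 1 1))"
    and i2: "integrable lborel (\<lambda>x. frechet_derivative G2 (at x) (axis 2 1))"
    by (intro test_fun_integrable[where X = UNIV] Bt test_fun_frechet_derivative G1 G2)+
  \<comment> \<open>Writing \<open>?A\<close> pointwise as a divergence minus \<open>?B\<close>
    confines the integrability questions to three derivatives or products that are themselves test
    functions.\<close>
  have "(\<integral>x. ?A x \<partial>lborel) = (\<integral>x. frechet_derivative G1 (at x) (axis 1 1)
      + frechet_derivative G2 (at x) (axis 2 1) - ?B x \<partial>lborel)"
    by (simp add: sum)
  also have "\<dots> = 0 + 0 - (\<integral>x. ?B x \<partial>lborel)"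
    unfolding Bochner_Integration.integral_diff[OF Bochner_Integration.integrable_add[OF i1 i2] iB]
      Bochner_Integration.integral_add[OF i1 i2]
      test_fun_integral_derivative[OF G1] test_fun_integral_derivative[OF G2] ..
  finally show ?thesis by simp
qed

section \<open>Weak Lebesgue spaces\<close>

text \<open>The supremum bounds l m^(1/r) by N, where m is the measure of the level set; solve for
  m. A level set of infinite measure would make the left side infinite.\<close>

lemma weakL_norm_emeasure_le:
  assumes r: "r > 0" and le: "weakL_norm r f \<le> ennreal N" and l: "l > 0" and N: "N \<ge> 0"
  shows "emeasure lborel {x. norm (f x) > l} \<le> ennreal ((N / l) powr r)"
proof -
  let ?m = "emeasure lborel {x. norm (f x) > l}"
  have "ennreal l * ennreal_powr ?m (1 / r) \<le> weakL_norm r f"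
    unfolding weakL_norm_def by (rule SUP_upper) (use l in auto)
  then have b: "ennreal l * ennreal_powr ?m (1 / r) \<le> ennreal N" using le by (rule order_trans)
  show ?thesis
  proof (cases ?m)
    case (real x)
    have "ennreal (l * x powr (1 / r)) \<le> ennreal N"
      using b real l by (simp add: ennreal_powr_def ennreal_mult)
    then have "x powr (1 / r) \<le> N / l"
      using N l by (simp add: field_simps)
    then have "(x powr (1 / r)) powr r \<le> (N / l) powr r"
      using r by (intro powr_mono2) auto
    then have "x \<le> (N / l) powr r" using r real by (simp add: powr_powr)
    then show ?thesis using real by (simp add: ennreal_leI)
  next
    case top
    then show ?thesis using b l by (simp add: ennreal_powr_def ennreal_mult_top top_unique)
  qed
qed

text \<open>A single term of the sum suffices: if 2^k < y \<le> 2^(k+1), the k-th term already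
  dominates y^p. The summand 1 takes care of y \<le> 1.\<close>

lemma powr_le_dyadic_sum:
  assumes y: "y \<ge> 0" and p: "p > 0"
  shows "ennreal (y powr p) \<le> 1 + (\<Sum>k. ennreal (2 powr (real (Suc k) * p)) * indicator {x. x > 2 ^ k} (y::real))"
proof (cases "y \<le> 1")
  case True
  then have "y powr p \<le> 1 powr p" using y p by (intro powr_mono2) auto
  then have "ennreal (y powr p) \<le> 1" by (simp add: ennreal_leI flip: ennreal_1)
  then show ?thesis by (meson add_increasing2 zero_le)
next
  case False
  let ?t = "\<lambda>k. ennreal (2 powr (real (Suc k) * p)) * indicator {x. x > 2 ^ k} y"
  obtain n where "y < 2 ^ n" using real_arch_pow[of 2 y] by auto
  then have ex: "\<exists>n. y \<le> 2 ^ n" using less_imp_le by blast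
  \<comment> \<open>Positive because y > 1, so it has a predecessor k, and minimality gives 2^k <
    y.\<close>
  define m where "m = (LEAST n. y \<le> 2 ^ n)"
  have m: "y \<le> 2 ^ m" unfolding m_def using ex by (rule LeastI_ex)
  with False obtain k where k: "m = Suc k" by (cases m) auto
  have "\<not> y \<le> 2 ^ k" using not_less_Least[of k "\<lambda>n. y \<le> 2 ^ n"] k unfolding m_def[symmetric] by simp
  then have "ennreal (2 powr (real (Suc k) * p)) = ?t k" by simp
  also have "\<dots> \<le> (\<Sum>k. ?t k)"
  proof -
    have "f k \<le> suminf f" for f :: "nat \<Rightarrow> ennreal"
      using sum_le_suminf[OF summableI, of "{k}" f] by simp
    then show ?thesis .
  qed
  finally have "ennreal (2 powr (real (Suc k) * p)) \<le> (\<Sum>k. ?t k)" .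
  moreover have "y powr p \<le> 2 powr (real (Suc k) * p)"
  proof -
    have "y powr p \<le> (2 powr real (Suc k)) powr p"
      using m y p unfolding k by (intro powr_mono2) (auto simp: powr_realpow simp del: power_Suc of_nat_Suc)
    then show ?thesis by (simp add: powr_powr)
  qed
  ultimately have "ennreal (y powr p) \<le> (\<Sum>k. ?t k)"
    by (meson ennreal_leI order_trans)
  then show ?thesis by (meson add_increasing zero_le)
qed

text \<open>The contributions of the dyadic levels \<open>{|f| > 2\<^sup>k}\<close> form a geometric series of ratio \<open>2\<^bsup>p-r\<^esup>\<close>.\<close>
lemma weakL_moment_bound:
  assumes p: "0 < p" "p < r" and N: "N \<ge> 0"
  shows "\<exists>M\<ge>0. \<forall>f :: real ^ 2 \<Rightarrow> 'b::{real_normed_vector, second_countable_topology}.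
    f \<in> borel_measurable borel \<and> weakL_norm r f \<le> ennreal N \<longrightarrow> (\<forall>S\<in>sets borel.
     (\<integral>\<^sup>+x\<in>S. ennreal (norm (f x) powr p) \<partial>lborel) \<le> emeasure lborel S + ennreal M)"
proof -
  \<comment> \<open>The dyadic weight 2^((k+1)p) times the bound (N / 2^k)^r for the measure of the
    k-th level set. It depends on \<open>p\<close>, \<open>r\<close> and \<open>N\<close> only,
    which makes the resulting constant uniform over all \<open>f\<close> and
    \<open>S\<close>.\<close>
  define a where "a k = 2 powr (real (Suc k) * p) * (N / 2 ^ k) powr r" for k :: nat
  have ak: "a k = 2 powr p * N powr r * (2 powr (p - r)) ^ k" for k
    using N by (simp add: a_def powr_divide powr_mult powr_add[symmetric] powr_realpow[symmetric] powr_powr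
        powr_diff field_simps flip: powr_add)
  have "2 powr (p - r) < 1" using p by (simp add: powr_less_one)
  then have sa: "summable a"
    unfolding ak[abs_def] by (auto intro!: summable_mult summable_geometric)
  have a0: "a k \<ge> 0" for k by (simp add: a_def)
  have "(\<integral>\<^sup>+x\<in>S. ennreal (norm (f x) powr p) \<partial>lborel) \<le> emeasure lborel S + ennreal (suminf a)"
    if f [measurable]: "f \<in> borel_measurable borel" and le: "weakL_norm r f \<le> ennreal N"
      and S [measurable]: "S \<in> sets borel" for f :: "real ^ 2 \<Rightarrow> 'b" and S
  proof -
    let ?t = "\<lambda>k x. ennreal (2 powr (real (Suc k) * p)) * indicator {x. norm (f x) > 2 ^ k} x"
    have "(\<integral>\<^sup>+x\<in>S. ennreal (norm (f x) powr p) \<partial>lborel) \<le> (\<integral>\<^sup>+x. indicator S x + (\<Sum>k. ?t k x) \<partial>lborel)"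
    proof (rule nn_integral_mono)
      fix x
      show "ennreal (norm (f x) powr p) * indicator S x \<le> indicator S x + (\<Sum>k. ?t k x)"
        using powr_le_dyadic_sum[OF norm_ge_zero p(1), of "f x"]
        by (auto simp: indicator_def)
    qed
    also have "\<dots> = emeasure lborel S + (\<Sum>k. ennreal (2 powr (real (Suc k) * p)) * emeasure lborel {x. norm (f x) > 2 ^ k})"
      by (subst nn_integral_add, simp, simp, subst nn_integral_suminf, simp, subst nn_integral_cmult_indicator, simp, simp)
    also have "(\<Sum>k. ennreal (2 powr (real (Suc k) * p)) * emeasure lborel {x. norm (f x) > 2 ^ k})
        \<le> (\<Sum>k. ennreal (a k))"
      using weakL_norm_emeasure_le[OF _ le _ N] p
      by (intro suminf_le) (auto simp: a_def ennreal_mult intro!: mult_left_mono simp del: of_nat_Suc)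
    also have "\<dots> = ennreal (suminf a)"
      by (rule suminf_ennreal2[OF a0 sa])
    finally show ?thesis by simp
  qed
  then show ?thesis using suminf_nonneg[OF sa a0] by blast
qed

lemma ennreal_powr_le:
  assumes "m \<le> ennreal x" "x \<ge> 0" "s \<ge> 0"
  shows "ennreal_powr m s \<le> ennreal (x powr s)"
proof -
  obtain y where y: "m = ennreal y" "y \<ge> 0" "y \<le> x"
    using assms by (cases m) (auto simp: top_unique)
  then show ?thesis using assms by (auto simp: ennreal_powr_def intro!: ennreal_leI powr_mono2)
qed

text \<open>Split the integral over levels at l = 1. Low levels are controlled by the finite measure
  of the support; high levels by the decay l^(-q/s), which is integrable at infinity because q >
  s.\<close>

lemma lorentz1I:
  assumes g [measurable]: "g \<in> borel_measurable borel" and s: "0 < s" "s < q" and N: "N \<ge> 0"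
    and fin: "emeasure lborel {x. g x \<noteq> 0} \<le> ennreal m" "m \<ge> 0"
    and le: "\<And>l. l > 0 \<Longrightarrow> emeasure lborel {x. \<bar>g x\<bar> > l} \<le> ennreal ((N / l) powr q)"
  shows "g \<in> lorentz1 s"
proof -
  let ?h = "\<lambda>l. ennreal_powr (emeasure lborel {x. \<bar>g x\<bar> > l}) (1 / s)"
  have qs: "- (q / s) < -1" using s by simp
  have "(\<integral>\<^sup>+ l\<in>{0<..}. ?h l \<partial>lborel) \<le> (\<integral>\<^sup>+ l. ennreal (m powr (1 / s)) * indicator {0..1} l
     + ennreal (N powr (q / s)) * (ennreal (l powr (- (q / s))) * indicator {1..} l) \<partial>lborel)"
  proof (rule nn_integral_mono)
    fix l :: real
    consider "l \<le> 0" | "0 < l" "l \<le> 1" | "l > 1" by linarith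
    then show "?h l * indicator {0<..} l \<le> ennreal (m powr (1 / s)) * indicator {0..1} l
     + ennreal (N powr (q / s)) * (ennreal (l powr (- (q / s))) * indicator {1..} l)"
    proof cases
      case 2
      have "emeasure lborel {x. \<bar>g x\<bar> > l} \<le> emeasure lborel {x. g x \<noteq> 0}"
        by (intro emeasure_mono) (use 2 in auto)
      then have "?h l \<le> ennreal (m powr (1 / s))"
        using fin s by (intro ennreal_powr_le) auto
      then show ?thesis using 2 by (auto intro: add_increasing2)
    next
      case 3
      have "?h l \<le> ennreal (((N / l) powr q) powr (1 / s))"
        using le[of l] s 3 by (intro ennreal_powr_le) auto
      also have "((N / l) powr q) powr (1 / s) = N powr (q / s) * l powr (- (q / s))"
        using N 3 by (simp add: powr_powr powr_divide powr_minus field_simps)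
      finally show ?thesis using 3 by (simp add: ennreal_mult)
    qed simp
  qed
  also have "\<dots> = ennreal (m powr (1 / s)) + ennreal (N powr (q / s)) *
      (\<integral>\<^sup>+ l. ennreal (l powr (- (q / s))) * indicator {1..} l \<partial>lborel)"
    by (simp add: nn_integral_add nn_integral_cmult nn_integral_cmult_indicator)
  also have "(\<integral>\<^sup>+ l. ennreal (l powr (- (q / s))) * indicator {1..} l \<partial>lborel)
      = ennreal (- (1 powr (- (q / s) + 1)) / (- (q / s) + 1))"
    using has_integral_powr_to_inf[OF qs, of 1]
    by (subst nn_integral_has_integral_lebesgue[symmetric])
      (auto intro!: nn_integral_cong simp: indicator_def)
  finally have "(\<integral>\<^sup>+ l\<in>{0<..}. ?h l \<partial>lborel) \<le> ennreal (m powr (1 / s)) + ennreal (N powr (q / s)) * ennreal (- (1 powr (- (q / s) + 1)) / (- (q / s) + 1))" .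
  also have "\<dots> < \<infinity>"
    unfolding infinity_ennreal_def
    by (intro ennreal_add_less_top[THEN iffD2] conjI ennreal_mult_less_top[THEN iffD2] disjI2 ennreal_less_top)
  finally show ?thesis using g by (simp add: lorentz1_def)
qed

section \<open>Moments, products and interpolation on sets of finite measure\<close>

lemma weakL_borel: "f \<in> weakL r \<Longrightarrow> f \<in> borel_measurable borel"
  by (simp add: weakL_def)

lemma weakL_norm_bound:
  assumes "f \<in> weakL r" obtains N where "N \<ge> 0" "weakL_norm r f \<le> ennreal N"
proof -
  have "weakL_norm r f < top" using assms by (simp add: weakL_def)
  then show ?thesis by (cases "weakL_norm r f") (auto intro: that)
qed

text \<open>Young's inequality for the conjugate exponents 4/3 and 4, with constants 1 in place of
  the sharp ones. The cases compare x with y^3, the curve on which x^(4/3) = y^4.\<close>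

lemma Young_4:
  fixes x y :: real
  assumes "x \<ge> 0" "y \<ge> 0" shows "x * y \<le> x powr (4 / 3) + y ^ 4"
proof (cases "y powr 3 \<le> x")
  case True
  then have "(y powr 3) powr (1 / 3) \<le> x powr (1 / 3)" using assms by (intro powr_mono2) auto
  moreover have "(y powr 3) powr (1 / 3) = y"
    unfolding powr_powr using assms by simp
  ultimately have "x * y \<le> x * x powr (1 / 3)"
    using assms by (intro mult_left_mono) simp_all
  also have "\<dots> = x powr (1 + 1 / 3)"
    using assms by (simp only: powr_add powr_one)
  finally have "x * y \<le> x powr (4 / 3)" by simp
  also have "\<dots> \<le> x powr (4 / 3) + y ^ 4" by simp
  finally show ?thesis .
next
  case False
  then have "x * y \<le> y powr 3 * y" using assms by (intro mult_right_mono) auto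
  also have "\<dots> = y ^ 4" using assms by (simp add: eval_nat_numeral)
  finally show ?thesis by (simp add: add_increasing)
qed

text \<open>On \<open>{x > R}\<close> the product is bounded by \<open>R\<^bsup>-\<eta>\<^esup> x\<^bsup>1+\<eta>\<^esup> y\<close> with \<open>(1 + \<eta>) 4 / 3 = p\<close>, on
  \<open>{x \<le> R}\<close> by \<open>R y\<close>.\<close>
lemma product_interpolation:
  assumes p: "4 / 3 < p" and d: "d > 0"
  shows "\<exists>M\<ge>0. \<forall>x\<ge>0. \<forall>y\<ge>0. (x::real) * y \<le> d * (1 + x powr p + y ^ 4) + M * y\<^sup>2"
proof -
  define \<eta> where "\<eta> = 3 / 4 * p - 1"
  have \<eta>: "\<eta> > 0" "(1 + \<eta>) * (4 / 3) = p" using p by (auto simp: \<eta>_def)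
  \<comment> \<open>Beyond this threshold the surplus factor x^\<eta> is at least 1/d.\<close>
  define R where "R = d powr (- 1 / \<eta>)"
  have R: "R > 0" "R powr (- \<eta>) = d" using d \<eta>(1) by (auto simp: R_def powr_powr)
  have "x * y \<le> d * (1 + x powr p + y ^ 4) + R\<^sup>2 / (4 * d) * y\<^sup>2" if "x \<ge> 0" "y \<ge> 0" for x y
  proof (cases "x \<le> R")
    case True
    then have "x * y \<le> R * y" using that by (intro mult_right_mono)
    \<comment> \<open>Expanding (2 d - R y)^2 \<ge> 0 and dividing by 4 d; this is the origin of the
      constant in front of y^2.\<close>
    also have "R * y \<le> d + R\<^sup>2 / (4 * d) * y\<^sup>2"
    proof -
      have "0 \<le> (2 * d - R * y)\<^sup>2 / (4 * d)" using d by simp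
      also have "\<dots> = d + R\<^sup>2 / (4 * d) * y\<^sup>2 - R * y" using d by (simp add: field_simps power2_eq_square)
      finally show ?thesis by simp
    qed
    also have "d + R\<^sup>2 / (4 * d) * y\<^sup>2 \<le> d * (1 + x powr p + y ^ 4) + R\<^sup>2 / (4 * d) * y\<^sup>2"
      using d mult_left_mono[of 1 "1 + x powr p + y ^ 4" d] by (intro add_right_mono) simp
    finally show ?thesis .
  next
    case False
    have "R powr \<eta> \<le> x powr \<eta>" using False R \<eta> by (intro powr_mono2) auto
    then have "1 \<le> R powr (- \<eta>) * x powr \<eta>" using R by (simp add: powr_minus field_simps)
    then have "1 * (x * y) \<le> (d * x powr \<eta>) * (x * y)"
      unfolding R(2) using that by (intro mult_right_mono) auto
    also have "\<dots> = d * (x powr (1 + \<eta>) * y)"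
      using that by (simp add: powr_add)
    also have "\<dots> \<le> d * ((x powr (1 + \<eta>)) powr (4 / 3) + y ^ 4)"
      using d that by (intro mult_left_mono Young_4) auto
    also have "(x powr (1 + \<eta>)) powr (4 / 3) = x powr p" by (simp only: powr_powr \<eta>)
    also have "d * (x powr p + y ^ 4) \<le> d * (1 + x powr p + y ^ 4) + R\<^sup>2 / (4 * d) * y\<^sup>2"
      using d by (simp add: add_increasing2 algebra_simps)
    finally show ?thesis by simp
  qed
  then show ?thesis using d by (intro exI[of _ "R\<^sup>2 / (4 * d)"]) auto
qed

lemma ennreal_tendsto_0I:
  fixes x :: "'i \<Rightarrow> ennreal"
  assumes "\<And>e. e > 0 \<Longrightarrow> eventually (\<lambda>n. x n \<le> ennreal e) F"
  shows "(x \<longlongrightarrow> 0) F"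
proof (rule order_tendstoI)
  fix a :: ennreal assume "a > 0"
  then obtain e where e: "e > 0" "ennreal e < a"
  proof (cases a)
    case (real r)
    then show ?thesis using \<open>a > 0\<close> that[of "r / 2"] by (auto simp: ennreal_less_iff)
  next
    case top
    then show ?thesis using that[of 1] by simp
  qed
  show "eventually (\<lambda>n. x n < a) F"
    using assms[OF e(1)] by eventually_elim (use e(2) in auto)
qed simp

lemma weakL_moment_finite:
  fixes f :: "real ^ 2 \<Rightarrow> 'b::{real_normed_vector, second_countable_topology}"
  assumes f: "f \<in> weakL r" and p: "0 < p" "p < r" and S: "S \<in> sets borel" "emeasure lborel S < \<infinity>"
  shows "(\<integral>\<^sup>+x\<in>S. ennreal (norm (f x) powr p) \<partial>lborel) < \<infinity>"
proof -
  obtain N where N: "N \<ge> 0" "weakL_norm r f \<le> ennreal N" using weakL_norm_bound[OF f] .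
  from weakL_moment_bound[OF p N(1), where 'b = 'b]
  obtain M where "(\<integral>\<^sup>+x\<in>S. ennreal (norm (f x) powr p) \<partial>lborel) \<le> emeasure lborel S + ennreal M"
    using weakL_borel[OF f] N S by blast
  also have "\<dots> < \<infinity>" using S by simp
  finally show ?thesis .
qed

text \<open>Young's inequality reduces the product to moments of orders 4/3 and 4, finite on sets of
  finite measure because these orders lie strictly below p and q. This is the source of the local
  integrability of \<open>U \<Omega>\<close>.\<close>

lemma weakL_product_finite:
  fixes f :: "real ^ 2 \<Rightarrow> 'b::{real_normed_vector, second_countable_topology}"
    and V :: "real ^ 2 \<Rightarrow> 'c::{real_normed_vector, second_countable_topology}"
  assumes f: "f \<in> weakL p" "4 / 3 < p" and V: "V \<in> weakL q" "4 < q"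
    and S [measurable]: "S \<in> sets borel" and fin: "emeasure lborel S < \<infinity>"
  shows "(\<integral>\<^sup>+x\<in>S. ennreal (norm (f x) * norm (V x)) \<partial>lborel) < \<infinity>"
proof -
  note [measurable] = weakL_borel[OF f(1)] weakL_borel[OF V(1)]
  have "(\<integral>\<^sup>+x\<in>S. ennreal (norm (f x) * norm (V x)) \<partial>lborel)
    \<le> (\<integral>\<^sup>+x. ennreal (norm (f x) powr (4 / 3)) * indicator S x + ennreal (norm (V x) powr 4) * indicator S x \<partial>lborel)"
  proof (rule nn_integral_mono)
    fix x
    have "norm (f x) * norm (V x) \<le> norm (f x) powr (4 / 3) + norm (V x) powr 4"
      using Young_4[of "norm (f x)" "norm (V x)"] by simp
    then show "ennreal (norm (f x) * norm (V x)) * indicator S x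
       \<le> ennreal (norm (f x) powr (4 / 3)) * indicator S x + ennreal (norm (V x) powr 4) * indicator S x"
      by (auto simp: indicator_def ennreal_leI simp flip: ennreal_plus)
  qed
  also have "\<dots> < \<infinity>"
    using weakL_moment_finite[OF f(1), of "4 / 3" S] weakL_moment_finite[OF V(1), of 4 S] f V S fin
    by (subst nn_integral_add) auto
  finally show ?thesis .
qed

text \<open>One domination yields integrability and a quantitative bound together. The typical
  integrand below is a product of functions from weak spaces, collected in \<open>F\<close>, with a
  bounded factor that vanishes outside \<open>S\<close>.\<close>

lemma integrable_support_bound:
  fixes h :: "'a::euclidean_space \<Rightarrow> 'b::{banach, second_countable_topology}"
  assumes h: "h \<in> borel_measurable borel" and c: "c \<ge> 0"
    and F [measurable]: "F \<in> borel_measurable borel" and S [measurable]: "S \<in> sets borel"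
    and fin: "(\<integral>\<^sup>+x\<in>S. ennreal (F x) \<partial>lborel) < \<infinity>"
    and le: "\<And>x. x \<in> S \<Longrightarrow> norm (h x) \<le> c * F x" and supp: "\<And>x. x \<notin> S \<Longrightarrow> h x = 0"
  shows "integrable lborel h"
    and "ennreal (norm (\<integral>x. h x \<partial>lborel)) \<le> ennreal c * (\<integral>\<^sup>+x\<in>S. ennreal (F x) \<partial>lborel)"
proof -
  have "(\<integral>\<^sup>+x. ennreal (norm (h x)) \<partial>lborel) \<le> (\<integral>\<^sup>+x. ennreal c * (ennreal (F x) * indicator S x) \<partial>lborel)"
  proof (rule nn_integral_mono)
    fix x show "ennreal (norm (h x)) \<le> ennreal c * (ennreal (F x) * indicator S x)"
      using le[of x] supp[of x] c by (cases "x \<in> S") (auto simp: ennreal_leI simp flip: ennreal_mult')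
  qed
  also have "\<dots> = ennreal c * (\<integral>\<^sup>+x\<in>S. ennreal (F x) \<partial>lborel)"
    by (subst nn_integral_cmult) auto
  finally have le: "(\<integral>\<^sup>+x. ennreal (norm (h x)) \<partial>lborel) \<le> ennreal c * (\<integral>\<^sup>+x\<in>S. ennreal (F x) \<partial>lborel)" .
  also have "\<dots> < \<infinity>" using fin by (simp add: ennreal_mult_less_top)
  finally show int: "integrable lborel h"
    using h by (intro integrableI_bounded) auto
  show "ennreal (norm (\<integral>x. h x \<partial>lborel)) \<le> ennreal c * (\<integral>\<^sup>+x\<in>S. ennreal (F x) \<partial>lborel)"
    using integral_norm_bound_ennreal[OF int] le by (rule order_trans)
qed

text \<open>By \<open>product_interpolation\<close> the product is at most d times quantities whose
  integrals are bounded uniformly in n, plus a multiple of |V n|^2. First d is made small, then n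
  large.\<close>

lemma product_tendsto_0:
  fixes f :: "nat \<Rightarrow> 'a::euclidean_space \<Rightarrow> 'b::{real_normed_vector, second_countable_topology}"
    and V :: "nat \<Rightarrow> 'a \<Rightarrow> 'c::{real_normed_vector, second_countable_topology}"
  assumes [measurable]: "\<And>n. f n \<in> borel_measurable borel" "\<And>n. V n \<in> borel_measurable borel" "S \<in> sets borel"
    and fin: "emeasure lborel S < \<infinity>" and p: "4 / 3 < p"
    and A: "A \<ge> 0" "\<And>n. (\<integral>\<^sup>+x\<in>S. ennreal (norm (f n x) powr p) \<partial>lborel) \<le> ennreal A"
    and B: "B \<ge> 0" "\<And>n. (\<integral>\<^sup>+x\<in>S. ennreal (norm (V n x) ^ 4) \<partial>lborel) \<le> ennreal B"
    and lim: "(\<lambda>n. \<integral>\<^sup>+x\<in>S. ennreal ((norm (V n x))\<^sup>2) \<partial>lborel) \<longlonglongrightarrow> 0"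
  shows "(\<lambda>n. \<integral>\<^sup>+x\<in>S. ennreal (norm (f n x) * norm (V n x)) \<partial>lborel) \<longlonglongrightarrow> 0"
proof (rule ennreal_tendsto_0I)
  fix e :: real assume e: "e > 0"
  obtain m where m: "emeasure lborel S = ennreal m" "m \<ge> 0" using fin by (cases "emeasure lborel S") auto
  \<comment> \<open>Half of \<open>e\<close> is reserved for the uniformly bounded moments and half
    for the L^2 term; the summand 1 keeps the denominator positive.\<close>
  define d where "d = e / (2 * (m + A + B + 1))"
  have d: "d > 0" "d * (m + A + B) \<le> e / 2" using e m A B by (auto simp: d_def field_simps)
  obtain M where M: "M \<ge> 0" "\<And>x y::real. x \<ge> 0 \<Longrightarrow> y \<ge> 0 \<Longrightarrow> x * y \<le> d * (1 + x powr p + y ^ 4) + M * y\<^sup>2"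
    using product_interpolation[OF p d(1)] by blast
  have "ennreal 0 < ennreal (e / (2 * (M + 1)))" using e M by (subst ennreal_less_iff) auto
  then have "eventually (\<lambda>n. (\<integral>\<^sup>+x\<in>S. ennreal ((norm (V n x))\<^sup>2) \<partial>lborel) < ennreal (e / (2 * (M + 1)))) sequentially"
    using order_tendstoD(2)[OF lim] by simp
  then show "eventually (\<lambda>n. (\<integral>\<^sup>+x\<in>S. ennreal (norm (f n x) * norm (V n x)) \<partial>lborel) \<le> ennreal e) sequentially"
  proof eventually_elim
    case (elim n)
    let ?I = "indicator S :: 'a \<Rightarrow> ennreal"
    have "(\<integral>\<^sup>+x\<in>S. ennreal (norm (f n x) * norm (V n x)) \<partial>lborel)
      \<le> (\<integral>\<^sup>+x. ennreal d * (?I x + ennreal (norm (f n x) powr p) * ?I x + ennreal (norm (V n x) ^ 4) * ?I x)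
          + ennreal M * (ennreal ((norm (V n x))\<^sup>2) * ?I x) \<partial>lborel)"
    proof (rule nn_integral_mono)
      fix x
      have "ennreal (norm (f n x) * norm (V n x)) \<le> ennreal (d * (1 + norm (f n x) powr p + norm (V n x) ^ 4) + M * (norm (V n x))\<^sup>2)"
        by (intro ennreal_leI M) auto
      also have "\<dots> = ennreal d * (1 + ennreal (norm (f n x) powr p) + ennreal (norm (V n x) ^ 4)) + ennreal M * ennreal ((norm (V n x))\<^sup>2)"
        using d M by (simp add: ennreal_mult)
      finally show "ennreal (norm (f n x) * norm (V n x)) * ?I x
        \<le> ennreal d * (?I x + ennreal (norm (f n x) powr p) * ?I x + ennreal (norm (V n x) ^ 4) * ?I x)
          + ennreal M * (ennreal ((norm (V n x))\<^sup>2) * ?I x)"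
        by (auto simp: indicator_def)
    qed
    also have "\<dots> = ennreal d * (emeasure lborel S + (\<integral>\<^sup>+x\<in>S. ennreal (norm (f n x) powr p) \<partial>lborel)
        + (\<integral>\<^sup>+x\<in>S. ennreal (norm (V n x) ^ 4) \<partial>lborel)) + ennreal M * (\<integral>\<^sup>+x\<in>S. ennreal ((norm (V n x))\<^sup>2) \<partial>lborel)"
      by (simp add: nn_integral_add nn_integral_cmult)
    also have "\<dots> \<le> ennreal d * (ennreal m + ennreal A + ennreal B) + ennreal M * ennreal (e / (2 * (M + 1)))"
      using A B m elim by (intro add_mono mult_left_mono) auto
    also have "\<dots> = ennreal (d * (m + A + B) + M * (e / (2 * (M + 1))))"
    proof -
      have "ennreal M * ennreal (e / (2 * (M + 1))) = ennreal (M * (e / (2 * (M + 1))))"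
        using M e by (intro ennreal_mult[symmetric]) auto
      moreover have "ennreal d * (ennreal m + ennreal A + ennreal B) = ennreal (d * (m + A + B))"
        using d m A B by (simp add: ennreal_mult)
      ultimately show ?thesis using d m A B M e by (subst ennreal_plus) auto
    qed
    also have "\<dots> \<le> ennreal e"
    proof (rule ennreal_leI)
      have "M * (e / (2 * (M + 1))) \<le> e / 2" using M e by (simp add: field_simps)
      then show "d * (m + A + B) + M * (e / (2 * (M + 1))) \<le> e" using d(2) by linarith
    qed
    finally show ?case .
  qed
qed

text \<open>The partial derivatives along basis vectors are test functions, hence bounded; the sum
  of their bounds controls the derivative in every direction, uniformly in the base point.\<close>

lemma norm_frechet_derivative_le:
  fixes \<phi> :: "'a::euclidean_space \<Rightarrow> 'b::real_normed_vector"
  assumes "\<phi> \<in> test_fun X"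
  obtains c where "c > 0" "\<And>x h. norm (frechet_derivative \<phi> (at x) h) \<le> c * norm h"
proof -
  obtain M where M: "\<And>d. M d > 0" "\<And>d x. norm (frechet_derivative \<phi> (at x) d) \<le> M d"
    using test_fun_bounded_range[OF test_fun_frechet_derivative[OF assms]] by metis
  have "norm (frechet_derivative \<phi> (at x) h) \<le> (\<Sum>d\<in>Basis. M d) * norm h" for x h
  proof -
    have "norm (frechet_derivative \<phi> (at x) h) = norm (\<Sum>d\<in>Basis. (h \<bullet> d) *\<^sub>R frechet_derivative \<phi> (at x) d)"
      by (rule arg_cong[where f = norm], rule linear_Basis_expansion,
          rule has_derivative_linear[OF smooth_has_derivative[OF test_fun_smooth[OF assms]]])
    also have "\<dots> \<le> (\<Sum>d\<in>Basis. M d * norm h)"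
    proof (rule sum_norm_le)
      fix d :: 'a assume "d \<in> Basis"
      then have "\<bar>h \<bullet> d\<bar> * norm (frechet_derivative \<phi> (at x) d) \<le> norm h * M d"
        using M Basis_le_norm by (intro mult_mono) auto
      then show "norm ((h \<bullet> d) *\<^sub>R frechet_derivative \<phi> (at x) d) \<le> M d * norm h"
        by (simp add: mult.commute)
    qed
    finally show ?thesis by (simp add: sum_distrib_right)
  qed
  moreover have "(\<Sum>d\<in>(Basis :: 'a set). M d) > 0" by (intro sum_pos M) auto
  ultimately show ?thesis using that by blast
qed

lemma compact_emeasure_finite: "compact K \<Longrightarrow> emeasure lborel K < \<infinity>"
  using emeasure_bounded_finite compact_imp_bounded by blast

lemma test_fun_support:
  assumes "\<phi> \<in> test_fun X"
  obtains K where "compact K" "K \<subseteq> X" "K \<in> sets borel" "emeasure lborel K < \<infinity>"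
    "\<And>x. x \<notin> K \<Longrightarrow> \<phi> x = 0" "\<And>x. x \<notin> K \<Longrightarrow> frechet_derivative \<phi> (at x) = (\<lambda>_. 0)"
proof (rule that)
  let ?K = "closure {x. \<phi> x \<noteq> 0}"
  show K: "compact ?K" "?K \<subseteq> X" using assms by (auto simp: test_fun_def)
  show "emeasure lborel ?K < \<infinity>" by (rule compact_emeasure_finite[OF K(1)])
  show "\<phi> x = 0" if "x \<notin> ?K" for x
    using that closure_subset[of "{x. \<phi> x \<noteq> 0}"] by auto
  show "frechet_derivative \<phi> (at x) = (\<lambda>_. 0)" if "x \<notin> ?K" for x
    using frechet_derivative_outside_support[OF that] .
qed simp

section \<open>The limit of the vorticity flux\<close>

text \<open>A level set of \<open>g\<close> at height l lies in the level set of \<open>f\<close> at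
  height l/c and so inherits its decay. Together with the support of finite measure this puts
  \<open>g\<close> into Lorentz spaces of every exponent below q; it serves to place U .
  \<nabla>\<psi> in the predual.\<close>

lemma lorentz1_dominated:
  fixes f :: "real ^ 2 \<Rightarrow> 'b::{real_normed_vector, second_countable_topology}"
  assumes f: "f \<in> weakL q" and q: "q > 0" and g: "g \<in> borel_measurable borel" and c: "c > 0"
    and le: "\<And>x. \<bar>g x\<bar> \<le> c * norm (f x)"
    and K: "K \<in> sets borel" "emeasure lborel K < \<infinity>" "\<And>x. x \<notin> K \<Longrightarrow> g x = 0"
    and s: "0 < s" "s < q"
  shows "g \<in> lorentz1 s"
proof -
  note [measurable] = weakL_borel[OF f] g
  obtain N where N: "N \<ge> 0" "weakL_norm q f \<le> ennreal N" using weakL_norm_bound[OF f] .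
  obtain m where m: "emeasure lborel K = ennreal m" "m \<ge> 0" using K(2) by (cases "emeasure lborel K") auto
  show ?thesis
  proof (rule lorentz1I[OF g s])
    show "0 \<le> c * N" using c N by simp
    have "emeasure lborel {x. g x \<noteq> 0} \<le> emeasure lborel K"
      using K by (intro emeasure_mono) auto
    then show "emeasure lborel {x. g x \<noteq> 0} \<le> ennreal m" using m by simp
    show "m \<ge> 0" by fact
    fix l :: real assume l: "l > 0"
    have "emeasure lborel {x. \<bar>g x\<bar> > l} \<le> emeasure lborel {x. norm (f x) > l / c}"
    proof (rule emeasure_mono)
      show "{x. \<bar>g x\<bar> > l} \<subseteq> {x. norm (f x) > l / c}"
        using c le by (auto simp: field_simps intro: less_le_trans)
    qed simp
    also have "\<dots> \<le> ennreal ((N / (l / c)) powr q)"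
      using weakL_norm_emeasure_le[OF q N(2) _ N(1), of "l / c"] l c by simp
    finally show "emeasure lborel {x. \<bar>g x\<bar> > l} \<le> ennreal ((c * N / l) powr q)"
      by (simp add: mult.commute)
  qed
qed

lemma smooth_borel: "smooth f \<Longrightarrow> f \<in> borel_measurable borel"
  by (intro borel_measurable_continuous_onI smooth_continuous_on)

lemma smooth_curl: "smooth V \<Longrightarrow> smooth (curl V)"
  unfolding curl_eq[abs_def] diff_conv_add_uminus
  by (intro smooth_add smooth_minus smooth_component smooth_frechet_derivative)

lemma weakLI:
  assumes "f \<in> borel_measurable borel" "weakL_norm r f \<le> ennreal N" shows "f \<in> weakL r"
  using assms ennreal_less_top[of N] by (auto simp: weakL_def intro: le_less_trans)

lemma norm_diff_power4_le: "norm (x - y) ^ 4 \<le> 16 * (norm x ^ 4 + norm (y :: 'a::real_normed_vector) ^ 4)"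
proof -
  have "norm (x - y) \<le> 2 * max (norm x) (norm y)"
    using norm_triangle_ineq4[of x y] by simp
  then have "norm (x - y) ^ 4 \<le> (2 * max (norm x) (norm y)) ^ 4" by (intro power_mono) auto
  also have "\<dots> \<le> 16 * (norm x ^ 4 + norm y ^ 4)"
    by (auto simp: max_def power_mult_distrib)
  finally show ?thesis .
qed

text \<open>Base point and direction both vary with x. Expanding the direction in the basis leaves
  finitely many products of measurable functions.\<close>

lemma frechet_derivative_apply_borel:
  fixes \<phi> :: "'a::euclidean_space \<Rightarrow> 'b::{real_normed_vector, second_countable_topology}"
  assumes "smooth \<phi>" and [measurable]: "g \<in> borel_measurable M" "V \<in> borel_measurable M"
  shows "(\<lambda>x. frechet_derivative \<phi> (at (g x)) (V x)) \<in> borel_measurable M"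
proof -
  have [measurable]: "(\<lambda>x. frechet_derivative \<phi> (at x) h) \<in> borel_measurable borel" for h
    by (intro smooth_borel smooth_frechet_derivative assms)
  have "(\<lambda>x. frechet_derivative \<phi> (at (g x)) (V x))
      = (\<lambda>x. \<Sum>d\<in>Basis. (V x \<bullet> d) *\<^sub>R frechet_derivative \<phi> (at (g x)) d)"
    by (rule ext, rule linear_Basis_expansion,
        rule has_derivative_linear[OF smooth_has_derivative[OF assms(1)]])
  also have "\<dots> \<in> borel_measurable M" by measurable
  finally show ?thesis .
qed

lemma tendsto_ennreal_norm_bound:
  fixes x :: "'i \<Rightarrow> 'b::real_normed_vector"
  assumes le: "\<And>n. ennreal (norm (x n - l)) \<le> y n" and y: "(y \<longlongrightarrow> 0) F"
  shows "(x \<longlongrightarrow> l) F"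
proof -
  have "((\<lambda>n. ennreal (norm (x n - l))) \<longlongrightarrow> ennreal 0) F"
    unfolding ennreal_0
  proof (rule tendsto_sandwich[OF _ _ tendsto_const y])
    show "eventually (\<lambda>n. ennreal (norm (x n - l)) \<le> y n) F"
      by (rule always_eventually) (rule allI, rule le)
  qed simp
  then have "((\<lambda>n. norm (x n - l)) \<longlongrightarrow> 0) F"
    by (rule tendsto_ennrealD) auto
  then show ?thesis
    by (simp only: tendsto_norm_zero_iff LIM_zero_iff)
qed

text \<open>\<open>U\<close> is too rough for the integration by parts of
  \<open>smooth_vorticity_flux\<close>, so the identity is inherited from the smooth
  \<open>W n\<close>. Here \<open>W n\<close> stands for the dissipative velocities and
  \<open>N\<close> for one bound of both weak norms.\<close>

lemma vorticity_flux_limit: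
  fixes W :: "nat \<Rightarrow> real ^ 2 \<Rightarrow> real ^ 2" and U :: "real ^ 2 \<Rightarrow> real ^ 2" and \<Omega> :: "real ^ 2 \<Rightarrow> real"
  assumes p: "4 / 3 < p" and q: "4 < q"
    and W: "\<And>n. smooth (W n)" "\<And>n x. divergence (W n) x = 0"
    and N: "N \<ge> 0" "\<And>n. weakL_norm p (curl (W n)) \<le> ennreal N" "\<And>n. weakL_norm q (W n) \<le> ennreal N"
    and U: "U \<in> weakL q" and \<Omega>: "\<Omega> \<in> weakL p"
    and L2: "L2_loc_tendsto W U sequentially"
    and ws: "weak_star_tendsto p (\<lambda>n. curl (W n)) \<Omega> sequentially"
    and \<psi>: "\<psi> \<in> test_fun UNIV"
  shows "(\<integral>x. U x \<bullet> frechet_derivative (\<lambda>x. perp (grad \<psi> x)) (at x) (U x) \<partial>lborel)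
    = - (\<integral>x. \<Omega> x * (U x \<bullet> grad \<psi> x) \<partial>lborel)"
proof -
  let ?\<phi> = "\<lambda>x. perp (grad \<psi> x)"
  let ?A = "\<lambda>x. frechet_derivative ?\<phi> (at x)"
  let ?w = "\<lambda>n. curl (W n)"
  have \<phi>: "?\<phi> \<in> test_fun UNIV" by (rule test_fun_perp_grad[OF \<psi>])
  note s\<psi> = test_fun_smooth[OF \<psi>] and s\<phi> = test_fun_smooth[OF \<phi>]
  have [measurable]: "U \<in> borel_measurable borel" "\<Omega> \<in> borel_measurable borel"
    "\<And>n. W n \<in> borel_measurable borel" "\<And>n. ?w n \<in> borel_measurable borel"
    "grad \<psi> \<in> borel_measurable borel"
    using weakL_borel[OF U] weakL_borel[OF \<Omega>] W by (auto intro: smooth_borel smooth_curl smooth_grad s\<psi>)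
  have Am [measurable]: "(\<lambda>x. ?A x (V x)) \<in> borel_measurable borel"
    if "V \<in> borel_measurable borel" for V
    by (rule frechet_derivative_apply_borel[OF s\<phi> _ that]) simp
  have Wq: "W n \<in> weakL q" and wp: "?w n \<in> weakL p" for n
    by (auto intro!: weakLI[where N = N] N)
  obtain c1 where c1: "c1 > 0" "\<And>x h. norm (?A x h) \<le> c1 * norm h" using norm_frechet_derivative_le[OF \<phi>] by blast
  obtain c2 where c2: "c2 > 0" "\<And>x. norm (grad \<psi> x) \<le> c2" using test_fun_bounded_range[OF test_fun_grad[OF \<psi>]] by blast
  obtain K1 where K1: "compact K1" "\<And>x. x \<notin> K1 \<Longrightarrow> ?A x = (\<lambda>_. 0)"
    using test_fun_support[OF \<phi>] by metis
  obtain K2 where K2: "compact K2" "\<And>x. x \<notin> K2 \<Longrightarrow> grad \<psi> x = 0"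
    using test_fun_support[OF test_fun_grad[OF \<psi>]] by metis
  define K where "K = K1 \<union> K2"
  have K: "compact K" "K \<in> sets borel" "emeasure lborel K < \<infinity>"
    "\<And>x. x \<notin> K \<Longrightarrow> ?A x = (\<lambda>_. 0)" "\<And>x. x \<notin> K \<Longrightarrow> grad \<psi> x = 0"
    using K1 K2 compact_emeasure_finite[OF compact_Un[OF K1(1) K2(1)]]
    by (auto simp: K_def intro!: borel_compact)
  note [measurable] = K(2)
  \<comment> \<open>An exponent with room on both sides: above 4/3 for the interpolation, below p so
    that moments of the vorticities are bounded. Being below 4 < q, it also serves for the moments
    of \<open>U\<close>.\<close>
  obtain p1 where p1: "4 / 3 < p1" "p1 < p" "p1 < 4"
    using dense[of "4 / 3" "min p 4"] p by auto
  note fin = weakL_product_finite[OF _ _ _ _ K(2,3)]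
  have p0: "p1 > 0" "0 < (4::real)" "p > 1" using p1 p by auto

  define V where "V n x = W n x - U x" for n x
  have [measurable]: "V n \<in> borel_measurable borel" for n
    unfolding V_def[abs_def] by measurable
  \<comment> \<open>The constant must be chosen before n; the moment bound permits this because it
    depends on the functions only through \<open>N\<close>.\<close>
  obtain Mw where Mw: "Mw \<ge> 0" "\<And>n. (\<integral>\<^sup>+x\<in>K. ennreal (norm (?w n x) powr p1) \<partial>lborel) \<le> emeasure lborel K + ennreal Mw"
  proof -
    obtain M where "M \<ge> 0" and *: "\<And>f :: real ^ 2 \<Rightarrow> real. f \<in> borel_measurable borel \<Longrightarrow> weakL_norm p f \<le> ennreal N \<Longrightarrow>
      (\<integral>\<^sup>+x\<in>K. ennreal (norm (f x) powr p1) \<partial>lborel) \<le> emeasure lborel K + ennreal M"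
      using weakL_moment_bound[OF p0(1) p1(2) N(1), where 'b = real] K(2) by blast
    show ?thesis by (rule that[OF \<open>M \<ge> 0\<close>]) (intro * weakL_borel[OF wp] N)
  qed
  obtain MW where MW: "MW \<ge> 0" "\<And>n. (\<integral>\<^sup>+x\<in>K. ennreal (norm (W n x) powr 4) \<partial>lborel) \<le> emeasure lborel K + ennreal MW"
  proof -
    obtain M where "M \<ge> 0" and *: "\<And>f :: real ^ 2 \<Rightarrow> real ^ 2. f \<in> borel_measurable borel \<Longrightarrow> weakL_norm q f \<le> ennreal N \<Longrightarrow>
      (\<integral>\<^sup>+x\<in>K. ennreal (norm (f x) powr 4) \<partial>lborel) \<le> emeasure lborel K + ennreal M"
      using weakL_moment_bound[OF p0(2) q N(1), where 'b = "real ^ 2"] K(2) by blast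
    show ?thesis by (rule that[OF \<open>M \<ge> 0\<close>]) (intro * weakL_borel[OF Wq] N)
  qed
  obtain m where m: "emeasure lborel K = ennreal m" "m \<ge> 0" using K(3) by (cases "emeasure lborel K") auto
  obtain mU where mU: "(\<integral>\<^sup>+x\<in>K. ennreal (norm (U x) powr 4) \<partial>lborel) = ennreal mU" "mU \<ge> 0"
    using weakL_moment_finite[OF U p0(2) q K(2,3)] by (cases "\<integral>\<^sup>+x\<in>K. ennreal (norm (U x) powr 4) \<partial>lborel") auto
  obtain mU' where mU': "(\<integral>\<^sup>+x\<in>K. ennreal (norm (U x) powr p1) \<partial>lborel) = ennreal mU'" "mU' \<ge> 0"
    using weakL_moment_finite[OF U p0(1) _ K(2,3)] p1 q
    by (cases "\<integral>\<^sup>+x\<in>K. ennreal (norm (U x) powr p1) \<partial>lborel") auto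
  have V4: "(\<integral>\<^sup>+x\<in>K. ennreal (norm (V n x) ^ 4) \<partial>lborel) \<le> ennreal (16 * (m + MW + mU))" for n
  proof -
    have "(\<integral>\<^sup>+x\<in>K. ennreal (norm (V n x) ^ 4) \<partial>lborel) \<le>
      (\<integral>\<^sup>+x. 16 * (ennreal (norm (W n x) powr 4) * indicator K x + ennreal (norm (U x) powr 4) * indicator K x) \<partial>lborel)"
    proof (rule nn_integral_mono)
      fix x
      have "ennreal (norm (V n x) ^ 4) \<le> ennreal (16 * (norm (W n x) powr 4 + norm (U x) powr 4))"
        using norm_diff_power4_le[of "W n x" "U x"] by (intro ennreal_leI) (simp add: V_def)
      also have "\<dots> = 16 * (ennreal (norm (W n x) powr 4) + ennreal (norm (U x) powr 4))"
        by (subst ennreal_mult) (auto simp del: powr_numeral)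
      finally show "ennreal (norm (V n x) ^ 4) * indicator K x \<le>
         16 * (ennreal (norm (W n x) powr 4) * indicator K x + ennreal (norm (U x) powr 4) * indicator K x)"
        by (auto simp: indicator_def)
    qed
    also have "\<dots> = 16 * ((\<integral>\<^sup>+x\<in>K. ennreal (norm (W n x) powr 4) \<partial>lborel) + (\<integral>\<^sup>+x\<in>K. ennreal (norm (U x) powr 4) \<partial>lborel))"
      by (simp add: nn_integral_add nn_integral_cmult del: powr_numeral)
    also have "\<dots> \<le> 16 * ((ennreal m + ennreal MW) + ennreal mU)"
      using MW(2)[of n] mU m by (intro mult_left_mono add_mono) auto
    also have "\<dots> = ennreal (16 * (m + MW + mU))"
      using m MW mU by (subst ennreal_mult) auto
    finally show ?thesis .
  qed
  have V2: "(\<lambda>n. \<integral>\<^sup>+x\<in>K. ennreal ((norm (V n x))\<^sup>2) \<partial>lborel) \<longlonglongrightarrow> 0"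
    using L2 K(1) by (simp add: L2_loc_tendsto_def V_def)
  have lim1: "(\<lambda>n. \<integral>\<^sup>+x\<in>K. ennreal (norm (?w n x) * norm (V n x)) \<partial>lborel) \<longlonglongrightarrow> 0"
    by (rule product_tendsto_0[where p = p1 and A = "m + Mw" and B = "16 * (m + MW + mU)"])
      (use K(3) p1 m MW mU V4 V2 Mw in auto)
  \<comment> \<open>The interpolation lemma again, with the constant sequence \<open>U\<close> in
    the role of the vorticities; it controls the cross terms of the quadratic expression.\<close>
  have lim2: "(\<lambda>n. \<integral>\<^sup>+x\<in>K. ennreal (norm (U x) * norm (V n x)) \<partial>lborel) \<longlonglongrightarrow> 0"
    by (rule product_tendsto_0[where p = p1 and A = mU' and B = "16 * (m + MW + mU)"])
      (use K(3) p1 m MW mU mU' V4 V2 in auto)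

  have iU: "integrable lborel (\<lambda>x. U x \<bullet> ?A x (U x))"
  proof (rule integrable_support_bound(1)[where c = c1 and F = "\<lambda>x. norm (U x) * norm (U x)" and S = K])
    show "norm (U x \<bullet> ?A x (U x)) \<le> c1 * (norm (U x) * norm (U x))" for x
      using order_trans[OF Cauchy_Schwarz_ineq2 mult_left_mono[OF c1(2)[of x "U x"] norm_ge_zero[of "U x"]]]
      by (simp add: ac_simps)
  qed (use c1 K fin[OF U _ U q] q in auto)
  have iW: "integrable lborel (\<lambda>x. W n x \<bullet> ?A x (W n x))" for n
  proof (rule integrable_support_bound(1)[where c = c1 and F = "\<lambda>x. norm (W n x) * norm (W n x)" and S = K])
    show "norm (W n x \<bullet> ?A x (W n x)) \<le> c1 * (norm (W n x) * norm (W n x))" for x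
      using order_trans[OF Cauchy_Schwarz_ineq2 mult_left_mono[OF c1(2)[of x "W n x"] norm_ge_zero[of "W n x"]]]
      by (simp add: ac_simps)
  qed (use c1 K fin[OF Wq _ Wq q] q in auto)

  \<comment> \<open>Expanding W = V + U in both slots of the bilinear expression cancels the pure
    \<open>U\<close> term and leaves one term quadratic in \<open>V\<close> and two cross
    terms.\<close>
  have dif: "norm ((\<integral>x. W n x \<bullet> ?A x (W n x) \<partial>lborel) - (\<integral>x. U x \<bullet> ?A x (U x) \<partial>lborel))
    \<le> ennreal c1 * ((\<integral>\<^sup>+x\<in>K. ennreal ((norm (V n x))\<^sup>2) \<partial>lborel) + 2 * (\<integral>\<^sup>+x\<in>K. ennreal (norm (U x) * norm (V n x)) \<partial>lborel))" for n
  proof -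
    let ?F = "\<lambda>x. (norm (V n x))\<^sup>2 + 2 * (norm (U x) * norm (V n x))"
    have F: "(\<integral>\<^sup>+x\<in>K. ennreal (?F x) \<partial>lborel) = (\<integral>\<^sup>+x\<in>K. ennreal ((norm (V n x))\<^sup>2) \<partial>lborel)
       + 2 * (\<integral>\<^sup>+x\<in>K. ennreal (norm (U x) * norm (V n x)) \<partial>lborel)"
    proof -
      have "(\<integral>\<^sup>+x\<in>K. ennreal (?F x) \<partial>lborel) = (\<integral>\<^sup>+x. ennreal ((norm (V n x))\<^sup>2) * indicator K x
          + 2 * (ennreal (norm (U x) * norm (V n x)) * indicator K x) \<partial>lborel)"
        by (intro nn_integral_cong) (auto simp: indicator_def ennreal_mult)
      then show ?thesis by (simp add: nn_integral_add nn_integral_cmult)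
    qed
    have b: "norm (W n x \<bullet> ?A x (W n x) - U x \<bullet> ?A x (U x)) \<le> c1 * ?F x" for x
    proof -
      have lin: "linear (?A x)" by (rule has_derivative_linear[OF smooth_has_derivative[OF s\<phi>]])
      have W: "W n x = V n x + U x" by (simp add: V_def)
      have cs: "\<bar>a \<bullet> ?A x b\<bar> \<le> c1 * (norm a * norm b)" for a b
        using order_trans[OF Cauchy_Schwarz_ineq2 mult_left_mono[OF c1(2)[of x b] norm_ge_zero[of a]]]
        by (simp add: ac_simps)
      have "W n x \<bullet> ?A x (W n x) - U x \<bullet> ?A x (U x)
         = V n x \<bullet> ?A x (V n x) + V n x \<bullet> ?A x (U x) + U x \<bullet> ?A x (V n x)"
        unfolding W linear_add[OF lin] by (simp add: inner_simps)
      also have "\<bar>\<dots>\<bar> \<le> c1 * (norm (V n x) * norm (V n x)) + c1 * (norm (V n x) * norm (U x)) + c1 * (norm (U x) * norm (V n x))"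
        using cs[of "V n x" "V n x"] cs[of "V n x" "U x"] cs[of "U x" "V n x"] by linarith
      also have "\<dots> = c1 * ?F x" by (simp add: algebra_simps power2_eq_square)
      finally show ?thesis by simp
    qed
    \<comment> \<open>The convergence \<open>V2\<close> would give finiteness for large n only; t^2
      \<le> 1 + t^4 and the fourth moment give it for every n.\<close>
    have "(\<integral>\<^sup>+x\<in>K. ennreal (norm (V n x) ^ 2) \<partial>lborel) \<le> (\<integral>\<^sup>+x. indicator K x + ennreal (norm (V n x) ^ 4) * indicator K x \<partial>lborel)"
    proof (rule nn_integral_mono)
      fix x
      have "(norm (V n x))\<^sup>2 \<le> 1 + norm (V n x) ^ 4"
      proof -
        have "2 * (norm (V n x))\<^sup>2 \<le> norm (V n x) ^ 4 + 1"
          using zero_le_power2[of "(norm (V n x))\<^sup>2 - 1"] by (simp add: power2_diff flip: power_mult)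
        then show ?thesis using zero_le_power2[of "norm (V n x)"] by linarith
      qed
      then have "ennreal ((norm (V n x))\<^sup>2) \<le> 1 + ennreal (norm (V n x) ^ 4)"
        by (metis ennreal_1 ennreal_leI ennreal_plus zero_le_one zero_le_power norm_ge_zero)
      then show "ennreal (norm (V n x) ^ 2) * indicator K x \<le> indicator K x + ennreal (norm (V n x) ^ 4) * indicator K x"
        by (auto simp: indicator_def)
    qed
    also have "\<dots> < \<infinity>"
      using V4[of n] K(3) by (subst nn_integral_add) (auto intro: le_less_trans)
    finally have f2: "(\<integral>\<^sup>+x\<in>K. ennreal (norm (V n x) ^ 2) \<partial>lborel) < \<infinity>" .
    have "(\<integral>\<^sup>+x\<in>K. ennreal (norm (U x) * norm (V n x)) \<partial>lborel) \<le>
        (\<integral>\<^sup>+x. ennreal (norm (U x) * norm (W n x)) * indicator K x + ennreal (norm (U x) * norm (U x)) * indicator K x \<partial>lborel)"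
    proof (rule nn_integral_mono)
      fix x
      have "norm (U x) * norm (V n x) \<le> norm (U x) * norm (W n x) + norm (U x) * norm (U x)"
        unfolding V_def distrib_left[symmetric] by (intro mult_left_mono norm_triangle_ineq4) auto
      then have "ennreal (norm (U x) * norm (V n x)) \<le> ennreal (norm (U x) * norm (W n x)) + ennreal (norm (U x) * norm (U x))"
        by (simp add: ennreal_leI flip: ennreal_plus)
      then show "ennreal (norm (U x) * norm (V n x)) * indicator K x \<le> ennreal (norm (U x) * norm (W n x)) * indicator K x + ennreal (norm (U x) * norm (U x)) * indicator K x"
        by (auto simp: indicator_def)
    qed
    also have "\<dots> < \<infinity>"
      using fin[OF U _ Wq q] fin[OF U _ U q] q by (subst nn_integral_add) auto
    finally have "(\<integral>\<^sup>+x\<in>K. ennreal (?F x) \<partial>lborel) < \<infinity>"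
      unfolding F using f2 by (simp add: ennreal_mult_less_top)
    from integrable_support_bound(2)[where h = "\<lambda>x. W n x \<bullet> ?A x (W n x) - U x \<bullet> ?A x (U x)" and S = K, OF _ _ _ _ this b]
    show ?thesis
      unfolding F[symmetric] using iU iW c1 K by simp
  qed
  have "(\<lambda>n. ennreal c1 * ((\<integral>\<^sup>+x\<in>K. ennreal ((norm (V n x))\<^sup>2) \<partial>lborel) + 2 * (\<integral>\<^sup>+x\<in>K. ennreal (norm (U x) * norm (V n x)) \<partial>lborel)))
     \<longlonglongrightarrow> ennreal c1 * (0 + 2 * 0)"
    by (intro ennreal_tendsto_cmult tendsto_add V2 lim2) auto
  then have LHS: "(\<lambda>n. \<integral>x. W n x \<bullet> ?A x (W n x) \<partial>lborel) \<longlonglongrightarrow> (\<integral>x. U x \<bullet> ?A x (U x) \<partial>lborel)"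
    by (intro tendsto_ennreal_norm_bound[OF dif]) simp

  \<comment> \<open>The conjugate exponent p/(p-1) is below 4 exactly when p > 4/3, hence below
    q.\<close>
  have g: "(\<lambda>x. U x \<bullet> grad \<psi> x) \<in> lorentz1 (p / (p - 1))"
  proof (rule lorentz1_dominated[OF U _ _ c2(1) _ K(2,3)])
    show "\<bar>U x \<bullet> grad \<psi> x\<bar> \<le> c2 * norm (U x)" for x
      using order_trans[OF Cauchy_Schwarz_ineq2 mult_left_mono[OF c2(2)[of x] norm_ge_zero[of "U x"]]]
      by (simp add: ac_simps)
    have "p / (p - 1) < 4" using p by (simp add: field_simps)
    then show "p / (p - 1) < q" using q by simp
  qed (use p p0 q K in auto)
  \<comment> \<open>The flux is split as w_n (W_n - U) + w_n U. The second part is weak-star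
    convergence tested against a fixed element of the predual; the first tends to zero by
    \<open>lim1\<close>, through the estimate \<open>dif2\<close>.\<close>
  have R1: "(\<lambda>n. \<integral>x. ?w n x * (U x \<bullet> grad \<psi> x) \<partial>lborel) \<longlonglongrightarrow> (\<integral>x. \<Omega> x * (U x \<bullet> grad \<psi> x) \<partial>lborel)"
    using ws g by (auto simp: weak_star_tendsto_def mult.commute)
  have cs2: "norm (?w n x * (v \<bullet> grad \<psi> x)) \<le> c2 * (norm (?w n x) * norm v)" for n x v
    using mult_left_mono[OF order_trans[OF Cauchy_Schwarz_ineq2 mult_left_mono[OF c2(2)[of x] norm_ge_zero[of v]]] abs_ge_zero[of "?w n x"]]
    by (simp add: abs_mult ac_simps)
  have i1: "integrable lborel (\<lambda>x. ?w n x * (u x \<bullet> grad \<psi> x))" if u: "u \<in> weakL q" for n u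
  proof (rule integrable_support_bound(1)[where c = c2 and F = "\<lambda>x. norm (?w n x) * norm (u x)" and S = K])
    note [measurable] = weakL_borel[OF u]
    show "(\<lambda>x. ?w n x * (u x \<bullet> grad \<psi> x)) \<in> borel_measurable borel"
      "(\<lambda>x. norm (?w n x) * norm (u x)) \<in> borel_measurable borel" by measurable
    show "norm (?w n x * (u x \<bullet> grad \<psi> x)) \<le> c2 * (norm (?w n x) * norm (u x))" for x
      by (rule cs2)
  qed (use c2 K fin[OF wp p u q] in auto)
  have dif2: "norm ((\<integral>x. ?w n x * (W n x \<bullet> grad \<psi> x) \<partial>lborel) - (\<integral>x. ?w n x * (U x \<bullet> grad \<psi> x) \<partial>lborel))
    \<le> ennreal c2 * (\<integral>\<^sup>+x\<in>K. ennreal (norm (?w n x) * norm (V n x)) \<partial>lborel)" for n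
  proof -
    have "(\<integral>\<^sup>+x\<in>K. ennreal (norm (?w n x) * norm (V n x)) \<partial>lborel) \<le>
        (\<integral>\<^sup>+x. ennreal (norm (?w n x) * norm (W n x)) * indicator K x + ennreal (norm (?w n x) * norm (U x)) * indicator K x \<partial>lborel)"
    proof (rule nn_integral_mono)
      fix x
      have "norm (?w n x) * norm (V n x) \<le> norm (?w n x) * norm (W n x) + norm (?w n x) * norm (U x)"
        unfolding V_def distrib_left[symmetric] by (intro mult_left_mono norm_triangle_ineq4) auto
      then have "ennreal (norm (?w n x) * norm (V n x)) \<le> ennreal (norm (?w n x) * norm (W n x)) + ennreal (norm (?w n x) * norm (U x))"
        by (simp add: ennreal_leI flip: ennreal_plus)
      then show "ennreal (norm (?w n x) * norm (V n x)) * indicator K x \<le> ennreal (norm (?w n x) * norm (W n x)) * indicator K x + ennreal (norm (?w n x) * norm (U x)) * indicator K x"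
        by (auto simp: indicator_def)
    qed
    also have "\<dots> < \<infinity>"
      using fin[OF wp p Wq q] fin[OF wp p U q] by (subst nn_integral_add) auto
    finally have f: "(\<integral>\<^sup>+x\<in>K. ennreal (norm (?w n x) * norm (V n x)) \<partial>lborel) < \<infinity>" .
    have b: "norm (?w n x * (W n x \<bullet> grad \<psi> x) - ?w n x * (U x \<bullet> grad \<psi> x)) \<le> c2 * (norm (?w n x) * norm (V n x))" for x
    proof -
      have "?w n x * (W n x \<bullet> grad \<psi> x) - ?w n x * (U x \<bullet> grad \<psi> x) = ?w n x * (V n x \<bullet> grad \<psi> x)"
        by (simp add: V_def inner_diff_left right_diff_distrib)
      then show ?thesis using cs2 by simp
    qed
    from integrable_support_bound(2)[where h = "\<lambda>x. ?w n x * (W n x \<bullet> grad \<psi> x) - ?w n x * (U x \<bullet> grad \<psi> x)" and S = K, OF _ _ _ _ f b]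
    show ?thesis using i1[OF Wq] i1[OF U] c2 K by simp
  qed
  have "(\<lambda>n. ennreal c2 * (\<integral>\<^sup>+x\<in>K. ennreal (norm (?w n x) * norm (V n x)) \<partial>lborel)) \<longlonglongrightarrow> ennreal c2 * 0"
    by (intro ennreal_tendsto_cmult lim1) auto
  then have "(\<lambda>n. (\<integral>x. ?w n x * (W n x \<bullet> grad \<psi> x) \<partial>lborel) - (\<integral>x. ?w n x * (U x \<bullet> grad \<psi> x) \<partial>lborel)) \<longlonglongrightarrow> 0"
    by (intro tendsto_ennreal_norm_bound[where y = "\<lambda>n. ennreal c2 * (\<integral>\<^sup>+x\<in>K. ennreal (norm (?w n x) * norm (V n x)) \<partial>lborel)"])
      (simp_all only: diff_0_right dif2 mult_zero_right)
  from tendsto_add[OF this R1]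
  have "(\<lambda>n. \<integral>x. ?w n x * (W n x \<bullet> grad \<psi> x) \<partial>lborel) \<longlonglongrightarrow> (\<integral>x. \<Omega> x * (U x \<bullet> grad \<psi> x) \<partial>lborel)"
    by simp
  moreover have "(\<integral>x. W n x \<bullet> ?A x (W n x) \<partial>lborel) = - (\<integral>x. ?w n x * (W n x \<bullet> grad \<psi> x) \<partial>lborel)" for n
    by (rule smooth_vorticity_flux[OF W \<psi>])
  ultimately have "(\<lambda>n. \<integral>x. W n x \<bullet> ?A x (W n x) \<partial>lborel) \<longlonglongrightarrow> - (\<integral>x. \<Omega> x * (U x \<bullet> grad \<psi> x) \<partial>lborel)"
    by (simp add: tendsto_minus)
  from LIMSEQ_unique[OF LHS this] show ?thesis .
qed

section \<open>The profile equation for the vorticity\<close>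

lemma weakL_integrable_inner:
  fixes U v :: "real ^ 2 \<Rightarrow> 'b::euclidean_space"
  assumes U: "U \<in> weakL q" "1 < q" and v [measurable]: "v \<in> borel_measurable borel"
    and c: "\<And>x. norm (v x) \<le> c" and K: "compact K" "\<And>x. x \<notin> K \<Longrightarrow> v x = 0"
  shows "integrable lborel (\<lambda>x. U x \<bullet> v x)"
proof (rule integrable_support_bound(1)[where c = c and F = "\<lambda>x. norm (U x)" and S = K])
  note [measurable] = weakL_borel[OF U(1)]
  show "(\<lambda>x. U x \<bullet> v x) \<in> borel_measurable borel" "(\<lambda>x. norm (U x)) \<in> borel_measurable borel" by measurable
  show "c \<ge> 0" using order_trans[OF norm_ge_zero c] .
  show "(\<integral>\<^sup>+x\<in>K. ennreal (norm (U x)) \<partial>lborel) < \<infinity>"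
    using weakL_moment_finite[OF U(1), of 1 K] U(2) K(1)
    by (simp add: compact_emeasure_finite[unfolded infinity_ennreal_def] borel_compact)
  show "norm (U x \<bullet> v x) \<le> c * norm (U x)" for x
    using order_trans[OF Cauchy_Schwarz_ineq2 mult_left_mono[OF c[of x] norm_ge_zero[of "U x"]]]
    by (simp add: ac_simps)
qed (use K in \<open>auto intro: borel_compact\<close>)

lemma test_fun_radial_derivative:
  assumes "\<psi> \<in> test_fun UNIV" shows "(\<lambda>y. y \<bullet> grad \<psi> y) \<in> test_fun UNIV"
proof (rule test_fun_subset[OF test_fun_grad[OF assms]])
  show "smooth (\<lambda>y. y \<bullet> grad \<psi> y)"
    by (intro smooth_bilinear[OF bounded_bilinear_inner] smooth_bounded_linear[OF bounded_linear_ident]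
        smooth_grad test_fun_smooth[OF assms])
  show "{y. y \<bullet> grad \<psi> y \<noteq> 0} \<subseteq> closure {x. grad \<psi> x \<noteq> 0}"
    using closure_subset[of "{x. grad \<psi> x \<noteq> 0}"] by force
qed

text \<open>The gradient of y . \<nabla>\<psi> is \<nabla>\<psi> plus the Hessian applied to y.
  Solved for the last term, this expresses the dilation term of the profile equation through rotated
  gradients of scalar test functions, to which \<open>weak_curl\<close> applies.\<close>

lemma perp_grad_radial_derivative:
  assumes s: "smooth \<psi>"
  shows "perp (grad (\<lambda>y. y \<bullet> grad \<psi> y) y) = perp (grad \<psi> y) + frechet_derivative (\<lambda>x. perp (grad \<psi> x)) (at y) y"
proof -
  let ?p = "\<lambda>i x. frechet_derivative \<psi> (at x) (axis i 1)"
  have dp: "(?p i has_derivative frechet_derivative (?p i) (at x)) (at x)" for i x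
    by (intro smooth_has_derivative smooth_frechet_derivative s)
  have dc: "((\<lambda>y. y $ i) has_derivative (\<lambda>h. h $ i)) (at y)" for i and y :: "real ^ 2"
    by (rule bounded_linear_imp_has_derivative[OF bounded_linear_vec_nth])
  have eq: "(\<lambda>y. y \<bullet> grad \<psi> y) = (\<lambda>y. y $ 1 * ?p 1 y + y $ 2 * ?p 2 y)"
    by (simp add: inner_vec_def sum_2 grad_component)
  have D: "frechet_derivative (\<lambda>y. y \<bullet> grad \<psi> y) (at y) h =
      y $ 1 * frechet_derivative (?p 1) (at y) h + h $ 1 * ?p 1 y + (y $ 2 * frechet_derivative (?p 2) (at y) h + h $ 2 * ?p 2 y)" for h
    unfolding eq
    using frechet_derivative_eq[OF has_derivative_add[OF has_derivative_mult[OF dc dp] has_derivative_mult[OF dc dp]]]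
    by simp
  \<comment> \<open>By symmetry of the Hessian, the derivative of the i-th partial in direction y
    becomes y dotted with the i-th derivative of the gradient, the form that the product rule
    \<open>D\<close> produces.\<close>
  have E: "frechet_derivative (?p i) (at y) y = y $ 1 * frechet_derivative (?p 1) (at y) (axis i 1)
      + y $ 2 * frechet_derivative (?p 2) (at y) (axis i 1)" for i
    using frechet_derivative_axis_sum[OF smooth_frechet_derivative[OF s, of "axis i 1"], of y y]
    unfolding mixed_partials_commute[OF s, of "axis i 1" y "axis 1 1"] mixed_partials_commute[OF s, of "axis i 1" y "axis 2 1"]
    by simp
  have "grad (\<lambda>y. y \<bullet> grad \<psi> y) y $ i = ?p i y + frechet_derivative (?p i) (at y) y" for i
    using exhaust_2[of i] unfolding grad_component D E by (auto simp: axis_def)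
  then show ?thesis
    by (simp add: vec_eq_iff forall_2 perp_component frechet_derivative_perp_grad[OF s] grad_component)
qed

lemma weak_curl_perp_grad:
  assumes "weak_curl U \<Omega>" "\<psi> \<in> test_fun UNIV"
  shows "(\<integral>x. U x \<bullet> perp (grad \<psi> x) \<partial>lborel) = - (\<integral>x. \<Omega> x * \<psi> x \<partial>lborel)"
proof -
  have "U x \<bullet> perp (grad \<psi> x) = U x $ 2 * grad \<psi> x $ 1 - U x $ 1 * grad \<psi> x $ 2" for x
    by (simp add: inner_vec_def sum_2 perp_component)
  then show ?thesis using assms unfolding weak_curl_def by simp
qed

text \<open>\<open>flux\<close> is the only nonlinear input. The other terms of the velocity
  equation, tested with a rotated gradient, are linear in \<open>U\<close> and become integrals of
  \<Omega> by the weak curl.\<close>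

lemma profile_vorticity_equation:
  assumes a: "0 < a" and U: "U \<in> weakL q" "4 < q" and curl: "weak_curl U \<Omega>"
    and eq: "euler_profile_eq a U P" and \<psi>: "\<psi> \<in> test_fun UNIV"
    and flux: "(\<integral>x. U x \<bullet> frechet_derivative (\<lambda>x. perp (grad \<psi> x)) (at x) (U x) \<partial>lborel)
      = - (\<integral>x. \<Omega> x * (U x \<bullet> grad \<psi> x) \<partial>lborel)"
  shows "(\<integral>x. \<Omega> x * (U x \<bullet> grad \<psi> x) \<partial>lborel) =
    (2 / (1 + a) - 1) * (\<integral>x. \<Omega> x * \<psi> x \<partial>lborel) + (1 / (1 + a)) * (\<integral>x. \<Omega> x * (x \<bullet> grad \<psi> x) \<partial>lborel)"
proof -
  let ?\<phi> = "\<lambda>x. perp (grad \<psi> x)" and ?\<chi> = "\<lambda>y. y \<bullet> grad \<psi> y"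
  let ?A = "\<lambda>x. frechet_derivative ?\<phi> (at x)"
  note s = test_fun_smooth[OF \<psi>]
  have \<phi>: "?\<phi> \<in> test_fun UNIV" by (rule test_fun_perp_grad[OF \<psi>])
  have \<chi>: "?\<chi> \<in> test_fun UNIV" by (rule test_fun_radial_derivative[OF \<psi>])
  have int: "integrable lborel (\<lambda>x. U x \<bullet> v x)" if v: "v \<in> test_fun UNIV" for v
  proof -
    obtain c where "\<And>x. norm (v x) \<le> c" using test_fun_bounded_range[OF v] by blast
    moreover obtain K where "compact K" "\<And>x. x \<notin> K \<Longrightarrow> v x = 0" using test_fun_support[OF v] by metis
    ultimately show ?thesis
      using U(2) by (intro weakL_integrable_inner[OF U(1) _ test_fun_borel[OF v]]) auto
  qed
  have A: "U x \<bullet> ?A x x = U x \<bullet> perp (grad ?\<chi> x) - U x \<bullet> ?\<phi> x" for x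
    unfolding perp_grad_radial_derivative[OF s] by (simp add: inner_add_right)
  have i1: "integrable lborel (\<lambda>x. U x \<bullet> ?\<phi> x)" by (rule int[OF \<phi>])
  have i2: "integrable lborel (\<lambda>x. U x \<bullet> perp (grad ?\<chi> x))" by (rule int[OF test_fun_perp_grad[OF \<chi>]])
  have i3: "integrable lborel (\<lambda>x. U x \<bullet> ?A x (U x))"
  proof -
    obtain c where c: "c > 0" "\<And>x h. norm (?A x h) \<le> c * norm h" using norm_frechet_derivative_le[OF \<phi>] by blast
    obtain K where K: "K \<in> sets borel" "emeasure lborel K < \<infinity>" "\<And>x. x \<notin> K \<Longrightarrow> ?A x = (\<lambda>_. 0)"
      using test_fun_support[OF \<phi>] by metis
    have [measurable]: "U \<in> borel_measurable borel" by (rule weakL_borel[OF U(1)])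
    have [measurable]: "(\<lambda>x. ?A x (U x)) \<in> borel_measurable borel"
      by (rule frechet_derivative_apply_borel[OF test_fun_smooth[OF \<phi>]]) simp_all
    show ?thesis
    proof (rule integrable_support_bound(1)[where c = c and F = "\<lambda>x. norm (U x) * norm (U x)" and S = K])
      show "norm (U x \<bullet> ?A x (U x)) \<le> c * (norm (U x) * norm (U x))" for x
        using order_trans[OF Cauchy_Schwarz_ineq2 mult_left_mono[OF c(2)[of x "U x"] norm_ge_zero[of "U x"]]]
        by (simp add: ac_simps)
    qed (use c K weakL_product_finite[OF U(1) _ U(1) U(2) K(1,2)] U(2) in auto)
  qed
  let ?b = "1 / (1 + a)"
  have J: "jacobian ?\<phi> (at y) *v h = ?A y h" for y h
    by (rule jacobian_mult[OF test_fun_smooth[OF \<phi>]])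
  have "0 = (\<integral>y. - ?b * (a * (U y \<bullet> ?\<phi> y) - 2 * (U y \<bullet> ?\<phi> y) - U y \<bullet> (jacobian ?\<phi> (at y) *v y))
             - U y \<bullet> (jacobian ?\<phi> (at y) *v U y) - P y * divergence ?\<phi> y \<partial>lborel)"
    using eq[unfolded euler_profile_eq_def, THEN bspec, OF \<phi>] by (rule sym)
  \<comment> \<open>The coefficient a - 1 is a - 2 from the equation, with 2 the dimension, plus 1
    from replacing the dilation term by means of \<open>A\<close>.\<close>
  also have "\<dots> = (\<integral>y. (- ?b * (a - 1)) * (U y \<bullet> ?\<phi> y) + ?b * (U y \<bullet> perp (grad ?\<chi> y)) - U y \<bullet> ?A y (U y) \<partial>lborel)"
  proof -
    have "- c * (a * X - 2 * X - (Y - X)) - Z - p * 0 = (- c * (a - 1)) * X + c * Y - Z" for c X Y Z p :: real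
      by (simp add: algebra_simps)
    then show ?thesis unfolding J A divergence_perp_grad[OF s] by (simp only:)
  qed
  also have "\<dots> = (- ?b * (a - 1)) * (\<integral>y. U y \<bullet> ?\<phi> y \<partial>lborel) + ?b * (\<integral>y. U y \<bullet> perp (grad ?\<chi> y) \<partial>lborel)
      - (\<integral>y. U y \<bullet> ?A y (U y) \<partial>lborel)"
    using i1 i2 i3 by simp
  also have "\<dots> = ?b * (a - 1) * (\<integral>x. \<Omega> x * \<psi> x \<partial>lborel) - ?b * (\<integral>x. \<Omega> x * ?\<chi> x \<partial>lborel) + (\<integral>x. \<Omega> x * (U x \<bullet> grad \<psi> x) \<partial>lborel)"
    unfolding weak_curl_perp_grad[OF curl \<psi>] weak_curl_perp_grad[OF curl \<chi>] flux by simp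
  finally have "(\<integral>x. \<Omega> x * (U x \<bullet> grad \<psi> x) \<partial>lborel) =
    - (?b * (a - 1)) * (\<integral>x. \<Omega> x * \<psi> x \<partial>lborel) + ?b * (\<integral>x. \<Omega> x * ?\<chi> x \<partial>lborel)" by simp
  moreover have "- (?b * (a - 1)) = 2 / (1 + a) - 1" using a by (simp add: field_simps)
  ultimately show ?thesis by (simp only:)
qed

section \<open>Transport in space-time\<close>

lemma nn_integral_lborel_scaleR:
  fixes f :: "'a::euclidean_space \<Rightarrow> ennreal"
  assumes [measurable]: "f \<in> borel_measurable borel" and c: "c \<noteq> 0"
  shows "(\<integral>\<^sup>+x. f x \<partial>lborel) = ennreal (\<bar>c\<bar> ^ DIM('a)) * (\<integral>\<^sup>+x. f (c *\<^sub>R x) \<partial>lborel)"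
  by (subst lborel_affine[OF c, of 0])
     (simp add: nn_integral_density nn_integral_distr nn_integral_cmult)

lemma integral_lborel_scaleR:
  fixes f :: "'a::euclidean_space \<Rightarrow> real"
  assumes [measurable]: "f \<in> borel_measurable borel" and c: "c \<noteq> 0"
  shows "(\<integral>x. f x \<partial>lborel) = \<bar>c\<bar> ^ DIM('a) * (\<integral>x. f (c *\<^sub>R x) \<partial>lborel)"
proof -
  have "(\<integral>x. f x \<partial>lborel) = (\<integral>x. f x \<partial>density (distr lborel borel (\<lambda>x. 0 + c *\<^sub>R x)) (\<lambda>_. ennreal (\<bar>c\<bar> ^ DIM('a))))"
    by (subst lborel_affine[OF c, of 0]) (simp add: ennreal_power)
  also have "\<dots> = \<bar>c\<bar> ^ DIM('a) * (\<integral>x. f (c *\<^sub>R x) \<partial>lborel)"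
    by (subst integral_density) (auto simp: integral_distr)
  finally show ?thesis .
qed

text \<open>The maximum over the interval sits at one end or the other according to the sign of
  \<open>e\<close>; the sum of both values avoids the distinction later.\<close>

lemma powr_le_endpoints:
  fixes t :: real
  assumes "0 < l" "l \<le> t" "t \<le> r" shows "t powr e \<le> l powr e + r powr e"
proof (cases "e \<ge> 0")
  case True
  then have "t powr e \<le> r powr e" using assms by (intro powr_mono2) auto
  then show ?thesis by (simp add: add_increasing)
next
  case False
  then have "t powr e \<le> l powr e" using assms by (intro powr_mono2') auto
  then show ?thesis by (simp add: add_increasing2)
qed

text \<open>At fixed t the substitution x = t^b y removes the scaling from \<open>F\<close>. For t
  between l and B the remaining powers of t are bounded, and the ball in x is carried into a fixed
  ball in y. The case b = e = 0 covers functions that do not depend on time.\<close>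

lemma self_similar_local_integrability:
  fixes F :: "real ^ 2 \<Rightarrow> real"
  assumes F [measurable]: "F \<in> borel_measurable borel" and F0: "\<And>y. F y \<ge> 0"
    and fin: "\<And>r. (\<integral>\<^sup>+y\<in>cball 0 r. ennreal (F y) \<partial>lborel) < \<infinity>"
    and b: "b \<ge> 0" and l: "0 < l"
  shows "(\<integral>\<^sup>+z\<in>{l..B} \<times> cball 0 B. ennreal (fst z powr e * F (fst z powr (- b) *\<^sub>R snd z)) \<partial>lborel) < \<infinity>"
proof -
  let ?r = "B * l powr (- b)"
  let ?I = "\<integral>\<^sup>+y\<in>cball 0 ?r. ennreal (F y) \<partial>lborel"
  \<comment> \<open>Dominates t^(2b+e) on the time interval, with 2b from the Jacobian of the planar
    dilation and e from the prefactor.\<close>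
  define C where "C = l powr (2 * b + e) + B powr (2 * b + e)"
  have C: "C \<ge> 0" by (simp add: C_def)
  define f :: "real \<times> (real ^ 2) \<Rightarrow> ennreal" where
    "f = (\<lambda>z. ennreal (fst z powr e * F (fst z powr (- b) *\<^sub>R snd z)) * indicator ({l..B} \<times> cball 0 B) z)"
  have f: "f \<in> borel_measurable (lborel \<Otimes>\<^sub>M lborel)"
  proof -
    have [measurable]: "{l..B} \<times> cball (0 :: real ^ 2) B \<in> sets (lborel \<Otimes>\<^sub>M lborel)"
      by (rule pair_measureI) simp_all
    have "(\<lambda>z :: real \<times> (real ^ 2). fst z powr e * F (fst z powr (- b) *\<^sub>R snd z)) \<in> borel_measurable (lborel \<Otimes>\<^sub>M lborel)"
      by measurable
    then show ?thesis
      unfolding f_def by measurable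
  qed
  have "(\<integral>\<^sup>+z\<in>{l..B} \<times> cball 0 B. ennreal (fst z powr e * F (fst z powr (- b) *\<^sub>R snd z)) \<partial>lborel)
     = (\<integral>\<^sup>+z. f z \<partial>(lborel \<Otimes>\<^sub>M lborel))"
    unfolding lborel_prod f_def ..
  also have "\<dots> = (\<integral>\<^sup>+t. \<integral>\<^sup>+x. f (t, x) \<partial>lborel \<partial>lborel)"
    by (rule lborel.nn_integral_fst[OF f, symmetric])
  also have "\<dots> = (\<integral>\<^sup>+t. \<integral>\<^sup>+x. ennreal (t powr e * F (t powr (- b) *\<^sub>R x)) * indicator ({l..B} \<times> cball 0 B) (t, x) \<partial>lborel \<partial>lborel)"
    unfolding f_def fst_conv snd_conv ..
  also have "\<dots> \<le> (\<integral>\<^sup>+t. ennreal C * ?I * indicator {l..B} t \<partial>lborel)"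
  proof (rule nn_integral_mono)
    fix t :: real
    show "(\<integral>\<^sup>+x. ennreal (t powr e * F (t powr (- b) *\<^sub>R x)) * indicator ({l..B} \<times> cball 0 B) (t, x) \<partial>lborel)
      \<le> ennreal C * ?I * indicator {l..B} t"
    proof (cases "t \<in> {l..B}")
      case True
      then have t: "t > 0" "l \<le> t" "t \<le> B" using l by auto
      have "(\<integral>\<^sup>+x. ennreal (t powr e * F (t powr (- b) *\<^sub>R x)) * indicator ({l..B} \<times> cball 0 B) (t, x) \<partial>lborel)
        = (\<integral>\<^sup>+x. ennreal (t powr e * F (t powr (- b) *\<^sub>R x)) * indicator (cball 0 B) x \<partial>lborel)"
        using True by (intro nn_integral_cong) (auto simp: indicator_def)
      also have "\<dots> = ennreal (\<bar>t powr b\<bar> ^ DIM(real ^ 2)) *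
         (\<integral>\<^sup>+y. ennreal (t powr e * F (t powr (- b) *\<^sub>R (t powr b *\<^sub>R y))) * indicator (cball 0 B) (t powr b *\<^sub>R y) \<partial>lborel)"
      proof (rule nn_integral_lborel_scaleR[where c = "t powr b" and
          f = "\<lambda>x. ennreal (t powr e * F (t powr (- b) *\<^sub>R x)) * indicator (cball 0 B) x"])
        have "(\<lambda>x. F (s *\<^sub>R x)) \<in> borel_measurable borel" for s
          by (rule measurable_compose[OF _ F]) simp
        then show "(\<lambda>x. ennreal (t powr e * F (t powr (- b) *\<^sub>R x)) * indicator (cball 0 B) x) \<in> borel_measurable borel"
          by (intro borel_measurable_times_ennreal borel_measurable_indicator measurable_compose[OF _ measurable_ennreal]
              borel_measurable_times borel_measurable_const) simp_all
      qed (use t in simp)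
      also have "\<bar>t powr b\<bar> ^ DIM(real ^ 2) = t powr (2 * b)"
        by (simp only: mult_2 powr_add) (simp add: power2_eq_square)
      also have "ennreal (t powr (2 * b)) *
         (\<integral>\<^sup>+y. ennreal (t powr e * F (t powr (- b) *\<^sub>R (t powr b *\<^sub>R y))) * indicator (cball 0 B) (t powr b *\<^sub>R y) \<partial>lborel)
         = (\<integral>\<^sup>+y. ennreal (t powr (2 * b)) * (ennreal (t powr e * F y) * indicator (cball 0 B) (t powr b *\<^sub>R y)) \<partial>lborel)"
      proof -
        have "t powr (- b) *\<^sub>R (t powr b *\<^sub>R y) = y" for y :: "real ^ 2"
          using t by (simp add: powr_minus)
        moreover have "(\<lambda>y. ennreal (t powr e * F y) * indicator (cball 0 B) (t powr b *\<^sub>R y)) \<in> borel_measurable lborel"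
          using F by (intro borel_measurable_times_ennreal measurable_compose[OF _ borel_measurable_indicator, of _ _ borel]
              measurable_compose[OF _ measurable_ennreal] borel_measurable_times borel_measurable_const) simp_all
        ultimately show ?thesis by (simp only: nn_integral_cmult)
      qed
      also have "\<dots> \<le> (\<integral>\<^sup>+y. ennreal C * (ennreal (F y) * indicator (cball 0 ?r) y) \<partial>lborel)"
      proof (rule nn_integral_mono)
        fix y
        have "t powr (2 * b) * (t powr e * F y) \<le> C * F y"
        proof -
          have "t powr (2 * b) * (t powr e * F y) = t powr (2 * b + e) * F y" by (simp add: powr_add)
          also have "\<dots> \<le> C * F y"
            unfolding C_def by (rule mult_right_mono[OF powr_le_endpoints[OF l t(2,3)] F0])
          finally show ?thesis .
        qed
        then have "ennreal (t powr (2 * b)) * ennreal (t powr e * F y) \<le> ennreal C * ennreal (F y)"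
          using F0[of y] C by (simp add: ennreal_leI flip: ennreal_mult)
        moreover have "norm y \<le> ?r" if "norm (t powr b *\<^sub>R y) \<le> B"
        proof -
          have "l powr b * norm y \<le> t powr b * norm y"
            using l t b by (intro mult_right_mono powr_mono2) auto
          also have "\<dots> \<le> B" using that by simp
          finally show ?thesis using l by (simp add: powr_minus field_simps)
        qed
        ultimately show "ennreal (t powr (2 * b)) * (ennreal (t powr e * F y) * indicator (cball 0 B) (t powr b *\<^sub>R y))
          \<le> ennreal C * (ennreal (F y) * indicator (cball 0 ?r) y)"
          by (auto simp: indicator_def)
      qed
      also have "\<dots> = ennreal C * ?I"
        using F by (intro nn_integral_cmult borel_measurable_times_ennreal borel_measurable_indicator
            measurable_compose[OF _ measurable_ennreal]) simp_all
      finally show ?thesis using True by simp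
    qed auto
  qed
  also have "\<dots> = ennreal C * ?I * emeasure lborel {l..B}"
    by (subst nn_integral_cmult_indicator) auto
  also have "\<dots> < \<infinity>"
    using fin[of ?r] emeasure_lborel_cbox_finite[of l B]
    by (simp add: ennreal_mult_less_top)
  finally show ?thesis .
qed

lemma compact_in_upper_half_space:
  fixes K :: "(real \<times> 'a::real_normed_vector) set"
  assumes "compact K" "K \<subseteq> {0<..} \<times> UNIV"
  obtains l B where "0 < l" "l < B" "K \<subseteq> {l..B} \<times> cball 0 B"
proof -
  obtain B where B: "B > 0" "\<And>z. z \<in> K \<Longrightarrow> norm z \<le> B"
    using compact_imp_bounded[OF assms(1)] by (auto simp: bounded_pos)
  obtain l where l: "l > 0" "\<And>z. z \<in> K \<Longrightarrow> l \<le> fst z"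
  proof (cases "K = {}")
    case False
    have "continuous_on K (fst :: real \<times> 'a \<Rightarrow> real)" by (intro continuous_intros)
    then obtain z where "z \<in> K" "\<And>y. y \<in> K \<Longrightarrow> fst z \<le> fst y"
      using continuous_attains_inf[OF assms(1) False] by metis
    then show ?thesis using assms(2) by (intro that[of "fst z"]) auto
  qed (use that[of 1] in auto)
  show ?thesis
  \<comment> \<open>Lowering the infimum of the times to at most B/2 enforces the strict inequality
    l < B.\<close>
  proof (rule that[of "min l (B / 2)" B])
    show "K \<subseteq> {min l (B / 2)..B} \<times> cball 0 B"
    proof
      fix z assume z: "z \<in> K"
      have "\<bar>fst z\<bar> \<le> norm z" "norm (snd z) \<le> norm z"
        using norm_fst_le[of "fst z" "snd z"] norm_snd_le[of "snd z" "fst z"] by auto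
      then show "z \<in> {min l (B / 2)..B} \<times> cball 0 B"
        using B(2)[OF z] l(2)[OF z] by (auto simp: mem_Times_iff)
    qed
  qed (use l B in auto)
qed

section \<open>Space-time test functions along the curves x = t^b y\<close>

lemma test_fun_time_slice:
  fixes \<phi> :: "real \<times> 'a::euclidean_space \<Rightarrow> 'b::real_normed_vector"
  assumes \<phi>: "\<phi> \<in> test_fun X" and c: "c > 0"
  shows "(\<lambda>y. \<phi> (t, c *\<^sub>R y)) \<in> test_fun UNIV"
    and "frechet_derivative (\<lambda>y. \<phi> (t, c *\<^sub>R y)) (at y) h = frechet_derivative \<phi> (at (t, c *\<^sub>R y)) (0, c *\<^sub>R h)"
proof -
  have bl: "bounded_linear (\<lambda>y :: 'a. (0 :: real, c *\<^sub>R y))"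
    by (intro bounded_linear_Pair bounded_linear_zero bounded_linear_scaleR_right)
  have eq: "(t, c *\<^sub>R y) = (t, 0) + (0, c *\<^sub>R y)" for y :: 'a by simp
  have "smooth (\<lambda>y. \<phi> (t, c *\<^sub>R y))"
    unfolding eq by (rule smooth_affine_comp[OF bl test_fun_smooth[OF \<phi>]])
  moreover have "bounded {y. \<phi> (t, c *\<^sub>R y) \<noteq> 0}"
  proof -
    have "bounded {z. \<phi> z \<noteq> 0}"
      using \<phi> by (auto simp: test_fun_def)
    then obtain B where B: "\<And>z. \<phi> z \<noteq> 0 \<Longrightarrow> norm z \<le> B"
      by (auto simp: bounded_iff)
    have "norm y \<le> B / c" if "\<phi> (t, c *\<^sub>R y) \<noteq> 0" for y
    proof -
      have "norm (c *\<^sub>R y) \<le> B"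
        using B[OF that] norm_snd_le[of "c *\<^sub>R y" t] by linarith
      then show ?thesis using c by (simp add: field_simps)
    qed
    then show ?thesis by (auto simp: bounded_iff)
  qed
  ultimately show "(\<lambda>y. \<phi> (t, c *\<^sub>R y)) \<in> test_fun UNIV" by (simp add: test_fun_UNIV_iff)
  have "((\<lambda>y. (t, c *\<^sub>R y)) has_derivative (\<lambda>h. (0, c *\<^sub>R h))) (at y)"
    by (auto intro!: derivative_eq_intros)
  from has_derivative_compose[OF this smooth_has_derivative[OF test_fun_smooth[OF \<phi>]]]
  show "frechet_derivative (\<lambda>y. \<phi> (t, c *\<^sub>R y)) (at y) h = frechet_derivative \<phi> (at (t, c *\<^sub>R y)) (0, c *\<^sub>R h)"
    by (simp add: frechet_derivative_eq)
qed

lemma frechet_derivative_scale_snd: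
  assumes "smooth \<phi>"
  shows "frechet_derivative \<phi> (at z) (0, c *\<^sub>R h) = c *\<^sub>R frechet_derivative \<phi> (at z) (0, h)"
  using linear_cmul[OF has_derivative_linear[OF smooth_has_derivative[OF assms, of z]], of c "(0, h)"] by simp

text \<open>With \<open>b = 1 / (1 + a)\<close>, the substitution \<open>x = t\<^sup>b y\<close> turns the space-time integrand into \<open>\<Omega>(y)\<close> times the
  time derivative of \<open>t\<^bsup>2b-1\<^esup> \<phi>(t, t\<^sup>b y)\<close>; this is its explicit form.\<close>
definition slice_derivative :: "real \<Rightarrow> (real \<times> (real ^ 2) \<Rightarrow> real) \<Rightarrow> real \<Rightarrow> real ^ 2 \<Rightarrow> real" where
  "slice_derivative b \<phi> t y = t powr (2 * b - 1) * frechet_derivative \<phi> (at (t, t powr b *\<^sub>R y)) (1, 0)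
     + (2 * b - 1) * t powr (2 * b - 2) * \<phi> (t, t powr b *\<^sub>R y)
     + b * t powr (3 * b - 2) * frechet_derivative \<phi> (at (t, t powr b *\<^sub>R y)) (0, y)"

text \<open>The weight t^(2b-1) is the Jacobian t^(2b) of the planar dilation times the factor
  t^(-1) of the self-similar vorticity. The exponent 3b - 2 adds b - 1 from differentiating
  t^b.\<close>

lemma has_real_derivative_slice:
  assumes \<phi>: "smooth \<phi>" and t: "t > 0"
  shows "((\<lambda>t. t powr (2 * b - 1) * \<phi> (t, t powr b *\<^sub>R y)) has_real_derivative slice_derivative b \<phi> t y) (at t)"
proof -
  let ?z = "(t, t powr b *\<^sub>R y)"
  have "((\<lambda>t. t powr b) has_vector_derivative b * t powr (b - 1)) (at t)"
    using has_real_derivative_powr[OF t, of b] by (simp add: has_real_derivative_iff_has_vector_derivative)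
  then have "((\<lambda>t. t powr b *\<^sub>R y) has_vector_derivative (b * t powr (b - 1)) *\<^sub>R y) (at t)"
    by (rule bounded_linear.has_vector_derivative[OF bounded_linear_scaleR_left])
  then have "((\<lambda>t. (t, t powr b *\<^sub>R y)) has_vector_derivative (1, (b * t powr (b - 1)) *\<^sub>R y)) (at t)"
    by (intro has_vector_derivative_Pair has_vector_derivative_id)
  from vector_derivative_diff_chain_within[OF this has_derivative_at_withinI[OF smooth_has_derivative[OF \<phi>]]]
  have d: "((\<lambda>t. \<phi> (t, t powr b *\<^sub>R y)) has_real_derivative
      frechet_derivative \<phi> (at ?z) (1, (b * t powr (b - 1)) *\<^sub>R y)) (at t)"
    by (simp add: o_def has_real_derivative_iff_has_vector_derivative)
  have lin: "linear (frechet_derivative \<phi> (at ?z))"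
    by (rule has_derivative_linear[OF smooth_has_derivative[OF \<phi>]])
  have e: "frechet_derivative \<phi> (at ?z) (1, (b * t powr (b - 1)) *\<^sub>R y)
      = frechet_derivative \<phi> (at ?z) (1, 0) + b * t powr (b - 1) * frechet_derivative \<phi> (at ?z) (0, y)"
    using linear_add[OF lin, of "(1, 0)" "(0, (b * t powr (b - 1)) *\<^sub>R y)"]
    by (simp add: frechet_derivative_scale_snd[OF \<phi>])
  have p: "t powr (2 * b - 1) * t powr (b - 1) = t powr (3 * b - 2)"
    by (simp add: powr_add[symmetric])
  have "((\<lambda>t. t powr (2 * b - 1)) has_real_derivative (2 * b - 1) * t powr (2 * b - 2)) (at t)"
    using has_real_derivative_powr[OF t, of "2 * b - 1"] by simp
  from DERIV_mult[OF this d]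
  show ?thesis
    unfolding slice_derivative_def e p[symmetric] by (simp add: algebra_simps)
qed

lemma integral_slice_derivative:
  fixes \<phi> :: "real \<times> (real ^ 2) \<Rightarrow> real"
  assumes \<phi>: "smooth \<phi>" and l: "0 < l" "l < B"
    and supp: "\<And>t x. t \<notin> {l..B} \<Longrightarrow> \<phi> (t, x) = 0" "\<And>t x. t \<notin> {l..B} \<Longrightarrow> frechet_derivative \<phi> (at (t, x)) = (\<lambda>_. 0)"
  shows "(\<integral>t. slice_derivative b \<phi> t y \<partial>lborel) = 0"
proof -
  let ?k = "\<lambda>t. t powr (2 * b - 1) * \<phi> (t, t powr b *\<^sub>R y)"
  have cont: "isCont (\<lambda>t. f (t, t powr b *\<^sub>R y)) t" if "smooth f" "t > 0" for t and f :: "real \<times> (real ^ 2) \<Rightarrow> real"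
  proof (rule isCont_o2[where g = f])
    show "isCont (\<lambda>t. (t, t powr b *\<^sub>R y)) t" using that by (intro continuous_intros) auto
    show "isCont f (t, t powr b *\<^sub>R y)"
      using smooth_continuous_on[OF that(1), of UNIV] by (simp add: continuous_on_eq_continuous_at)
  qed
  \<comment> \<open>The interval is enlarged so that \<phi> vanishes at both ends; its left end
    stays positive, where the powers of t are differentiable.\<close>
  have "(\<integral>t. slice_derivative b \<phi> t y * indicator {l / 2..B + 1} t \<partial>lborel) = ?k (B + 1) - ?k (l / 2)"
  proof (rule integral_FTC_Icc_real)
    fix t assume "l / 2 \<le> t"
    then have t: "t > 0" using l by simp
    show "DERIV ?k t :> slice_derivative b \<phi> t y" by (rule has_real_derivative_slice[OF \<phi> t])
    show "isCont (\<lambda>t. slice_derivative b \<phi> t y) t"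
      unfolding slice_derivative_def using t
      by (intro continuous_intros cont smooth_frechet_derivative \<phi>) auto
  qed (use l in auto)
  also have "\<dots> = 0" using l by (simp add: supp)
  also have "(\<lambda>t. slice_derivative b \<phi> t y * indicator {l / 2..B + 1} t) = (\<lambda>t. slice_derivative b \<phi> t y)"
  proof
    fix t
    show "slice_derivative b \<phi> t y * indicator {l / 2..B + 1} t = slice_derivative b \<phi> t y"
      using l by (cases "t \<in> {l..B}") (auto simp: indicator_def slice_derivative_def supp)
  qed
  finally show ?thesis .
qed

text \<open>Fubini is used in both orders: integrating in space first gives slices to which the
  profile equation applies, integrating in time first gives an exact derivative for each fixed
  y.\<close>

lemma self_similar_transport:
  fixes U :: "real ^ 2 \<Rightarrow> real ^ 2" and \<Omega> :: "real ^ 2 \<Rightarrow> real"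
  assumes a: "0 < a"
    and U [measurable]: "U \<in> borel_measurable borel" and \<Omega> [measurable]: "\<Omega> \<in> borel_measurable borel"
    and fin: "\<And>r. (\<integral>\<^sup>+y\<in>cball 0 r. ennreal \<bar>\<Omega> y\<bar> \<partial>lborel) < \<infinity>"
      "\<And>r. (\<integral>\<^sup>+y\<in>cball 0 r. ennreal (\<bar>\<Omega> y\<bar> * norm (U y)) \<partial>lborel) < \<infinity>"
    and eq: "\<And>\<psi>. \<psi> \<in> test_fun UNIV \<Longrightarrow> (\<integral>y. \<Omega> y * (U y \<bullet> grad \<psi> y) \<partial>lborel) =
      (2 / (1 + a) - 1) * (\<integral>y. \<Omega> y * \<psi> y \<partial>lborel) + (1 / (1 + a)) * (\<integral>y. \<Omega> y * (y \<bullet> grad \<psi> y) \<partial>lborel)"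
  shows "weak_transport (velocity_field a U) (vorticity_field a \<Omega>)"
proof -
  define b where "b = 1 / (1 + a)"
  have b: "b > 0" "a / (1 + a) = 1 - b" "2 / (1 + a) = 2 * b" "1 / (1 + a) = b"
    using a by (auto simp: b_def field_simps)
  define w where "w t x = t powr (- 1) * \<Omega> (t powr (- b) *\<^sub>R x)" for t x
  define v where "v t x = t powr (- (1 - b)) *\<^sub>R U (t powr (- b) *\<^sub>R x)" for t x
  have wv: "vorticity_field a \<Omega> = w" "velocity_field a U = v"
    by (auto simp: fun_eq_iff vorticity_field_def velocity_field_def w_def v_def b)
  have wm: "(\<lambda>z. w (fst z) (snd z)) \<in> borel_measurable borel"
    and vm: "(\<lambda>z. v (fst z) (snd z)) \<in> borel_measurable borel"
    unfolding w_def v_def borel_prod[symmetric] by measurable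
  let ?S = "\<lambda>l B. {l..B} \<times> cball (0 :: real ^ 2) B"
  have S: "?S l B \<in> sets borel" for l B
    by (intro borel_closed closed_Times) auto
  let ?W = "\<lambda>z :: real \<times> (real ^ 2). fst z powr (- 1) * \<bar>\<Omega> (fst z powr (- b) *\<^sub>R snd z)\<bar>"
  let ?WV = "\<lambda>z :: real \<times> (real ^ 2). fst z powr (- 1 - (1 - b)) * (\<bar>\<Omega> (fst z powr (- b) *\<^sub>R snd z)\<bar> * norm (U (fst z powr (- b) *\<^sub>R snd z)))"
  have Wm: "?W \<in> borel_measurable borel" and WVm: "?WV \<in> borel_measurable borel"
    unfolding borel_prod[symmetric] by measurable
  have finW: "(\<integral>\<^sup>+z\<in>?S l B. ennreal (?W z) \<partial>lborel) < \<infinity>" if "l > 0" for l B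
    by (rule self_similar_local_integrability[OF _ _ fin(1) _ that]) (use b in auto)
  have finWV: "(\<integral>\<^sup>+z\<in>?S l B. ennreal (?WV z) \<partial>lborel) < \<infinity>" if "l > 0" for l B
    by (rule self_similar_local_integrability[OF _ _ fin(2) _ that]) (use b in auto)
  have nw: "\<bar>w (fst z) (snd z)\<bar> = ?W z" for z
    by (simp add: w_def abs_mult)
  have nwv: "\<bar>w (fst z) (snd z)\<bar> * norm (v (fst z) (snd z)) = ?WV z" for z
  proof -
    have "fst z powr (- 1 - (1 - b)) = fst z powr (- 1) * fst z powr (- (1 - b))"
      by (simp only: powr_add[symmetric]) simp
    then show ?thesis by (simp add: w_def v_def abs_mult)
  qed

  have "loc_integrable_on ({0<..} \<times> UNIV) (\<lambda>(t, x). w t x)"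
    unfolding loc_integrable_on_def set_integrable_def
  proof (intro allI impI, elim conjE)
    fix K :: "(real \<times> (real ^ 2)) set" assume K: "compact K" "K \<subseteq> {0<..} \<times> UNIV"
    obtain l B where lB: "0 < l" "l < B" "K \<subseteq> ?S l B" using compact_in_upper_half_space[OF K] .
    show "integrable lborel (\<lambda>z. indicator K z *\<^sub>R (case z of (t, x) \<Rightarrow> w t x))"
    proof (rule integrable_support_bound(1)[OF _ zero_le_one Wm S finW[OF lB(1)]])
      show "(\<lambda>z. indicator K z *\<^sub>R (case z of (t, x) \<Rightarrow> w t x)) \<in> borel_measurable borel"
        using wm borel_compact[OF K(1)] by (auto simp: case_prod_beta intro!: borel_measurable_scaleR borel_measurable_indicator)
      show "norm (indicator K z *\<^sub>R (case z of (t, x) \<Rightarrow> w t x)) \<le> 1 * ?W z" for z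
        unfolding nw[symmetric] by (auto simp: case_prod_beta indicator_def)
      show "indicator K z *\<^sub>R (case z of (t, x) \<Rightarrow> w t x) = 0" if "z \<notin> ?S l B" for z
        using that lB(3) by (auto simp: indicator_def)
    qed
  qed
  moreover have "loc_integrable_on ({0<..} \<times> UNIV) (\<lambda>(t, x). w t x *\<^sub>R v t x)"
    unfolding loc_integrable_on_def set_integrable_def
  proof (intro allI impI, elim conjE)
    fix K :: "(real \<times> (real ^ 2)) set" assume K: "compact K" "K \<subseteq> {0<..} \<times> UNIV"
    obtain l B where lB: "0 < l" "l < B" "K \<subseteq> ?S l B" using compact_in_upper_half_space[OF K] .
    show "integrable lborel (\<lambda>z. indicator K z *\<^sub>R (case z of (t, x) \<Rightarrow> w t x *\<^sub>R v t x))"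
    proof (rule integrable_support_bound(1)[OF _ zero_le_one WVm S finWV[OF lB(1)]])
      show "(\<lambda>z. indicator K z *\<^sub>R (case z of (t, x) \<Rightarrow> w t x *\<^sub>R v t x)) \<in> borel_measurable borel"
        using wm vm borel_compact[OF K(1)] by (auto simp: case_prod_beta intro!: borel_measurable_scaleR borel_measurable_indicator)
      show "norm (indicator K z *\<^sub>R (case z of (t, x) \<Rightarrow> w t x *\<^sub>R v t x)) \<le> 1 * ?WV z" for z
        unfolding nwv[symmetric] by (auto simp: case_prod_beta indicator_def)
      show "indicator K z *\<^sub>R (case z of (t, x) \<Rightarrow> w t x *\<^sub>R v t x) = 0" if "z \<notin> ?S l B" for z
        using that lB(3) by (auto simp: indicator_def)
    qed
  qed
  moreover have "(\<integral>(t, x). w t x * frechet_derivative \<phi> (at (t, x)) (1, 0)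
                + w t x * frechet_derivative \<phi> (at (t, x)) (0, v t x) \<partial>lborel) = 0"
    if \<phi>: "\<phi> \<in> test_fun ({0<..} \<times> UNIV)" for \<phi> :: "real \<times> (real ^ 2) \<Rightarrow> real"
  proof -
    note s = test_fun_smooth[OF \<phi>]
    let ?D = "\<lambda>z. frechet_derivative \<phi> (at z)"
    obtain K where K: "compact K" "K \<subseteq> {0<..} \<times> UNIV" "\<And>z. z \<notin> K \<Longrightarrow> \<phi> z = 0" "\<And>z. z \<notin> K \<Longrightarrow> ?D z = (\<lambda>_. 0)"
      using test_fun_support[OF \<phi>] by metis
    obtain l B where lB: "0 < l" "l < B" "K \<subseteq> ?S l B" using compact_in_upper_half_space[OF K(1,2)] .
    have z0: "\<phi> z = 0" "?D z = (\<lambda>_. 0)" if "z \<notin> ?S l B" for z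
      using that K lB(3) by blast+
    have zt: "\<phi> (t, x) = 0" "?D (t, x) = (\<lambda>_. 0)" if "t \<notin> {l..B}" for t x
      using that z0[of "(t, x)"] by auto
    obtain c where c: "c > 0" "\<And>z h. \<bar>?D z h\<bar> \<le> c * norm h"
      using norm_frechet_derivative_le[OF \<phi>] by (metis real_norm_def)
    obtain c0 where c0: "c0 > 0" "\<And>z. \<bar>\<phi> z\<bar> \<le> c0"
      using test_fun_bounded_range[OF \<phi>] by auto

    define F where "F t x = w t x * ?D (t, x) (1, 0) + w t x * ?D (t, x) (0, v t x)" for t x
    have Dm: "(\<lambda>z. ?D z (h z)) \<in> borel_measurable borel" if "h \<in> borel_measurable borel" for h
      by (rule frechet_derivative_apply_borel[OF s _ that]) simp
    have Fm: "(\<lambda>z. F (fst z) (snd z)) \<in> borel_measurable borel"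
      unfolding F_def prod.collapse
      using vm by (intro borel_measurable_add borel_measurable_times wm Dm borel_measurable_Pair borel_measurable_const)
    have iF1: "integrable lborel (\<lambda>z. w (fst z) (snd z) * ?D z (1, 0))"
    proof (rule integrable_support_bound(1)[OF _ _ Wm S finW[OF lB(1)]])
      show "(\<lambda>z. w (fst z) (snd z) * ?D z (1, 0)) \<in> borel_measurable borel"
        by (intro borel_measurable_times wm Dm borel_measurable_const)
      show "norm (w (fst z) (snd z) * ?D z (1, 0)) \<le> c * ?W z" for z
        unfolding nw[symmetric] using mult_left_mono[OF c(2)[of z "(1, 0)"] abs_ge_zero[of "w (fst z) (snd z)"]]
        by (simp add: abs_mult mult.commute)
      show "w (fst z) (snd z) * ?D z (1, 0) = 0" if "z \<notin> ?S l B" for z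
        using z0(2)[OF that] by simp
    qed (use c in simp)
    have iF2: "integrable lborel (\<lambda>z. w (fst z) (snd z) * ?D z (0, v (fst z) (snd z)))"
    proof (rule integrable_support_bound(1)[OF _ _ WVm S finWV[OF lB(1)]])
      show "(\<lambda>z. w (fst z) (snd z) * ?D z (0, v (fst z) (snd z))) \<in> borel_measurable borel"
        by (intro borel_measurable_times wm Dm borel_measurable_const borel_measurable_Pair vm)
      show "norm (w (fst z) (snd z) * ?D z (0, v (fst z) (snd z))) \<le> c * ?WV z" for z
        unfolding nwv[symmetric] using mult_left_mono[OF c(2)[of z "(0, v (fst z) (snd z))"] abs_ge_zero[of "w (fst z) (snd z)"]]
        by (simp add: abs_mult ac_simps)
      show "w (fst z) (snd z) * ?D z (0, v (fst z) (snd z)) = 0" if "z \<notin> ?S l B" for z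
        using z0(2)[OF that] by simp
    qed (use c in simp)
    have iF: "integrable (lborel \<Otimes>\<^sub>M lborel) (case_prod F)"
    proof -
      have "case_prod F = (\<lambda>z. w (fst z) (snd z) * ?D z (1, 0) + w (fst z) (snd z) * ?D z (0, v (fst z) (snd z)))"
        by (auto simp: F_def fun_eq_iff)
      then show ?thesis
        unfolding lborel_prod using Bochner_Integration.integrable_add[OF iF1 iF2] by simp
    qed

    let ?H = "slice_derivative b \<phi>"
    \<comment> \<open>From |t^b y| \<le> B and t \<ge> l follows |y| \<le> B l^(-b); the maximum
      with B lets one number bound both t and y.\<close>
    define B' where "B' = max B (B * l powr (- b))"
    have H0: "?H t y = 0" if "(t, y) \<notin> ?S l B'" for t y
    proof (cases "t \<in> {l..B}")
      case True
      then have "norm y > B'" using that by (auto simp: B'_def)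
      then have y: "norm y > B * l powr (- b)" by (simp add: B'_def)
      have "B = l powr b * (B * l powr (- b))" using lB by (simp add: powr_minus)
      also have "\<dots> < l powr b * norm y" using y lB by (intro mult_strict_left_mono) auto
      also have "\<dots> \<le> t powr b * norm y" using True lB b by (intro mult_right_mono powr_mono2) auto
      finally have "(t, t powr b *\<^sub>R y) \<notin> ?S l B" by simp
      from z0[OF this] show ?thesis by (simp add: slice_derivative_def)
    next
      case False
      then show ?thesis by (simp add: slice_derivative_def zt)
    qed
    define C where "C = (l powr (2 * b - 1) + B' powr (2 * b - 1)) * c + \<bar>2 * b - 1\<bar> * (l powr (2 * b - 2) + B' powr (2 * b - 2)) * c0
        + b * (l powr (3 * b - 2) + B' powr (3 * b - 2)) * (c * B')"
    have B': "B' > 0" using lB by (simp add: B'_def)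
    have C: "C \<ge> 0" unfolding C_def using c c0 b B' by (intro add_nonneg_nonneg mult_nonneg_nonneg) auto
    have HC: "\<bar>?H t y\<bar> \<le> C" if "(t, y) \<in> ?S l B'" for t y
    proof -
      have t: "l \<le> t" "t \<le> B'" "norm y \<le> B'" using that by auto
      note p = powr_le_endpoints[OF lB(1) t(1,2)]
      let ?z = "(t, t powr b *\<^sub>R y)"
      have 1: "\<bar>t powr (2 * b - 1) * ?D ?z (1, 0)\<bar> \<le> (l powr (2 * b - 1) + B' powr (2 * b - 1)) * c"
        unfolding abs_mult using p c(2)[of ?z "(1, 0)"] by (intro mult_mono) auto
      have 2: "\<bar>(2 * b - 1) * t powr (2 * b - 2) * \<phi> ?z\<bar> \<le> \<bar>2 * b - 1\<bar> * (l powr (2 * b - 2) + B' powr (2 * b - 2)) * c0"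
        unfolding abs_mult using p c0 by (intro mult_mono) auto
      have "\<bar>?D ?z (0, y)\<bar> \<le> c * B'"
      proof -
        have "\<bar>?D ?z (0, y)\<bar> \<le> c * norm y" using c(2)[of ?z "(0, y)"] by simp
        also have "\<dots> \<le> c * B'" using t(3) c(1) by (intro mult_left_mono) auto
        finally show ?thesis .
      qed
      then have 3: "\<bar>b * t powr (3 * b - 2) * ?D ?z (0, y)\<bar> \<le> b * (l powr (3 * b - 2) + B' powr (3 * b - 2)) * (c * B')"
        unfolding abs_mult using p b c B' by (intro mult_mono) auto
      show ?thesis
        unfolding slice_derivative_def C_def using 1 2 3 by linarith
    qed
    \<comment> \<open>Needed for exchanging the order of integration. As \<open>?H\<close> is
      bounded and vanishes off a compact box, it reduces to local integrability of \<Omega> on the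
      product, the unscaled case b = e = 0.\<close>
    have iG: "integrable (lborel \<Otimes>\<^sub>M lborel) (\<lambda>(t, y). \<Omega> y * ?H t y)"
      unfolding lborel_prod
    proof (rule integrable_support_bound(1)[OF _ C _ S])
      have zm: "(\<lambda>z :: real \<times> (real ^ 2). (fst z, fst z powr b *\<^sub>R snd z)) \<in> borel_measurable borel"
        unfolding borel_prod[symmetric] by measurable
      have "(\<lambda>z. ?D (fst z, fst z powr b *\<^sub>R snd z) (h z)) \<in> borel_measurable borel"
        if "h \<in> borel_measurable borel" for h
        by (rule frechet_derivative_apply_borel[OF s zm that])
      moreover have "(\<lambda>z :: real \<times> (real ^ 2). (0 :: real, snd z)) \<in> borel_measurable borel"
        "(\<lambda>z :: real \<times> (real ^ 2). \<Omega> (snd z)) \<in> borel_measurable borel"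
        "\<And>e. (\<lambda>z :: real \<times> (real ^ 2). fst z powr e) \<in> borel_measurable borel"
        unfolding borel_prod[symmetric] by measurable
      moreover have "(\<lambda>z. \<phi> (fst z, fst z powr b *\<^sub>R snd z)) \<in> borel_measurable borel"
        by (rule measurable_compose[OF zm test_fun_borel[OF \<phi>]])
      ultimately show "(\<lambda>(t, y). \<Omega> y * ?H t y) \<in> borel_measurable borel"
        unfolding slice_derivative_def case_prod_beta
        by (intro borel_measurable_times borel_measurable_add borel_measurable_const) auto
      show "(\<lambda>z. \<bar>\<Omega> (snd z)\<bar>) \<in> borel_measurable (borel :: (real \<times> (real ^ 2)) measure)"
        unfolding borel_prod[symmetric] by measurable
      have "(\<integral>\<^sup>+z\<in>?S l B'. ennreal (fst z powr 0 * \<bar>\<Omega> (fst z powr (- 0) *\<^sub>R snd z)\<bar>) \<partial>lborel) < \<infinity>"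
        by (rule self_similar_local_integrability[OF _ _ fin(1) _ lB(1)]) auto
      also have "(\<integral>\<^sup>+z\<in>?S l B'. ennreal (fst z powr 0 * \<bar>\<Omega> (fst z powr (- 0) *\<^sub>R snd z)\<bar>) \<partial>lborel)
          = (\<integral>\<^sup>+z\<in>?S l B'. ennreal \<bar>\<Omega> (snd z)\<bar> \<partial>lborel)"
        using lB by (intro nn_integral_cong) (auto simp: indicator_def)
      finally show "(\<integral>\<^sup>+z\<in>?S l B'. ennreal \<bar>\<Omega> (snd z)\<bar> \<partial>lborel) < \<infinity>" .
      show "norm (case z of (t, y) \<Rightarrow> \<Omega> y * ?H t y) \<le> C * \<bar>\<Omega> (snd z)\<bar>" if "z \<in> ?S l B'" for z
        using mult_left_mono[OF HC[of "fst z" "snd z"] abs_ge_zero[of "\<Omega> (snd z)"]] that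
        by (simp add: case_prod_beta abs_mult mult.commute)
      show "(case z of (t, y) \<Rightarrow> \<Omega> y * ?H t y) = 0" if "z \<notin> ?S l B'" for z
        using H0[of "fst z" "snd z"] that by (simp add: case_prod_beta)
    qed

    \<comment> \<open>At each fixed time the flux is eliminated by the profile equation with \<Phi>,
      the time slice of \<phi> in the variable y, as test function. Outside the time support both
      sides vanish.\<close>
    have slice: "(\<integral>x. F t x \<partial>lborel) = (\<integral>y. \<Omega> y * ?H t y \<partial>lborel)" for t
    proof (cases "t \<in> {l..B}")
      case False
      then show ?thesis by (simp add: F_def slice_derivative_def zt)
    next
      case True
      then have t: "t > 0" using lB by simp
      define r where "r = t powr b"
      have r: "r > 0" using t by (simp add: r_def)
      define \<Phi> where "\<Phi> y = \<phi> (t, r *\<^sub>R y)" for y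
      define \<Phi>' where "\<Phi>' y = ?D (t, r *\<^sub>R y) (1, 0)" for y
      have \<Phi>: "\<Phi> \<in> test_fun UNIV" unfolding \<Phi>_def[abs_def] by (rule test_fun_time_slice(1)[OF \<phi> r])
      have \<Phi>': "\<Phi>' \<in> test_fun UNIV"
        unfolding \<Phi>'_def[abs_def] by (rule test_fun_time_slice(1)[OF test_fun_frechet_derivative[OF \<phi>] r])
      have gr: "h \<bullet> grad \<Phi> y = r * ?D (t, r *\<^sub>R y) (0, h)" for h y
        using frechet_derivative_grad[OF test_fun_smooth[OF \<Phi>], of y h]
        unfolding \<Phi>_def[abs_def] test_fun_time_slice(2)[OF \<phi> r] by (simp add: frechet_derivative_scale_snd[OF s])
      have int: "integrable lborel (\<lambda>y. \<Omega> y * g y)" if g: "g \<in> test_fun UNIV" for g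
      proof -
        obtain M where M: "M > 0" "\<And>x. norm (g x) \<le> M" using test_fun_bounded_range[OF g] by blast
        obtain R where R: "\<And>x. g x \<noteq> 0 \<Longrightarrow> norm x \<le> R" using g by (auto simp: test_fun_UNIV_iff bounded_iff)
        show ?thesis
        proof (rule integrable_support_bound(1)[where c = M and S = "cball 0 R", OF _ _ _ _ fin(1)])
          show "(\<lambda>y. \<Omega> y * g y) \<in> borel_measurable borel"
            using test_fun_borel[OF g] by (intro borel_measurable_times \<Omega>)
          show "norm (\<Omega> y * g y) \<le> M * \<bar>\<Omega> y\<bar>" for y
            using mult_left_mono[OF M(2)[of y] abs_ge_zero[of "\<Omega> y"]] by (simp add: abs_mult mult.commute)
          show "\<Omega> y * g y = 0" if "y \<notin> cball 0 R" for y using R[of y] that by auto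
        qed (use M in auto)
      qed
      have intU: "integrable lborel (\<lambda>y. \<Omega> y * (U y \<bullet> grad \<Phi> y))"
      proof -
        obtain M where M: "M > 0" "\<And>x. norm (grad \<Phi> x) \<le> M" using test_fun_bounded_range[OF test_fun_grad[OF \<Phi>]] by blast
        obtain R where R: "\<And>x. grad \<Phi> x \<noteq> 0 \<Longrightarrow> norm x \<le> R"
          using test_fun_grad[OF \<Phi>] by (auto simp: test_fun_UNIV_iff bounded_iff)
        show ?thesis
        proof (rule integrable_support_bound(1)[where c = M and S = "cball 0 R", OF _ _ _ _ fin(2)])
          show "(\<lambda>y. \<Omega> y * (U y \<bullet> grad \<Phi> y)) \<in> borel_measurable borel"
            using test_fun_borel[OF test_fun_grad[OF \<Phi>]] by (intro borel_measurable_times borel_measurable_inner \<Omega> U)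
          show "norm (\<Omega> y * (U y \<bullet> grad \<Phi> y)) \<le> M * (\<bar>\<Omega> y\<bar> * norm (U y))" for y
            using mult_left_mono[OF order_trans[OF Cauchy_Schwarz_ineq2 mult_left_mono[OF M(2)[of y] norm_ge_zero[of "U y"]]] abs_ge_zero[of "\<Omega> y"]]
            by (simp add: abs_mult ac_simps)
          show "\<Omega> y * (U y \<bullet> grad \<Phi> y) = 0" if "y \<notin> cball 0 R" for y
            using R[of y] that by (cases "grad \<Phi> y = 0") auto
        qed (use M in auto)
      qed
      have rs: "t powr (- b) *\<^sub>R (r *\<^sub>R y) = y" for y :: "real ^ 2"
        using t by (simp add: r_def powr_minus)
      \<comment> \<open>The scaling factors t^(-1) of the vorticity and t^(-(1-b)) of the velocity
        combine to t^(-2) t^b, and t^b is the chain-rule factor contained in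
        \<open>grad \<Phi>\<close>.\<close>
      have Fr: "F t (r *\<^sub>R y) = t powr (- 1) * (\<Omega> y * \<Phi>' y) + t powr (- 2) * (\<Omega> y * (U y \<bullet> grad \<Phi> y))" for y
      proof -
        have "t powr (- 1) * t powr (- (1 - b)) = t powr (- 2) * r"
          unfolding r_def by (simp only: powr_add[symmetric]) simp
        moreover have "t powr (- 1) * \<Omega> y * (t powr (- (1 - b)) * ?D (t, r *\<^sub>R y) (0, U y))
           = (t powr (- 1) * t powr (- (1 - b))) * (\<Omega> y * ?D (t, r *\<^sub>R y) (0, U y))"
          by (simp only: mult_ac)
        ultimately have "t powr (- 1) * \<Omega> y * (t powr (- (1 - b)) * ?D (t, r *\<^sub>R y) (0, U y))
           = t powr (- 2) * (\<Omega> y * (r * ?D (t, r *\<^sub>R y) (0, U y)))"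
          by (simp only: mult_ac)
        then show ?thesis
          unfolding F_def w_def v_def rs gr frechet_derivative_scale_snd[OF s] \<Phi>'_def real_scaleR_def
          by (simp only: mult.assoc)
      qed
      have Ftm: "(\<lambda>x. F t x) \<in> borel_measurable borel"
        using measurable_compose[of "\<lambda>x. (t, x)" borel borel, OF _ Fm] by simp
      have r2: "\<bar>r\<bar> ^ DIM(real ^ 2) = t powr (2 * b)"
        unfolding r_def by (simp only: mult_2 powr_add) (simp add: power2_eq_square)
      have p1: "t powr (2 * b) * t powr (- 1) = t powr (2 * b - 1)"
        and p2: "t powr (2 * b) * t powr (- 2) = t powr (2 * b - 2)"
        and p3: "t powr (2 * b - 2) * r = t powr (3 * b - 2)"
        unfolding r_def by (simp_all only: powr_add[symmetric]) simp_all
      have "(\<integral>x. F t x \<partial>lborel) = t powr (2 * b) * (\<integral>y. F t (r *\<^sub>R y) \<partial>lborel)"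
        using integral_lborel_scaleR[OF Ftm, of r] r unfolding r2 by simp
      also have "(\<integral>y. F t (r *\<^sub>R y) \<partial>lborel) = t powr (- 1) * (\<integral>y. \<Omega> y * \<Phi>' y \<partial>lborel)
          + t powr (- 2) * (\<integral>y. \<Omega> y * (U y \<bullet> grad \<Phi> y) \<partial>lborel)"
        unfolding Fr using int[OF \<Phi>'] intU by simp
      also have "t powr (2 * b) * \<dots> = t powr (2 * b - 1) * (\<integral>y. \<Omega> y * \<Phi>' y \<partial>lborel)
          + t powr (2 * b - 2) * (\<integral>y. \<Omega> y * (U y \<bullet> grad \<Phi> y) \<partial>lborel)"
        unfolding p1[symmetric] p2[symmetric] by (simp only: distrib_left mult.assoc)
      \<comment> \<open>The profile equation enters here. Its two linear terms are those that arise
        from differentiating the weight t^(2b-1) and the argument t^b y.\<close>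
      also have "\<dots> = t powr (2 * b - 1) * (\<integral>y. \<Omega> y * \<Phi>' y \<partial>lborel)
          + t powr (2 * b - 2) * ((2 * b - 1) * (\<integral>y. \<Omega> y * \<Phi> y \<partial>lborel) + b * (\<integral>y. \<Omega> y * (y \<bullet> grad \<Phi> y) \<partial>lborel))"
        using eq[OF \<Phi>] unfolding b by simp
      also have "\<dots> = (\<integral>y. t powr (2 * b - 1) * (\<Omega> y * \<Phi>' y)
          + t powr (2 * b - 2) * ((2 * b - 1) * (\<Omega> y * \<Phi> y) + b * (\<Omega> y * (y \<bullet> grad \<Phi> y))) \<partial>lborel)"
        using int[OF \<Phi>'] int[OF \<Phi>] int[OF test_fun_radial_derivative[OF \<Phi>]] by simp
      also have "\<dots> = (\<integral>y. \<Omega> y * ?H t y \<partial>lborel)"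
      proof (intro Bochner_Integration.integral_cong refl)
        fix y
        show "t powr (2 * b - 1) * (\<Omega> y * \<Phi>' y) + t powr (2 * b - 2) * ((2 * b - 1) * (\<Omega> y * \<Phi> y) + b * (\<Omega> y * (y \<bullet> grad \<Phi> y)))
          = \<Omega> y * ?H t y"
        proof -
          have "A * (x * p) + B * (k * (x * q) + b * (x * (r * d))) = x * (A * p + k * B * q + b * (B * r) * d)"
            for A B x p q k d :: real
            by algebra
          then show ?thesis
            unfolding slice_derivative_def gr p3[symmetric] \<Phi>_def \<Phi>'_def r_def[symmetric] .
        qed
      qed
      finally show ?thesis .
    qed

    have "(\<integral>(t, x). F t x \<partial>lborel) = (\<integral>t. \<integral>x. F t x \<partial>lborel \<partial>lborel)"
      using lborel_pair.integral_fst'[OF iF] by (simp add: lborel_prod case_prod_beta)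
    also have "\<dots> = (\<integral>t. \<integral>y. \<Omega> y * ?H t y \<partial>lborel \<partial>lborel)"
      by (simp only: slice)
    \<comment> \<open>With t as the inner variable, \<Omega>(y) is a constant factor and only a
      smooth function of time remains to be integrated.\<close>
    also have "\<dots> = (\<integral>y. \<integral>t. \<Omega> y * ?H t y \<partial>lborel \<partial>lborel)"
      by (rule lborel_pair.Fubini_integral[OF iG, symmetric])
    also have "\<dots> = 0"
      using integral_slice_derivative[OF s lB(1,2) zt] by simp
    finally show ?thesis by (simp add: F_def)
  qed
  ultimately show ?thesis
    unfolding weak_transport_def wv by blast
qed

section \<open>The three conclusions for the vanishing-dissipation limit\<close>

theorem corollary1p5:
  fixes a :: real
    and C :: "real \<Rightarrow> real" and C' :: "real \<Rightarrow> (real ^ 2 \<Rightarrow> real ^ 2) \<Rightarrow> real"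
    and u0 :: "real ^ 2 \<Rightarrow> real ^ 2" and \<omega>0 :: "real ^ 2 \<Rightarrow> real"
    and U\<epsilon> :: "real \<Rightarrow> real ^ 2 \<Rightarrow> real ^ 2" and P\<epsilon> :: "real \<Rightarrow> real ^ 2 \<Rightarrow> real"
    and U :: "real ^ 2 \<Rightarrow> real ^ 2" and \<Omega> P :: "real ^ 2 \<Rightarrow> real"
  assumes "0 < a" and "a < 1 / 2"
    and "homogeneous_datum a u0" and "weak_curl u0 \<omega>0"
    and "dissipative_profiles C C' a u0 \<omega>0 U\<epsilon> P\<epsilon>"
    and "vanishing_dissipation_limit a U\<epsilon> P\<epsilon> U \<Omega> P"
    and "euler_profile_properties a U P"
  shows "loc_integrable_on UNIV (\<lambda>y. \<Omega> y *\<^sub>R U y)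
    \<and> (\<forall>\<psi>\<in>test_fun UNIV.
          (\<integral>y. \<Omega> y * ((U y - y /\<^sub>R (1 + a)) \<bullet> grad \<psi> y) \<partial>lborel)
          = (2 / (1 + a) - 1) * (\<integral>y. \<Omega> y * \<psi> y \<partial>lborel))
    \<and> weak_transport (velocity_field a U) (vorticity_field a \<Omega>)"
proof -
  note a = assms(1,2)
  \<comment> \<open>Each of the two inequalities is equivalent to a < 1/2 for positive a.\<close>
  have p: "4 / 3 < p_c a" and q: "4 < q_c a"
    using a by (auto simp: p_c_def q_c_def field_simps)
  have U: "U \<in> weakL (q_c a)" and eq: "euler_profile_eq a U P"
    using assms(7) by (auto simp: euler_profile_properties_def)
  obtain e where e: "\<And>n :: nat. e n \<in> {0<..1}" and L2: "L2_loc_tendsto (\<lambda>n. U\<epsilon> (e n)) U sequentially"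
    and ws: "weak_star_tendsto (p_c a) (\<lambda>n. curl (U\<epsilon> (e n))) \<Omega> sequentially"
    and curl: "weak_curl U \<Omega>"
    using assms(6) unfolding vanishing_dissipation_limit_def by blast
  have \<Omega>: "\<Omega> \<in> weakL (p_c a)" using ws by (simp add: weak_star_tendsto_def)
  note D = assms(5)[unfolded dissipative_profiles_def, rule_format]
  \<comment> \<open>Weak-star convergence to the datum, taken at \<epsilon> = 1, includes membership
    of the limit; without a finite norm of \<omega>0 the uniform vorticity bound would say
    nothing.\<close>
  have "\<omega>0 \<in> weakL (p_c a)"
    using D[of 1] by (simp add: weak_star_tendsto_def)
  then obtain w where w: "w \<ge> 0" "weakL_norm (p_c a) \<omega>0 \<le> ennreal w" by (rule weakL_norm_bound)
  \<comment> \<open>One constant for both norms. The constants \<open>C a\<close> and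
    \<open>C' a u0\<close> are arbitrary reals, and \<open>ennreal\<close> sends negative ones to 0,
    hence the maxima.\<close>
  define N where "N = max 0 (C a) * w + max 0 (C' a u0)"
  have N0: "N \<ge> 0" using w by (simp add: N_def)
  have N1: "weakL_norm (p_c a) (curl (U\<epsilon> (e n))) \<le> ennreal N" for n
  proof -
    have "weakL_norm (p_c a) (curl (U\<epsilon> (e n))) \<le> ennreal (C a) * weakL_norm (p_c a) \<omega>0"
      using D[OF e] by blast
    also have "\<dots> \<le> ennreal (max 0 (C a)) * ennreal w"
      using w by (intro mult_mono ennreal_leI) auto
    also have "\<dots> = ennreal (max 0 (C a) * w)" using w by (simp add: ennreal_mult)
    also have "\<dots> \<le> ennreal N" by (intro ennreal_leI) (simp add: N_def)
    finally show ?thesis .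
  qed
  have N2: "weakL_norm (q_c a) (U\<epsilon> (e n)) \<le> ennreal N" for n
  proof -
    have "weakL_norm (q_c a) (U\<epsilon> (e n)) \<le> weakL_norm (q_c a) (U\<epsilon> (e n))
        + weakL_norm (p_c a) (\<lambda>y. jacobian (U\<epsilon> (e n)) (at y)) + weakL_norm (1 / a) (P\<epsilon> (e n))"
      by (simp add: add.assoc)
    also have "\<dots> \<le> ennreal (C' a u0)"
      using D[OF e] by blast
    also have "\<dots> \<le> ennreal N" using w by (intro ennreal_leI) (auto simp: N_def intro: add_increasing)
    finally show ?thesis .
  qed
  have W: "smooth (U\<epsilon> (e n))" "divergence (U\<epsilon> (e n)) y = 0" for n y
    using D[OF e] unfolding dissipative_profile_eq_def by blast+
  have vort: "(\<integral>x. \<Omega> x * (U x \<bullet> grad \<psi> x) \<partial>lborel) =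
      (2 / (1 + a) - 1) * (\<integral>x. \<Omega> x * \<psi> x \<partial>lborel) + (1 / (1 + a)) * (\<integral>x. \<Omega> x * (x \<bullet> grad \<psi> x) \<partial>lborel)"
    if "\<psi> \<in> test_fun UNIV" for \<psi>
    by (rule profile_vorticity_equation[OF a(1) U q curl eq that
        vorticity_flux_limit[OF p q W N0 N1 N2 U \<Omega> L2 ws that]])
  note [measurable] = weakL_borel[OF U] weakL_borel[OF \<Omega>]
  have finU: "(\<integral>\<^sup>+y\<in>K. ennreal (\<bar>\<Omega> y\<bar> * norm (U y)) \<partial>lborel) < \<infinity>" if "compact K" for K
    using weakL_product_finite[OF \<Omega> p U q borel_compact[OF that] compact_emeasure_finite[OF that]] by simp
  have fin: "(\<integral>\<^sup>+y\<in>K. ennreal \<bar>\<Omega> y\<bar> \<partial>lborel) < \<infinity>" if "compact K" for K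
    using weakL_moment_finite[OF \<Omega> _ _ borel_compact[OF that] compact_emeasure_finite[OF that], of 1] p by simp

  have loc: "loc_integrable_on UNIV (\<lambda>y. \<Omega> y *\<^sub>R U y)"
    unfolding loc_integrable_on_def set_integrable_def
  proof (intro allI impI, elim conjE)
    fix K :: "(real ^ 2) set" assume K: "compact K"
    have [measurable]: "K \<in> sets borel" using borel_compact[OF K] .
    show "integrable lborel (\<lambda>y. indicator K y *\<^sub>R \<Omega> y *\<^sub>R U y)"
    proof (rule integrable_support_bound(1)[OF _ zero_le_one _ _ finU[OF K]])
      show "(\<lambda>y. indicator K y *\<^sub>R \<Omega> y *\<^sub>R U y) \<in> borel_measurable borel"
        "(\<lambda>y. \<bar>\<Omega> y\<bar> * norm (U y)) \<in> borel_measurable borel" "K \<in> sets borel"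
        by measurable
    qed (auto simp: indicator_def)
  qed
  have profile: "(\<integral>y. \<Omega> y * ((U y - y /\<^sub>R (1 + a)) \<bullet> grad \<psi> y) \<partial>lborel)
      = (2 / (1 + a) - 1) * (\<integral>y. \<Omega> y * \<psi> y \<partial>lborel)" if \<psi>: "\<psi> \<in> test_fun UNIV" for \<psi>
  proof -
    obtain K where K: "compact K" "\<And>x. x \<notin> K \<Longrightarrow> grad \<psi> x = 0"
      using test_fun_support[OF test_fun_grad[OF \<psi>]] by metis
    obtain c where c: "c > 0" "\<And>x. norm (grad \<psi> x) \<le> c" using test_fun_bounded_range[OF test_fun_grad[OF \<psi>]] by blast
    obtain c' where c': "c' > 0" "\<And>x. \<bar>x \<bullet> grad \<psi> x\<bar> \<le> c'"
      using test_fun_bounded_range[OF test_fun_radial_derivative[OF \<psi>]] by auto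
    have [measurable]: "grad \<psi> \<in> borel_measurable borel" by (rule test_fun_borel[OF test_fun_grad[OF \<psi>]])
    have i1: "integrable lborel (\<lambda>y. \<Omega> y * (U y \<bullet> grad \<psi> y))"
    proof (rule integrable_support_bound(1)[OF _ less_imp_le[OF c(1)] _ _ finU[OF K(1)]])
      show "(\<lambda>y. \<Omega> y * (U y \<bullet> grad \<psi> y)) \<in> borel_measurable borel"
        "(\<lambda>y. \<bar>\<Omega> y\<bar> * norm (U y)) \<in> borel_measurable borel" by measurable
      show "norm (\<Omega> y * (U y \<bullet> grad \<psi> y)) \<le> c * (\<bar>\<Omega> y\<bar> * norm (U y))" for y
        using mult_left_mono[OF order_trans[OF Cauchy_Schwarz_ineq2 mult_left_mono[OF c(2)[of y] norm_ge_zero[of "U y"]]] abs_ge_zero[of "\<Omega> y"]]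
        by (simp add: abs_mult ac_simps)
    qed (use K in \<open>auto intro: borel_compact\<close>)
    have i2: "integrable lborel (\<lambda>y. \<Omega> y * (y \<bullet> grad \<psi> y))"
    proof (rule integrable_support_bound(1)[OF _ less_imp_le[OF c'(1)] _ _ fin[OF K(1)]])
      show "(\<lambda>y. \<Omega> y * (y \<bullet> grad \<psi> y)) \<in> borel_measurable borel"
        "(\<lambda>y. \<bar>\<Omega> y\<bar>) \<in> borel_measurable borel" by measurable
      show "norm (\<Omega> y * (y \<bullet> grad \<psi> y)) \<le> c' * \<bar>\<Omega> y\<bar>" for y
        using mult_left_mono[OF c'(2)[of y] abs_ge_zero[of "\<Omega> y"]] by (simp add: abs_mult mult.commute)
    qed (use K in \<open>auto intro: borel_compact\<close>)
    have "\<Omega> y * ((U y - y /\<^sub>R (1 + a)) \<bullet> grad \<psi> y) = \<Omega> y * (U y \<bullet> grad \<psi> y) - (1 / (1 + a)) * (\<Omega> y * (y \<bullet> grad \<psi> y))" for y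
      by (simp add: inner_diff_left right_diff_distrib inverse_eq_divide)
    then have "(\<integral>y. \<Omega> y * ((U y - y /\<^sub>R (1 + a)) \<bullet> grad \<psi> y) \<partial>lborel)
      = (\<integral>y. \<Omega> y * (U y \<bullet> grad \<psi> y) \<partial>lborel) - (1 / (1 + a)) * (\<integral>y. \<Omega> y * (y \<bullet> grad \<psi> y) \<partial>lborel)"
      using i1 i2 by simp
    then show ?thesis using vort[OF \<psi>] by (simp only: add_diff_cancel_right')
  qed
  have "weak_transport (velocity_field a U) (vorticity_field a \<Omega>)"
    by (rule self_similar_transport[OF a(1) weakL_borel[OF U] weakL_borel[OF \<Omega>]
          fin[OF compact_cball] finU[OF compact_cball] vort])
  with loc profile show ?thesis by blast
qed

end
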